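(* Let $P\in\mathcal M_N(\mathbb R)$ be a stochastic strongly connected matrix, $\nu$ a probability vector of $\mathbb R^N$, and $\mu>0$. Let $A=(A_1,\dots,A_N)\in\mathcal M_d(\mathbb R)^N$ be irreducible and let $\|\cdot\|_{\mathrm e}$ be an extremal norm for $A$. Then the following statements are equivalent: (a) $\lambda_{\mathrm d}(A)=\lambda_{\mathrm p}(\nu,\mu,P,A)$. (b) For every $k\in\mathbb N$, $i_1,\dots,i_k\in\{1,\dots,N\}$, and $t_1,\dots,t_k\geq0$, one has $\bigl\|e^{A_{i_k}t_k}\cdots e^{A_{i_1}t_1}\bigr\|_{\mathrm e}=e^{\lambda_{\mathrm d}(A)(t_1+\dots+t_k)}$. (c) For every $k\in\mathbb N$, $i_1,\dots,i_k\in\{1,\dots,N\}$, and $t_1,\dots,t_k\geq0$, one has $\rho\bigl(e^{A_{i_k}t_k}\cdots e^{A_{i_1}t_1}\bigr)=e^{\lambda_{\mathrm d}(A)(t_1+\dots+t_k)}$. (d) Up to a common change of basis (i.e., after conjugating all matrices by one common invertible matrix), the matrices $A_i-\lambda_{\mathrm d}(A)\,\mathrm{Id}$, $i\in\{1,\dots,N\}$, are skew-symmetric.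
   Context: $\mathbb N$ is the set of positive integers; $d,N\in\mathbb N$; $\mathcal M_d(\mathbb R)$ is the space of real $d\times d$ matrices; $\rho(\cdot)$ is the spectral radius; $\|\cdot\|$ is an operator norm on $\mathcal M_d(\mathbb R)$ induced by a norm on $\mathbb R^d$. $\Sigma$ is the set of piecewise constant right-continuous functions $\sigma:[0,\infty)\to\{1,\dots,N\}$; $\Phi_\sigma(t)$ is the flow of $\dot x=A_{\sigma(t)}x$ with $\Phi_\sigma(0)=\mathrm{Id}$. $A$ is irreducible if the only subspaces of $\mathbb R^d$ invariant by all $A_i$ are $\{0\}$ and $\mathbb R^d$. A stochastic matrix is strongly connected if its associated directed graph is strongly connected. $\lambda_{\mathrm d}(A)=\limsup_{t\to\infty}\frac1t\sup_{\sigma\in\Sigma}\log\|\Phi_\sigma(t)\|$. A norm $\|\cdot\|_{\mathrm e}$ on $\mathcal M_d(\mathbb R)$, induced by a norm on $\mathbb R^d$, is extremal for $A$ if $\|\Phi_\sigma(t)\|_{\mathrm e}\leq e^{\lambda_{\mathrm d}(A)t}$ for every $\sigma\in\Sigma$ and $t\geq0$. The Markov process $(\nu,\mu,P)$, with $P=(p_{ij})$, is the continuous-time Markov chain $\sigma$ on $\{1,\dots,N\}$ with initial law $\nu$, transition matrix $P$ and jump rate $\mu$ (independent exponential inter-jump times of parameter $\mu$; at each jump, $i\to j$ with probability $p_{ij}$, trivial jumps allowed), and $\lambda_{\mathrm p}(\nu,\mu,P,A)=\limsup_{t\to+\infty}\frac1t\mathbb E[\log\|\Phi_\sigma(t)\|]$.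 *)

theory Defs
  imports "HOL-Probability.Probability"
begin

section \<open>Norms, matrix exponential and spectral radius\<close>

text \<open>The componentwise \<open>*\<close> and \<open>^\<close> of the \<open>vec\<close> type must not be
  confused with the matrix product \<open>**\<close>; matrix powers and the matrix exponential are therefore
  introduced explicitly.\<close>

definition is_norm :: "('v::real_vector \<Rightarrow> real) \<Rightarrow> bool" where
  "is_norm v \<longleftrightarrow>
     (\<forall>x. 0 \<le> v x) \<and>
     (\<forall>x. v x = 0 \<longleftrightarrow> x = 0) \<and>
     (\<forall>c x. v (c *\<^sub>R x) = \<bar>c\<bar> * v x) \<and>
     (\<forall>x y. v (x + y) \<le> v x + v y)"

text \<open>Same shape as the library constant \<open>onorm\<close>, for an arbitrary norm \<open>v\<close>
  (the term for \<open>x = 0\<close> is \<open>0 / 0 = 0\<close>).\<close>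

definition opnorm :: "(real^'d \<Rightarrow> real) \<Rightarrow> real^'d^'d \<Rightarrow> real" where
  "opnorm v M = (SUP x. v (M *v x) / v x)"

primrec mpow :: "real^'d^'d \<Rightarrow> nat \<Rightarrow> real^'d^'d" where
  "mpow M 0 = mat 1"
| "mpow M (Suc n) = M ** mpow M n"

definition mexp :: "real^'d^'d \<Rightarrow> real^'d^'d" where
  "mexp M = (\<Sum>n. (1 / fact n) *\<^sub>R mpow M n)"

definition eigenvalues :: "real^'d^'d \<Rightarrow> complex set" where
  "eigenvalues M =
     {z. \<exists>x :: complex^'d. x \<noteq> 0 \<and> (\<chi> i j. complex_of_real (M $ i $ j)) *v x = z *s x}"

definition spectral_radius :: "real^'d^'d \<Rightarrow> real" where
  "spectral_radius M = Max (cmod ` eigenvalues M)"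

definition skew_symmetric :: "real^'d^'d \<Rightarrow> bool" where
  "skew_symmetric M \<longleftrightarrow> transpose M = - M"

definition irreducible_family :: "('n \<Rightarrow> real^'d^'d) \<Rightarrow> bool" where
  "irreducible_family A \<longleftrightarrow>
     (\<forall>S. subspace S \<and> (\<forall>i. \<forall>x\<in>S. A i *v x \<in> S) \<longrightarrow> S = {0} \<or> S = UNIV)"


section \<open>Switching signals and the flow\<close>

definition jump_times :: "(real \<Rightarrow> 'n) \<Rightarrow> real set" where
  "jump_times \<sigma> = {t. 0 < t \<and> \<not> (\<forall>\<^sub>F s in at t. \<sigma> s = \<sigma> t)}"

text \<open>Signals are functions on \<open>[0,\<infinity>)\<close>; their values at negative times are irrelevant.
  Right-continuity is with respect to the discrete topology on the modes, and piecewise constant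
  means finitely many jumps in every bounded interval.\<close>

definition switching_signals :: "(real \<Rightarrow> 'n) set" where
  "switching_signals =
     {\<sigma>. (\<forall>t\<ge>0. \<forall>\<^sub>F s in at_right t. \<sigma> s = \<sigma> t) \<and> (\<forall>T. finite (jump_times \<sigma> \<inter> {..T}))}"

definition is_flow ::
    "('n \<Rightarrow> real^'d^'d) \<Rightarrow> (real \<Rightarrow> 'n) \<Rightarrow> (real \<Rightarrow> real^'d^'d) \<Rightarrow> bool" where
  "is_flow A \<sigma> \<Phi> \<longleftrightarrow>
     \<Phi> 0 = mat 1 \<and>
     continuous_on {0..} \<Phi> \<and>
     (\<forall>t>0. t \<notin> jump_times \<sigma> \<longrightarrow> (\<Phi> has_vector_derivative (A (\<sigma> t) ** \<Phi> t)) (at t))"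

text \<open>For \<open>\<sigma> \<in> switching_signals\<close> a solution exists and is unique on \<open>[0,\<infinity>)\<close>;
  the choice only affects the irrelevant values at negative times.\<close>

definition flow :: "('n \<Rightarrow> real^'d^'d) \<Rightarrow> (real \<Rightarrow> 'n) \<Rightarrow> real \<Rightarrow> real^'d^'d" where
  "flow A \<sigma> = (SOME \<Phi>. is_flow A \<sigma> \<Phi>)"

text \<open>\<open>switched_prod A i t k\<close> is $e^{A_{i_k} t_k} \cdots e^{A_{i_1} t_1}$; the entries of the
  sequences at index 0 are not used.\<close>

primrec switched_prod ::
    "('n \<Rightarrow> real^'d^'d) \<Rightarrow> (nat \<Rightarrow> 'n) \<Rightarrow> (nat \<Rightarrow> real) \<Rightarrow> nat \<Rightarrow> real^'d^'d" where
  "switched_prod A i t 0 = mat 1"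
| "switched_prod A i t (Suc k) = mexp (t (Suc k) *\<^sub>R A (i (Suc k))) ** switched_prod A i t k"


section \<open>Deterministic Lyapunov exponent and extremal norms\<close>

text \<open>For a norm \<open>v\<close> the upper limit is finite, since
  $e^{-Ct} \le \|\Phi_\sigma(t)\| \le e^{Ct}$ up to constants, uniformly in $\sigma$;
  so \<open>real_of_ereal\<close> loses nothing here or in \<open>lambda_p\<close> below.\<close>

definition lambda_d :: "(real^'d \<Rightarrow> real) \<Rightarrow> ('n \<Rightarrow> real^'d^'d) \<Rightarrow> real" where
  "lambda_d v A = real_of_ereal (Limsup at_top (\<lambda>t::real.
     ereal (1 / t) * (SUP \<sigma>\<in>switching_signals. ereal (ln (opnorm v (flow A \<sigma> t))))))"

text \<open>The extremal norm \<open>opnorm e\<close> is induced by \<open>e\<close>; the norm \<open>v\<close> is the reference norm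
  used in the definition of the Lyapunov exponent.\<close>

definition extremal_norm ::
    "(real^'d \<Rightarrow> real) \<Rightarrow> ('n \<Rightarrow> real^'d^'d) \<Rightarrow> (real^'d \<Rightarrow> real) \<Rightarrow> bool" where
  "extremal_norm v A e \<longleftrightarrow>
     is_norm e \<and>
     (\<forall>\<sigma>\<in>switching_signals. \<forall>t\<ge>0. opnorm e (flow A \<sigma> t) \<le> exp (lambda_d v A * t))"


section \<open>Random switching\<close>

definition probability_vector :: "real^'n \<Rightarrow> bool" where
  "probability_vector \<nu> \<longleftrightarrow> (\<forall>i. 0 \<le> \<nu> $ i) \<and> (\<Sum>i\<in>UNIV. \<nu> $ i) = 1"

definition stochastic_matrix :: "real^'n^'n \<Rightarrow> bool" where
  "stochastic_matrix P \<longleftrightarrow> (\<forall>i j. 0 \<le> P $ i $ j) \<and> (\<forall>i. (\<Sum>j\<in>UNIV. P $ i $ j) = 1)"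

definition strongly_connected_matrix :: "real^'n^'n \<Rightarrow> bool" where
  "strongly_connected_matrix P \<longleftrightarrow> (\<forall>i j. (i, j) \<in> {(k, l). 0 < P $ k $ l}\<^sup>*)"

text \<open>A realisation, on the probability space \<open>M\<close>, of the continuous-time Markov chain with
  initial law \<open>\<nu>\<close>, jump rate \<open>\<mu>\<close> and transition matrix \<open>P\<close>: \<open>Z\<close> is the embedded
  discrete-time chain and \<open>\<tau> n\<close> the holding time in \<open>Z n\<close>. The null set on which some holding
  time vanishes or infinitely many jumps accumulate is assumed to have been discarded, so that every
  trajectory is in \<open>switching_signals\<close>.\<close>

definition markov_process ::
    "'a measure \<Rightarrow> real^'n \<Rightarrow> real \<Rightarrow> real^'n^'n \<Rightarrow> ('a \<Rightarrow> real \<Rightarrow> 'n) \<Rightarrow> bool" where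
  "markov_process M \<nu> \<mu> P \<sigma> \<longleftrightarrow>
     prob_space M \<and>
     (\<exists>(Z :: nat \<Rightarrow> 'a \<Rightarrow> 'n) (\<tau> :: nat \<Rightarrow> 'a \<Rightarrow> real).
        (\<forall>n. Z n \<in> M \<rightarrow>\<^sub>M count_space UNIV) \<and>
        (\<forall>n z. measure M {\<omega>\<in>space M. \<forall>k\<le>n. Z k \<omega> = z k} =
           \<nu> $ z 0 * (\<Prod>k<n. P $ z k $ z (Suc k))) \<and>
        (\<forall>n. distributed M lborel (\<tau> n) (exponential_density \<mu>)) \<and>
        prob_space.indep_vars M (\<lambda>_. borel) \<tau> UNIV \<and>
        prob_space.indep_set M
          (sets (vimage_algebra (space M) (\<lambda>\<omega> n. Z n \<omega>) (PiM UNIV (\<lambda>_. count_space UNIV))))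
          (sets (vimage_algebra (space M) (\<lambda>\<omega> n. \<tau> n \<omega>) (PiM UNIV (\<lambda>_. borel)))) \<and>
        (\<forall>\<omega>\<in>space M. (\<forall>n. 0 < \<tau> n \<omega>) \<and>
           filterlim (\<lambda>n. \<Sum>k<n. \<tau> k \<omega>) at_top sequentially) \<and>
        (\<forall>\<omega>\<in>space M. \<forall>n t.
           (\<Sum>k<n. \<tau> k \<omega>) \<le> t \<and> t < (\<Sum>k<Suc n. \<tau> k \<omega>) \<longrightarrow> \<sigma> \<omega> t = Z n \<omega>))"

definition lambda_p ::
    "(real^'d \<Rightarrow> real) \<Rightarrow> 'a measure \<Rightarrow> ('a \<Rightarrow> real \<Rightarrow> 'n) \<Rightarrow> ('n \<Rightarrow> real^'d^'d) \<Rightarrow> real" where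
  "lambda_p v M \<sigma> A = real_of_ereal (Limsup at_top (\<lambda>t::real.
     ereal (1 / t * (LINT \<omega>|M. ln (opnorm v (flow A (\<sigma> \<omega>) t))))))"

end

theory Submission
  imports Defs "HOL-Complex_Analysis.Cauchy_Integral_Formula"
    "HOL-Computational_Algebra.Fundamental_Theorem_Algebra"
begin

text \<open>
  Subtracting \<open>\<lambda> = lambda_d v A\<close> from every \<open>A i\<close> multiplies a product of exponentials of total
  duration \<open>t\<close> by \<open>exp (- \<lambda> t)\<close>. For the shifted matrices \<open>B i\<close> extremality says that the semigroup
  \<open>S\<close> generated by the matrices \<open>mexp (t *\<^sub>R B i)\<close> with \<open>t \<ge> 0\<close> consists of elements of \<open>e\<close>-norm at
  most one; this is the only way in which the deterministic exponent enters
  (\<open>extremal_norm_opnorm_le_one\<close>). Condition (b) becomes: all norms on \<open>S\<close> are one. Condition (c)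
  becomes: all spectral radii on \<open>S\<close> are one (\<open>switched_prod_characterization\<close>).

  (b) implies (d). The closure \<open>K\<close> of \<open>S\<close> is a compact semigroup that does not contain zero. Powers
  of an element of minimal rank accumulate at an idempotent \<open>E\<close>, and \<open>E K E\<close> is a compact group
  with unit \<open>E\<close> (\<open>minimal_rank_group\<close>), so it preserves a quadratic form \<open>H\<close> that is positive
  definite on the range of \<open>E\<close> (\<open>bounded_group_invariant_form\<close>). For \<open>V\<close> in \<open>K\<close> and \<open>W\<close> in \<open>S\<close> one
  gets \<open>H(E V W E x) = H(E x)\<close>. The left-hand side is an entire function of each of the durations in
  \<open>W\<close>, so the identity persists when the durations are allowed to be negative. By irreducibility
  the observations \<open>E V\<close> separate points, and the vectors with bounded orbit, an invariant subspace
  containing the range of \<open>E\<close>, fill the space; hence the whole group generated by the flows is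
  bounded (\<open>flow_group_bounded\<close>). A second use of the invariant form, now for a group of invertible matrices, gives
  a basis in which all \<open>mexp (t *\<^sub>R B i)\<close> are orthogonal and all \<open>B i\<close> skew-symmetric.

  (d) implies (c) because isometries only have eigenvalues of modulus one, and (c) implies (b)
  because a matrix of norm below one has powers tending to zero.

  (a) is equivalent to (b). Up to a bounded error, which disappears after division by \<open>t\<close>, the
  exponent may be computed with the norm \<open>e\<close>; then (b) makes the logarithm of the norm of the random
  flow equal to \<open>\<lambda> t\<close>. Conversely, if some product of exponentials has norm \<open>< 1\<close>, strong
  connectedness allows the chain to follow that product approximately from any state, with probability
  bounded below, inside any block of \<open>m\<close> consecutive jumps. In expectation a positive
  proportion of the blocks completed before time \<open>t\<close> contracts by a fixed factor
  (\<open>expected_log_of_contraction\<close>), so the probabilistic exponent is smaller than \<open>\<lambda>\<close>.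
\<close>

section \<open>Norms and induced matrix norms\<close>

lemma bounded_bilinear_matrix_mult:
  "bounded_bilinear ((**) :: real^'n^'m \<Rightarrow> real^'k^'n \<Rightarrow> real^'k^'m)"
  unfolding bilinear_conv_bounded_bilinear[symmetric] bilinear_def linear_iff
  by (auto simp: matrix_matrix_mult_def vec_eq_iff sum.distrib sum_distrib_left algebra_simps)

lemma bounded_bilinear_matrix_vector_mult:
  "bounded_bilinear ((*v) :: real^'n^'m \<Rightarrow> real^'n \<Rightarrow> real^'m)"
  unfolding bilinear_conv_bounded_bilinear[symmetric] bilinear_def linear_iff
  by (auto simp: matrix_vector_mult_def vec_eq_iff sum.distrib sum_distrib_left algebra_simps)

lemma bounded_linear_transpose: "bounded_linear (transpose :: real^'n^'m \<Rightarrow> real^'m^'n)"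
  unfolding linear_conv_bounded_linear[symmetric] linear_iff
  by (auto simp: transpose_def vec_eq_iff)

lemmas tendsto_matrix_mult = bounded_bilinear.tendsto[OF bounded_bilinear_matrix_mult]
lemmas continuous_on_matrix_mult = bounded_bilinear.continuous_on[OF bounded_bilinear_matrix_mult]
lemmas continuous_on_matrix_vector_mult =
  bounded_bilinear.continuous_on[OF bounded_bilinear_matrix_vector_mult]
lemmas continuous_on_transpose = bounded_linear.continuous_on[OF bounded_linear_transpose]
lemmas matrix_minus_left = bounded_bilinear.minus_left[OF bounded_bilinear_matrix_mult]
lemmas matrix_diff_left = bounded_bilinear.diff_left[OF bounded_bilinear_matrix_mult]
lemmas matrix_diff_right = bounded_bilinear.diff_right[OF bounded_bilinear_matrix_mult]
lemmas matrix_scaleR_left = bounded_bilinear.scaleR_left[OF bounded_bilinear_matrix_mult]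
lemmas matrix_scaleR_right = bounded_bilinear.scaleR_right[OF bounded_bilinear_matrix_mult]
lemmas has_vector_derivative_matrix_mult =
  bounded_bilinear.has_vector_derivative[OF bounded_bilinear_matrix_mult]

lemma matrix_vector_scaleR_left: "(c *\<^sub>R M) *v x = c *\<^sub>R (M *v (x::real^'n))"
  by (simp add: scaleR_matrix_vector_assoc)

lemma
  assumes "is_norm v"
  shows is_norm_nonneg: "0 \<le> v x" and is_norm_eq_0: "v x = 0 \<longleftrightarrow> x = 0"
    and is_norm_scaleR: "v (c *\<^sub>R x) = \<bar>c\<bar> * v x" and is_norm_triangle: "v (x + y) \<le> v x + v y"
  using assms by (auto simp: is_norm_def)

lemma is_norm_pos: "is_norm v \<Longrightarrow> x \<noteq> 0 \<Longrightarrow> 0 < v x"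
  by (metis is_norm_eq_0 is_norm_nonneg order_le_less)

lemma is_norm_zero: "is_norm v \<Longrightarrow> v 0 = 0"
  by (simp add: is_norm_eq_0)

lemma is_norm_minus: "is_norm v \<Longrightarrow> v (- x) = v x"
  using is_norm_scaleR[of v "-1" x] by simp

lemma is_norm_sum:
  assumes "is_norm v" shows "v (sum f I) \<le> (\<Sum>i\<in>I. v (f i))"
proof (induction I rule: infinite_finite_induct)
  case (insert x F)
  then show ?case using is_norm_triangle[OF assms, of "f x" "sum f F"] by simp
qed (simp_all add: is_norm_zero assms)

lemma is_norm_diff_abs:
  assumes "is_norm v" shows "\<bar>v x - v y\<bar> \<le> v (x - y)"
  using is_norm_triangle[OF assms, of "x - y" y] is_norm_triangle[OF assms, of "y - x" x]
    is_norm_minus[OF assms, of "x - y"] by simp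

lemma is_norm_le_norm:
  fixes v :: "'v::euclidean_space \<Rightarrow> real"
  assumes "is_norm v"
  obtains C where "0 < C" "\<And>x. v x \<le> C * norm x"
proof
  let ?C = "(\<Sum>b\<in>Basis. v b) + 1"
  have s0: "0 \<le> (\<Sum>b\<in>Basis. v b)"
    by (intro sum_nonneg is_norm_nonneg assms)
  show "0 < ?C" using s0 by simp
  fix x :: 'v
  have "v x = v (\<Sum>b\<in>Basis. (x \<bullet> b) *\<^sub>R b)"
    by (simp add: euclidean_representation)
  also have "\<dots> \<le> (\<Sum>b\<in>Basis. \<bar>x \<bullet> b\<bar> * v b)"
    using is_norm_sum[OF assms, of "\<lambda>b. (x \<bullet> b) *\<^sub>R b" Basis] by (simp add: is_norm_scaleR[OF assms])
  also have "\<dots> \<le> (\<Sum>b\<in>Basis. norm x * v b)"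
    by (intro sum_mono mult_right_mono is_norm_nonneg assms Basis_le_norm)
  also have "\<dots> \<le> ?C * norm x"
    by (simp add: sum_distrib_left algebra_simps)
  finally show "v x \<le> ?C * norm x" .
qed

lemma is_norm_continuous_on:
  fixes v :: "'v::euclidean_space \<Rightarrow> real"
  assumes "is_norm v" shows "continuous_on S v"
proof -
  obtain C where C: "0 < C" "\<And>x. v x \<le> C * norm x"
    using is_norm_le_norm[OF assms] by blast
  have "C-lipschitz_on S v"
    by (intro lipschitz_onI)
       (use C is_norm_diff_abs[OF assms] in \<open>auto simp: dist_norm intro: order_trans\<close>)
  then show ?thesis by (rule lipschitz_on_continuous_on)
qed

lemma is_norm_ge_norm:
  fixes v :: "'v::euclidean_space \<Rightarrow> real"
  assumes "is_norm v"
  obtains c where "0 < c" "\<And>x. c * norm x \<le> v x"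
proof -
  have ne: "sphere (0::'v) 1 \<noteq> {}" by simp
  obtain z where z: "z \<in> sphere 0 1" "\<And>y. y \<in> sphere 0 1 \<Longrightarrow> v z \<le> v y"
    using continuous_attains_inf[OF compact_sphere ne is_norm_continuous_on[OF assms]] by blast
  have "0 < v z" using z by (intro is_norm_pos assms) auto
  moreover have "v z * norm x \<le> v x" for x
  proof (cases "x = 0")
    case False
    have "v z \<le> v ((1 / norm x) *\<^sub>R x)"
      by (intro z) (use False in simp)
    then show ?thesis
      using False by (simp add: is_norm_scaleR[OF assms] field_simps)
  qed (simp add: is_norm_zero assms)
  ultimately show ?thesis by (rule that)
qed

lemma opnorm_bdd_above:
  fixes v :: "real^'d \<Rightarrow> real"
  assumes "is_norm v" shows "bdd_above (range (\<lambda>x. v (M *v x) / v x))"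
proof -
  obtain C where C: "0 < C" "\<And>x. v x \<le> C * norm x" using is_norm_le_norm[OF assms] by blast
  obtain c where c: "0 < c" "\<And>x. c * norm x \<le> v x" using is_norm_ge_norm[OF assms] by blast
  obtain K where K: "0 < K" "\<And>x. norm (M *v x) \<le> norm x * K"
    using bounded_linear.pos_bounded[OF matrix_vector_mul_bounded_linear[of M]] by blast
  have "v (M *v x) / v x \<le> C * K / c" for x
  proof (cases "x = 0")
    case False
    have "v (M *v x) \<le> C * (norm x * K)"
      using C(2)[of "M *v x"] K(2)[of x] C(1) by (meson mult_left_mono order_trans less_imp_le)
    also have "\<dots> = (C * K / c) * (c * norm x)" using c by simp
    also have "\<dots> \<le> (C * K / c) * v x"
      using C(1) K(1) c by (intro mult_left_mono) auto
    finally show ?thesis using is_norm_pos[OF assms False] by (simp add: divide_le_eq)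
  qed (use C K c in \<open>simp add: is_norm_zero assms\<close>)
  then show ?thesis by (intro bdd_aboveI2)
qed

lemma opnorm_bound:
  fixes v :: "real^'d \<Rightarrow> real"
  assumes "is_norm v" shows "v (M *v x) \<le> opnorm v M * v x"
proof (cases "x = 0")
  case False
  have "v (M *v x) / v x \<le> opnorm v M"
    unfolding opnorm_def by (intro cSUP_upper opnorm_bdd_above assms) auto
  then show ?thesis using is_norm_pos[OF assms False] by (simp add: divide_le_eq)
qed (simp add: is_norm_zero assms)

lemma opnorm_nonneg:
  fixes v :: "real^'d \<Rightarrow> real"
  assumes "is_norm v" shows "0 \<le> opnorm v M"
  using opnorm_bound[OF assms, of M "axis undefined 1"]
    is_norm_nonneg[OF assms, of "M *v axis undefined 1"]
    is_norm_pos[OF assms, of "axis undefined 1"]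
  by (smt (verit) axis_eq_0_iff mult_neg_pos zero_neq_one)

lemma opnorm_le:
  fixes v :: "real^'d \<Rightarrow> real"
  assumes "is_norm v" "0 \<le> K" "\<And>x. v (M *v x) \<le> K * v x" shows "opnorm v M \<le> K"
  unfolding opnorm_def
proof (intro cSUP_least)
  fix x show "v (M *v x) / v x \<le> K"
    using assms(2) assms(3)[of x] is_norm_pos[OF assms(1), of x]
    by (cases "x = 0") (auto simp: divide_le_eq is_norm_zero assms(1))
qed simp

lemma opnorm_matrix_mult:
  fixes v :: "real^'d \<Rightarrow> real"
  assumes "is_norm v" shows "opnorm v (M ** N) \<le> opnorm v M * opnorm v N"
proof (rule opnorm_le[OF assms])
  fix x
  have "v ((M ** N) *v x) = v (M *v (N *v x))" by (simp add: matrix_vector_mul_assoc)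
  also have "\<dots> \<le> opnorm v M * v (N *v x)" by (rule opnorm_bound[OF assms])
  also have "\<dots> \<le> opnorm v M * (opnorm v N * v x)"
    by (intro mult_left_mono opnorm_bound opnorm_nonneg assms)
  finally show "v ((M ** N) *v x) \<le> opnorm v M * opnorm v N * v x" by simp
qed (simp add: opnorm_nonneg assms)

lemma opnorm_mat_1:
  fixes v :: "real^'d \<Rightarrow> real"
  assumes "is_norm v" shows "opnorm v (mat 1) = 1"
proof (rule antisym)
  show "opnorm v (mat 1) \<le> 1" by (rule opnorm_le[OF assms]) auto
  show "1 \<le> opnorm v (mat 1)"
    using opnorm_bound[OF assms, of "mat 1" "axis undefined 1"]
      is_norm_pos[OF assms, of "axis undefined 1"] by simp
qed

lemma is_norm_opnorm:
  fixes v :: "real^'d \<Rightarrow> real"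
  assumes "is_norm v" shows "is_norm (opnorm v)"
  unfolding is_norm_def
proof (intro conjI allI)
  fix M N :: "real^'d^'d" and c :: real
  show "0 \<le> opnorm v M" by (rule opnorm_nonneg[OF assms])
  show "opnorm v M = 0 \<longleftrightarrow> M = 0"
  proof
    assume 0: "opnorm v M = 0"
    have "M *v x = 0" for x
      using opnorm_bound[OF assms, of M x] is_norm_nonneg[OF assms, of "M *v x"] 0
      by (simp add: is_norm_eq_0[OF assms])
    then show "M = 0" by (simp add: matrix_eq)
  next
    assume "M = 0"
    then show "opnorm v M = 0"
      using opnorm_le[OF assms, of 0 M] opnorm_nonneg[OF assms, of M] by (simp add: is_norm_zero assms)
  qed
  show "opnorm v (M + N) \<le> opnorm v M + opnorm v N"
  proof (rule opnorm_le[OF assms])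
    fix x
    have "v ((M + N) *v x) \<le> v (M *v x) + v (N *v x)"
      by (simp add: matrix_vector_mult_add_rdistrib is_norm_triangle assms)
    then show "v ((M + N) *v x) \<le> (opnorm v M + opnorm v N) * v x"
      using opnorm_bound[OF assms, of M x] opnorm_bound[OF assms, of N x] by (simp add: algebra_simps)
  qed (simp add: opnorm_nonneg assms)
  have *: "opnorm v (c *\<^sub>R M) \<le> \<bar>c\<bar> * opnorm v M" for c M
    by (rule opnorm_le[OF assms])
       (simp_all add: opnorm_nonneg assms matrix_vector_scaleR_left is_norm_scaleR
         mult.assoc mult_left_mono opnorm_bound)
  show "opnorm v (c *\<^sub>R M) = \<bar>c\<bar> * opnorm v M"
  proof (cases "c = 0")
    case True
    then show ?thesis using *[of 0 M] opnorm_nonneg[OF assms, of "0::real^'d^'d"] by simp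
  next
    case False
    then show ?thesis using *[of c M] *[of "1 / c" "c *\<^sub>R M"]
      by (simp add: field_simps)
  qed
qed

lemmas opnorm_scaleR = is_norm_scaleR[OF is_norm_opnorm]
lemmas continuous_on_opnorm = is_norm_continuous_on[OF is_norm_opnorm]

lemma tendsto_opnorm:
  fixes v :: "real^'d \<Rightarrow> real"
  assumes "is_norm v" "(f \<longlongrightarrow> M) F"
  shows "((\<lambda>x. opnorm v (f x)) \<longlongrightarrow> opnorm v M) F"
  using continuous_on_tendsto_compose[OF continuous_on_opnorm[OF assms(1), of UNIV] assms(2)] by simp

section \<open>The matrix exponential\<close>

lemma mpow_commute: "M ** mpow M n = mpow M n ** M"
proof (induction n)
  case (Suc n)
  then show ?case by (metis matrix_mul_assoc mpow.simps(2))
qed simp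

lemma opnorm_mpow:
  fixes v :: "real^'d \<Rightarrow> real"
  assumes "is_norm v" shows "opnorm v (mpow M n) \<le> opnorm v M ^ n"
proof (induction n)
  case (Suc n)
  have "opnorm v (mpow M (Suc n)) \<le> opnorm v M * opnorm v (mpow M n)"
    by (simp add: opnorm_matrix_mult[OF assms])
  also have "\<dots> \<le> opnorm v M * opnorm v M ^ n"
    by (intro mult_left_mono Suc opnorm_nonneg assms)
  finally show ?case by simp
qed (simp add: opnorm_mat_1 assms)

lemma is_norm_norm: "is_norm (norm :: 'v::real_normed_vector \<Rightarrow> real)"
  by (auto simp: is_norm_def norm_triangle_ineq)

lemma mpow_scaleR: "mpow (t *\<^sub>R M) n = t ^ n *\<^sub>R mpow M n"
  by (induction n) (simp_all add: matrix_scaleR_left matrix_scaleR_right)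

lemma summable_mexp:
  fixes M :: "real^'d^'d"
  shows "summable (\<lambda>n. (1 / fact n) *\<^sub>R mpow M n)"
proof -
  let ?v = "norm :: real^'d \<Rightarrow> real"
  obtain c where c: "0 < c" "\<And>X::real^'d^'d. c * norm X \<le> opnorm ?v X"
    using is_norm_ge_norm[OF is_norm_opnorm[OF is_norm_norm]] by blast
  have *: "norm ((1 / fact n) *\<^sub>R mpow M n) \<le> (1 / c) * (inverse (fact n) * opnorm ?v M ^ n)" for n
  proof -
    have "c * norm (mpow M n) \<le> opnorm ?v M ^ n"
      using c(2)[of "mpow M n"] opnorm_mpow[OF is_norm_norm, of M n] by (rule order_trans)
    then have "norm (mpow M n) \<le> opnorm ?v M ^ n / c"
      using c(1) by (simp add: le_divide_eq mult.commute)
    then have "inverse (fact n) * norm (mpow M n) \<le> inverse (fact n) * (opnorm ?v M ^ n / c)"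
      by (rule mult_left_mono) simp
    then show ?thesis by (simp add: inverse_eq_divide mult.commute)
  qed
  have "summable (\<lambda>n. (1 / c) * (inverse (fact n) * opnorm ?v M ^ n))"
    by (rule summable_mult[OF summable_exp])
  then show ?thesis
    by (rule summable_comparison_test') (use * in blast)
qed

lemma mexp_sums: "(\<lambda>n. (1 / fact n) *\<^sub>R mpow M n) sums mexp M"
  unfolding mexp_def using summable_mexp by (rule summable_sums)

text \<open>Entrywise, \<open>t \<mapsto> mexp (t *\<^sub>R M)\<close> is a scalar power series, to which termwise differentiation
  and the identity theorem apply.\<close>

lemma mexp_entry_sums:
  fixes M :: "real^'d^'d"
  shows "(\<lambda>n. ((1 / fact n) * mpow M n $ i $ j) * t ^ n) sums (mexp (t *\<^sub>R M) $ i $ j)"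
proof -
  have "bounded_linear (\<lambda>X::real^'d^'d. X $ i $ j)"
    using bounded_linear_compose[OF bounded_linear_vec_nth[of j] bounded_linear_vec_nth[of i]] by simp
  from bounded_linear.sums[OF this mexp_sums[of "t *\<^sub>R M"]] show ?thesis
    by (simp add: mpow_scaleR mult_ac)
qed

lemma mexp_0: "mexp (0::real^'d^'d) = mat 1"
proof -
  have "mexp (0 *\<^sub>R (0::real^'d^'d)) $ i $ j = mat 1 $ i $ j" for i j :: 'd
    using sums_unique2[OF mexp_entry_sums[of "0::real^'d^'d" i j 0] powser_sums_zero] by simp
  then show ?thesis by (simp add: vec_eq_iff)
qed

lemma matrix_axis_expansion:
  fixes X :: "real^'n^'m"
  shows "X = (\<Sum>i\<in>UNIV. \<Sum>j\<in>UNIV. (X $ i $ j) *\<^sub>R axis i (axis j 1))"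
proof -
  have inner: "(\<Sum>j\<in>UNIV. (X $ i $ j) *\<^sub>R (axis i (axis j 1) :: real^'n^'m)) = axis i (X $ i)" for i
  proof -
    have "(\<Sum>j\<in>UNIV. (X $ i $ j) *\<^sub>R (axis j 1 :: real^'n)) = X $ i"
      using basis_expansion[of "X $ i"] by (simp add: scalar_mult_eq_scaleR)
    moreover have "(X $ i $ j) *\<^sub>R (axis i (axis j 1) :: real^'n^'m) = axis i ((X $ i $ j) *\<^sub>R axis j 1)" for j
      by (simp add: vec_eq_iff axis_def)
    moreover have "(\<Sum>j\<in>J. axis i (g j) :: real^'n^'m) = axis i (\<Sum>j\<in>J. g j)" for J and g :: "'n \<Rightarrow> _"
      by (simp add: vec_eq_iff axis_def)
    ultimately show ?thesis by simp
  qed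
  have "(\<Sum>i\<in>UNIV. axis i (X $ i)) $ a = X $ a" for a
    by (simp add: axis_def)
  then show ?thesis by (simp add: inner vec_eq_iff)
qed

lemma has_vector_derivative_matrix_entrywise:
  fixes f :: "real \<Rightarrow> real^'n^'m"
  assumes "\<And>i j. ((\<lambda>t. f t $ i $ j) has_vector_derivative f' $ i $ j) (at t within S)"
  shows "(f has_vector_derivative f') (at t within S)"
proof -
  have "((\<lambda>t. \<Sum>i\<in>UNIV. \<Sum>j\<in>UNIV. (f t $ i $ j) *\<^sub>R (axis i (axis j 1) :: real^'n^'m))
      has_vector_derivative (\<Sum>i\<in>UNIV. \<Sum>j\<in>UNIV. (f' $ i $ j) *\<^sub>R (axis i (axis j 1)))) (at t within S)"
    by (intro has_vector_derivative_sum
        bounded_linear.has_vector_derivative[OF bounded_linear_scaleR_left] assms)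
  then show ?thesis by (simp flip: matrix_axis_expansion)
qed

lemma has_vector_derivative_mexp:
  fixes M :: "real^'d^'d"
  shows "((\<lambda>t. mexp (t *\<^sub>R M)) has_vector_derivative M ** mexp (t *\<^sub>R M)) (at t within S)"
proof (rule has_vector_derivative_matrix_entrywise)
  fix i j
  define c where "c n = (1 / fact n) * mpow M n $ i $ j" for n
  have cs: "(\<lambda>n. c n * t ^ n) sums (mexp (t *\<^sub>R M) $ i $ j)" for t
    unfolding c_def by (rule mexp_entry_sums)
  have "((\<lambda>t. \<Sum>n. c n * t ^ n) has_field_derivative (\<Sum>n. diffs c n * t ^ n)) (at t)"
    by (rule termdiffs_strong_converges_everywhere) (rule sums_summable[OF cs])
  moreover have "(\<lambda>n. diffs c n * t ^ n) sums ((M ** mexp (t *\<^sub>R M)) $ i $ j)" for t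
  proof -
    have "diffs c n * t ^ n = (\<Sum>k\<in>UNIV. M $ i $ k * (((1 / fact n) * mpow M n $ k $ j) * t ^ n))" for n
    proof -
      have "diffs c n = of_nat (Suc n) * ((1 / fact (Suc n)) * (M ** mpow M n) $ i $ j)"
        by (simp only: diffs_def c_def mpow.simps)
      also have "\<dots> = (1 / fact n) * (M ** mpow M n) $ i $ j"
        by (simp only: fact_Suc) (simp del: of_nat_Suc)
      also have "\<dots> = (1 / fact n) * (\<Sum>k\<in>UNIV. M $ i $ k * mpow M n $ k $ j)"
        by (simp add: matrix_matrix_mult_def)
      finally show ?thesis
        by (simp only: sum_distrib_left sum_distrib_right mult_ac)
    qed
    moreover have "(\<lambda>n. \<Sum>k\<in>UNIV. M $ i $ k * (((1 / fact n) * mpow M n $ k $ j) * t ^ n)) sums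
        (\<Sum>k\<in>UNIV. M $ i $ k * mexp (t *\<^sub>R M) $ k $ j)" for t
      by (intro sums_sum sums_mult mexp_entry_sums)
    ultimately show ?thesis by (simp only: matrix_matrix_mult_def vec_lambda_beta)
  qed
  moreover have "(\<Sum>n. c n * t ^ n) = mexp (t *\<^sub>R M) $ i $ j" for t
    using cs by (rule sums_unique[symmetric])
  ultimately have "((\<lambda>t. mexp (t *\<^sub>R M) $ i $ j) has_field_derivative (M ** mexp (t *\<^sub>R M)) $ i $ j) (at t)"
    by (simp only: sums_iff)
  then show "((\<lambda>t. mexp (t *\<^sub>R M) $ i $ j) has_vector_derivative (M ** mexp (t *\<^sub>R M)) $ i $ j)
      (at t within S)"
    unfolding has_real_derivative_iff_has_vector_derivative[symmetric]
    by (rule has_field_derivative_at_within)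
qed

lemma continuous_on_mexp: "continuous_on S (\<lambda>t. mexp (t *\<^sub>R M))"
  by (auto simp: continuous_on_eq_continuous_within
      intro!: has_vector_derivative_continuous has_vector_derivative_mexp)

lemma mexp_commute:
  fixes M :: "real^'d^'d"
  shows "M ** mexp (t *\<^sub>R M) = mexp (t *\<^sub>R M) ** M"
proof -
  have 1: "(\<lambda>n. M ** ((1 / fact n) *\<^sub>R mpow (t *\<^sub>R M) n)) sums (M ** mexp (t *\<^sub>R M))"
    by (rule bounded_linear.sums[OF bounded_bilinear.bounded_linear_right[OF bounded_bilinear_matrix_mult] mexp_sums])
  have 2: "(\<lambda>n. ((1 / fact n) *\<^sub>R mpow (t *\<^sub>R M) n) ** M) sums (mexp (t *\<^sub>R M) ** M)"
    by (rule bounded_linear.sums[OF bounded_bilinear.bounded_linear_left[OF bounded_bilinear_matrix_mult] mexp_sums])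
  have "M ** ((1 / fact n) *\<^sub>R mpow (t *\<^sub>R M) n) = ((1 / fact n) *\<^sub>R mpow (t *\<^sub>R M) n) ** M" for n
    by (simp add: mpow_scaleR matrix_scaleR_left matrix_scaleR_right mpow_commute)
  then show ?thesis using sums_unique2[OF 1] 2 by simp
qed

text \<open>The linear differential equation has unique solutions: multiplying a solution by the
  exponential of the opposite matrix gives a constant. All functional equations of the exponential
  are instances of this.\<close>

lemma linear_ode_constant:
  fixes X :: "real \<Rightarrow> real^'d^'d"
  assumes "a \<le> b" and cont: "continuous_on {a..b} X"
    and der: "\<And>t. a < t \<Longrightarrow> t < b \<Longrightarrow> (X has_vector_derivative M ** X t) (at t)"
  shows "mexp (- (b - a) *\<^sub>R M) ** X b = X a"
proof -
  let ?g = "\<lambda>t. mexp ((- (t - a)) *\<^sub>R M) ** X t"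
  have cont': "continuous_on {a..b} ?g"
  proof -
    have "continuous_on {a..b} (\<lambda>t. mexp ((- (t - a)) *\<^sub>R M))"
      by (rule continuous_on_compose2[OF continuous_on_mexp[of UNIV M]]) (auto intro!: continuous_intros)
    then show ?thesis using cont by (rule continuous_on_matrix_mult)
  qed
  have der': "(?g has_vector_derivative 0) (at t)" if "a < t" "t < b" for t
  proof -
    have "((\<lambda>t. mexp ((- (t - a)) *\<^sub>R M)) has_vector_derivative
        (-1) *\<^sub>R (M ** mexp ((- (t - a)) *\<^sub>R M))) (at t)"
    proof -
      have "((\<lambda>t. - (t - a)) has_vector_derivative -1) (at t)"
        by (auto intro!: derivative_eq_intros)
      from vector_diff_chain_at[OF this has_vector_derivative_mexp] show ?thesis
        by (simp add: o_def)
    qed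
    from has_vector_derivative_matrix_mult[OF this der[OF that]] show ?thesis
      by (simp add: matrix_minus_left matrix_mul_assoc mexp_commute)
  qed
  have "?g b = ?g a"
  proof (cases "a = b")
    case False
    have "(?g has_derivative (\<lambda>h. 0)) (at t within {a..b})" if "t \<in> {a..b} - {a, b}" for t
      using der'[of t] that by (auto simp: has_vector_derivative_def intro: has_derivative_at_withinI)
    from has_derivative_zero_unique_strong_interval[OF _ cont' refl this, of "{a, b}" b]
    show ?thesis using assms(1) by simp
  qed simp
  then show ?thesis by (simp add: mexp_0)
qed

lemma mexp_minus_mult:
  fixes M :: "real^'d^'d"
  shows "mexp (- t *\<^sub>R M) ** mexp (t *\<^sub>R M) = mat 1"
proof -
  have pos: "mexp (- t *\<^sub>R M) ** mexp (t *\<^sub>R M) = mat 1" if "0 \<le> t" for t and M :: "real^'d^'d"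
    using linear_ode_constant[OF that continuous_on_mexp has_vector_derivative_mexp, where M = M]
    by (simp add: mexp_0)
  show ?thesis
  proof (cases "0 \<le> t")
    case False
    then show ?thesis using pos[of "- t" "- M"] by simp
  qed (rule pos)
qed

lemma mexp_mult_minus:
  fixes M :: "real^'d^'d"
  shows "mexp (t *\<^sub>R M) ** mexp (- t *\<^sub>R M) = mat 1"
  using mexp_minus_mult[of "- t" M] by simp

lemma linear_ode_unique:
  fixes X :: "real \<Rightarrow> real^'d^'d"
  assumes "a \<le> b" and "continuous_on {a..b} X"
    and "\<And>t. a < t \<Longrightarrow> t < b \<Longrightarrow> (X has_vector_derivative M ** X t) (at t)"
  shows "X b = mexp ((b - a) *\<^sub>R M) ** X a"
  using linear_ode_constant[OF assms] mexp_mult_minus[of "b - a" M]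
  by (metis matrix_mul_assoc matrix_mul_lid)

lemma mexp_add:
  fixes M :: "real^'d^'d"
  assumes "0 \<le> s"
  shows "mexp ((s + t) *\<^sub>R M) = mexp (s *\<^sub>R M) ** mexp (t *\<^sub>R M)"
proof -
  have "mexp ((t + s) *\<^sub>R M) = mexp (((t + s) - t) *\<^sub>R M) ** mexp (t *\<^sub>R M)"
    using assms by (intro linear_ode_unique continuous_on_mexp has_vector_derivative_mexp) auto
  then show ?thesis by (simp add: add.commute)
qed

lemma mexp_shift:
  fixes M :: "real^'d^'d"
  assumes "0 \<le> t"
  shows "mexp (t *\<^sub>R M) = exp (l * t) *\<^sub>R mexp (t *\<^sub>R (M - l *\<^sub>R mat 1))"
proof -
  let ?X = "\<lambda>t. exp (l * t) *\<^sub>R mexp (t *\<^sub>R (M - l *\<^sub>R mat 1))"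
  have "?X t = mexp ((t - 0) *\<^sub>R M) ** ?X 0"
  proof (rule linear_ode_unique[OF assms])
    show "continuous_on {0..t} ?X"
      by (intro continuous_intros continuous_on_mexp)
    fix t
    have "((\<lambda>t. exp (l * t)) has_real_derivative exp (l * t) * l) (at t)"
      by (auto intro!: derivative_eq_intros)
    from has_vector_derivative_scaleR[OF this has_vector_derivative_mexp[of "M - l *\<^sub>R mat 1"]]
    show "(?X has_vector_derivative M ** ?X t) (at t)"
      by (simp add: matrix_diff_left matrix_scaleR_left matrix_scaleR_right algebra_simps)
  qed
  then show ?thesis by (simp add: mexp_0)
qed

lemma opnorm_mexp:
  fixes v :: "real^'d \<Rightarrow> real"
  assumes v: "is_norm v"
  shows "opnorm v (mexp M) \<le> exp (opnorm v M)"
proof (rule LIMSEQ_le_const2)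
  show "(\<lambda>n. opnorm v (\<Sum>k<n. (1 / fact k) *\<^sub>R mpow M k)) \<longlonglongrightarrow> opnorm v (mexp M)"
    using mexp_sums[of M] unfolding sums_def by (rule tendsto_opnorm[OF v])
  have "opnorm v (\<Sum>k<n. (1 / fact k) *\<^sub>R mpow M k) \<le> exp (opnorm v M)" for n
  proof -
    have "opnorm v (\<Sum>k<n. (1 / fact k) *\<^sub>R mpow M k) \<le> (\<Sum>k<n. opnorm v ((1 / fact k) *\<^sub>R mpow M k))"
      by (rule is_norm_sum[OF is_norm_opnorm[OF v]])
    also have "\<dots> = (\<Sum>k<n. (1 / fact k) * opnorm v (mpow M k))"
      by (simp add: opnorm_scaleR[OF v])
    also have "\<dots> \<le> (\<Sum>k<n. (1 / fact k) * opnorm v M ^ k)"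
      by (intro sum_mono mult_left_mono opnorm_mpow v) simp
    also have "\<dots> = (\<Sum>k<n. opnorm v M ^ k /\<^sub>R fact k)"
      by (simp add: field_simps)
    also have "\<dots> \<le> exp (opnorm v M)"
      using exp_converges[of "opnorm v M"]
      by (intro sum_le_suminf[of _ "{..<n}", THEN order_trans])
         (auto simp: opnorm_nonneg[OF v] sums_iff)
    finally show ?thesis .
  qed
  then show "\<exists>N. \<forall>n\<ge>N. opnorm v (\<Sum>k<n. (1 / fact k) *\<^sub>R mpow M k) \<le> exp (opnorm v M)" by blast
qed

section \<open>Functions given by an everywhere convergent power series\<close>

text \<open>The entries of \<open>t \<mapsto> mexp (t *\<^sub>R M)\<close> belong to this ring of functions, and its elements
  are determined by their values on the half-line. This is how identities that hold for
  nonnegative times are extended to negative times.\<close>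

definition real_entire :: "(real \<Rightarrow> real) \<Rightarrow> bool" where
  "real_entire f \<longleftrightarrow> (\<exists>a. \<forall>t. (\<lambda>n. a n * t ^ n) sums f t)"

lemma real_entire_const: "real_entire (\<lambda>_. c)"
proof -
  have "(\<lambda>n. (if n = 0 then c else 0) * t ^ n) sums c" for t
    by (rule sums_cong[THEN iffD1, OF _ sums_single[of 0 "\<lambda>_. c"]]) auto
  then show ?thesis unfolding real_entire_def by (intro exI[of _ "\<lambda>n. if n = 0 then c else 0"]) auto
qed

lemma real_entire_add:
  assumes "real_entire f" "real_entire g" shows "real_entire (\<lambda>t. f t + g t)"
proof -
  obtain a b where "\<And>t. (\<lambda>n. a n * t ^ n) sums f t" "\<And>t. (\<lambda>n. b n * t ^ n) sums g t"
    using assms unfolding real_entire_def by auto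
  then have "\<forall>t. (\<lambda>n. (a n + b n) * t ^ n) sums (f t + g t)"
    by (simp add: sums_add distrib_right)
  then show ?thesis unfolding real_entire_def by (intro exI[of _ "\<lambda>n. a n + b n"])
qed

lemma real_entire_mult:
  assumes "real_entire f" "real_entire g" shows "real_entire (\<lambda>t. f t * g t)"
proof -
  obtain a b where ab: "\<And>t. (\<lambda>n. a n * t ^ n) sums f t" "\<And>t. (\<lambda>n. b n * t ^ n) sums g t"
    using assms unfolding real_entire_def by auto
  have abs: "summable (\<lambda>n. norm (c n * t ^ n))" if "\<And>t. (\<lambda>n. c n * t ^ n) sums h t" for c h and t :: real
    by (rule powser_insidea[of c "\<bar>t\<bar> + 1"]) (use that[THEN sums_summable] in auto)
  have "(\<lambda>n. (\<Sum>i\<le>n. a i * b (n - i)) * t ^ n) sums (f t * g t)" for t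
  proof -
    have "(\<lambda>n. \<Sum>i\<le>n. (a i * t ^ i) * (b (n - i) * t ^ (n - i))) sums
        ((\<Sum>n. a n * t ^ n) * (\<Sum>n. b n * t ^ n))"
      by (intro Cauchy_product_sums abs[OF ab(1)] abs[OF ab(2)])
    moreover have "(a i * t ^ i) * (b (n - i) * t ^ (n - i)) = a i * b (n - i) * t ^ n" if "i \<le> n" for i n
      using power_add[of t i "n - i"] that by simp
    then have "(\<Sum>i\<le>n. (a i * t ^ i) * (b (n - i) * t ^ (n - i))) = (\<Sum>i\<le>n. a i * b (n - i) * t ^ n)" for n
      by (intro sum.cong) auto
    ultimately have "(\<lambda>n. \<Sum>i\<le>n. a i * b (n - i) * t ^ n) sums
        ((\<Sum>n. a n * t ^ n) * (\<Sum>n. b n * t ^ n))"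
      by simp
    then show ?thesis
      using sums_unique[OF ab(1)[of t]] sums_unique[OF ab(2)[of t]] by (simp only: sum_distrib_right)
  qed
  then have "\<forall>t. (\<lambda>n. (\<Sum>i\<le>n. a i * b (n - i)) * t ^ n) sums (f t * g t)" ..
  then show ?thesis
    unfolding real_entire_def by (intro exI[of _ "\<lambda>n. \<Sum>i\<le>n. a i * b (n - i)"])
qed

lemma real_entire_sum:
  assumes "\<And>i. i \<in> I \<Longrightarrow> real_entire (f i)" shows "real_entire (\<lambda>t. \<Sum>i\<in>I. f i t)"
  using assms
  by (induction I rule: infinite_finite_induct) (auto intro: real_entire_const real_entire_add)

lemma real_entire_mexp_entry:
  fixes M :: "real^'d^'d"
  shows "real_entire (\<lambda>t. mexp (t *\<^sub>R M) $ i $ j)"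
  unfolding real_entire_def
  by (intro exI[of _ "\<lambda>n. (1 / fact n) * mpow M n $ i $ j"] allI mexp_entry_sums)

text \<open>A power series that is not identically zero has isolated zeros.\<close>

lemma real_entire_constant:
  assumes "real_entire f" and "\<And>t. 0 \<le> t \<Longrightarrow> f t = c"
  shows "f t = c"
proof -
  obtain b where b: "\<And>t. (\<lambda>n. b n * t ^ n) sums (f t + (- c))"
    using real_entire_add[OF assms(1) real_entire_const[of "- c"]] unfolding real_entire_def by auto
  have b0: "b m = 0" for m
  proof (cases "m = 0")
    case True
    then show ?thesis
      using sums_unique2[OF b[of 0] powser_sums_zero] assms(2)[of 0] by simp
  next
    case False
    show ?thesis
    proof (rule ccontr)
      assume "b m \<noteq> 0"
      then obtain s where "0 < s" "\<And>z. z \<in> cball 0 s - {0} \<Longrightarrow> f z + (- c) \<noteq> 0"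
        using powser_0_nonzero[of 1 0 b "\<lambda>t. f t + (- c)" m] b assms(2)[of 0] False by auto
      from this(2)[of s] \<open>0 < s\<close> assms(2)[of s] show False by auto
    qed
  qed
  show ?thesis using b[of t] by (simp add: b0 sums_iff)
qed

section \<open>Complex eigenvalues of a real matrix\<close>

abbreviation complex_matrix :: "real^'d^'d \<Rightarrow> complex^'d^'d" where
  "complex_matrix M \<equiv> (\<chi> i j. complex_of_real (M $ i $ j))"

lemma complex_matrix_component:
  "Re ((complex_matrix M *v x) $ i) = (M *v (\<chi> j. Re (x $ j))) $ i"
  "Im ((complex_matrix M *v x) $ i) = (M *v (\<chi> j. Im (x $ j))) $ i"
  by (simp_all add: matrix_vector_mult_def)

lemma char_poly_exists:
  fixes N :: "complex^'d^'d"
  shows "\<exists>p. \<forall>z. poly p z = det (mat z - N)"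
proof
  let ?p = "\<Sum>\<pi>\<in>{\<pi>. \<pi> permutes (UNIV::'d set)}. [:of_int (sign \<pi>):] *
      (\<Prod>i\<in>UNIV. (if i = \<pi> i then [:- (N $ i $ \<pi> i), 1:] else [:- (N $ i $ \<pi> i):]))"
  have "poly (if i = \<pi> i then [:- (N $ i $ \<pi> i), 1:] else [:- (N $ i $ \<pi> i):]) z = (mat z - N) $ i $ \<pi> i"
    for i z and \<pi> :: "'d \<Rightarrow> 'd"
    by (simp add: mat_def)
  then show "\<forall>z. poly ?p z = det (mat z - N)"
    by (simp add: det_def poly_sum poly_prod)
qed

lemma eigenvalues_iff_det:
  "z \<in> eigenvalues M \<longleftrightarrow> det (mat z - complex_matrix M) = 0"
proof -
  let ?N = "complex_matrix M"
  have eq: "(mat z - ?N) *v x = z *s x - ?N *v x" for x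
  proof -
    have "mat z *v x = z *s x"
      by (simp add: vec_eq_iff matrix_vector_mult_def mat_def if_distrib[where f = "\<lambda>a. a * _"] cong: if_cong)
    then show ?thesis by (simp add: matrix_vector_mult_diff_rdistrib)
  qed
  have "z \<in> eigenvalues M \<longleftrightarrow> (\<exists>x. x \<noteq> 0 \<and> (mat z - ?N) *v x = 0)"
    unfolding eigenvalues_def mem_Collect_eq by (subst eq) (metis eq_iff_diff_eq_0)
  also have "\<dots> \<longleftrightarrow> \<not> invertible (mat z - ?N)"
    unfolding invertible_left_inverse matrix_left_invertible_ker by blast
  also have "\<dots> \<longleftrightarrow> det (mat z - ?N) = 0"
    by (simp add: invertible_det_nz)
  finally show ?thesis .
qed

text \<open>For real \<open>x\<close> the determinant is \<open>x ^ CARD('d)\<close> times \<open>det (1 - N / x)\<close>, and the second factor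
  tends to 1. This is how the characteristic polynomial is seen to be nonconstant.\<close>

lemma char_poly_growth:
  fixes N :: "complex^'d^'d"
  shows "filterlim (\<lambda>x::real. det (mat (of_real x) - N)) at_infinity at_top"
proof -
  define R where "R w = (\<chi> i j. (if i = j then 1 else 0) - w * N $ i $ j)" for w
  have "((\<lambda>x::real. det (R (of_real (inverse x)))) \<longlongrightarrow>
      (\<Sum>\<pi>\<in>{\<pi>. \<pi> permutes (UNIV::'d set)}. of_int (sign \<pi>) *
        (\<Prod>i\<in>UNIV. (if i = \<pi> i then 1 else 0) - of_real 0 * N $ i $ \<pi> i))) at_top"
    unfolding det_def R_def vec_lambda_beta
    by (intro tendsto_intros tendsto_inverse_0_at_top filterlim_ident)
  moreover have "(\<Sum>\<pi>\<in>{\<pi>. \<pi> permutes (UNIV::'d set)}. of_int (sign \<pi>) *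
        (\<Prod>i\<in>UNIV. (if i = \<pi> i then 1 else 0) - of_real 0 * N $ i $ \<pi> i)) = det (mat 1 :: complex^'d^'d)"
    by (simp add: det_def mat_def)
  ultimately have "((\<lambda>x::real. det (R (of_real (inverse x)))) \<longlongrightarrow> 1) at_top"
    by (simp add: det_I)
  moreover have "filterlim (\<lambda>x::real. of_real x ^ CARD('d) :: complex) at_infinity at_top"
    by (rule filterlim_norm_at_top_imp_at_infinity)
       (auto simp: norm_power intro!: filterlim_pow_at_top filterlim_at_infinity_imp_norm_at_top
         filterlim_of_real_at_infinity simp del: norm_of_real)
  ultimately have "filterlim (\<lambda>x::real. det (R (of_real (inverse x))) * of_real x ^ CARD('d)) at_infinity at_top"
    by (intro tendsto_mult_filterlim_at_infinity) auto
  moreover have "\<forall>\<^sub>F x::real in at_top. det (R (of_real (inverse x))) * of_real x ^ CARD('d) = det (mat (of_real x) - N)"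
  proof (rule eventually_mono[OF eventually_gt_at_top[of 0]])
    fix x :: real assume "0 < x"
    then have "mat (of_real x) - N = (\<chi> i. of_real x *s (R (of_real (inverse x)) $ i))"
      by (simp add: vec_eq_iff mat_def R_def field_simps)
    then show "det (R (of_real (inverse x))) * of_real x ^ CARD('d) = det (mat (of_real x) - N)"
      using det_rows_mul[of "\<lambda>_. of_real x" "\<lambda>i. R (of_real (inverse x)) $ i"] by simp
  qed
  ultimately show ?thesis by (rule filterlim_cong[OF refl refl, THEN iffD1, rotated])
qed

lemma eigenvalues_finite_nonempty:
  fixes M :: "real^'d^'d"
  shows "finite (eigenvalues M)" "eigenvalues M \<noteq> {}"
proof -
  obtain p where p: "\<And>z. poly p z = det (mat z - complex_matrix M)"
    using char_poly_exists by blast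
  have ev: "eigenvalues M = {z. poly p z = 0}"
    by (auto simp: eigenvalues_iff_det p)
  have lim: "filterlim (\<lambda>x::real. poly p (of_real x)) at_infinity at_top"
    unfolding p by (rule char_poly_growth)
  have nc: "\<not> constant (poly p)"
  proof
    assume "constant (poly p)"
    then have "poly p (of_real x) = poly p 0" for x unfolding constant_def by blast
    then have "filterlim (\<lambda>x::real. poly p 0) at_infinity at_top" using lim by simp
    then show False
      using not_tendsto_and_filterlim_at_infinity[of at_top "\<lambda>x::real. poly p 0" "poly p 0"] by simp
  qed
  then have "p \<noteq> 0" by (auto simp: constant_def)
  then show "finite (eigenvalues M)" unfolding ev by (rule poly_roots_finite)
  show "eigenvalues M \<noteq> {}" unfolding ev using Fundamental_Theorem_Algebra.fundamental_theorem_of_algebra[OF nc] by auto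
qed

section \<open>Invariant quadratic forms of bounded groups of matrices\<close>

abbreviation act :: "real^'d^'d \<Rightarrow> real^'d^'d \<Rightarrow> real^'d^'d" where
  "act g X \<equiv> transpose g ** X ** g"

lemma act_act: "act h (act g X) = act (g ** h) X"
  by (simp add: matrix_transpose_mul matrix_mul_assoc)

lemma inner_act: "x \<bullet> (act g X *v x) = (g *v x) \<bullet> (X *v (g *v x))"
proof -
  have "act g X *v x = (X *v (g *v x)) v* g"
    by (simp add: matrix_vector_mul_assoc[symmetric])
  then show ?thesis by (metis inner_commute dot_lmul_matrix)
qed

lemma bounded_linear_act: "bounded_linear (act g :: real^'d^'d \<Rightarrow> real^'d^'d)"
  by (intro bounded_linear_compose[OF bounded_bilinear.bounded_linear_left[OF bounded_bilinear_matrix_mult, of g]]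
      bounded_bilinear.bounded_linear_right[OF bounded_bilinear_matrix_mult])

text \<open>The group acts on the matrices \<open>X\<close> by \<open>act g X\<close>, preserving the closed
  convex set \<open>C\<close> below. The norm \<open>\<phi>\<close>, the supremum of the Frobenius norm over the orbit, is
  invariant, and by the parallelogram law its minimum over \<open>C\<close> is attained at a single point;
  uniqueness makes that point invariant. The group need not consist of invertible matrices: its
  unit may be a projection \<open>E\<close>, and then the form is supported on the range of \<open>E\<close>.\<close>

lemma bounded_group_invariant_form:
  fixes G :: "(real^'d^'d) set" and E :: "real^'d^'d"
  assumes E: "E \<in> G" and bd: "bounded G"
    and mult: "\<And>g h. g \<in> G \<Longrightarrow> h \<in> G \<Longrightarrow> g ** h \<in> G"
    and unit: "\<And>g. g \<in> G \<Longrightarrow> g ** E = g"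
    and inv: "\<And>g. g \<in> G \<Longrightarrow> \<exists>h\<in>G. g ** h = E \<and> h ** g = E"
  shows "\<exists>H c. transpose H = H \<and> (\<forall>g\<in>G. act g H = H) \<and> 0 < c \<and>
    (\<forall>x. c * (norm (E *v x))\<^sup>2 \<le> x \<bullet> (H *v x))"
proof -
  obtain B where B: "0 < B" "\<And>g. g \<in> G \<Longrightarrow> norm g \<le> B"
    using bd by (metis bounded_pos)
  obtain K where K: "0 < K" "\<And>(X :: real^'d^'d) (Y :: real^'d^'d). norm (X ** Y) \<le> norm X * norm Y * K"
    using bounded_bilinear.pos_bounded[OF bounded_bilinear_matrix_mult] by blast
  obtain K2 where K2: "0 < K2" "\<And>(X :: real^'d^'d) y. norm (X *v y) \<le> norm X * norm y * K2"
    using bounded_bilinear.pos_bounded[OF bounded_bilinear_matrix_vector_mult] by blast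
  obtain K3 where K3: "0 < K3" "\<And>X :: real^'d^'d. norm (transpose X) \<le> norm X * K3"
    using bounded_linear.pos_bounded[OF bounded_linear_transpose] by blast
  define L where "L = (B * K3) * K * B * K"
  have L: "0 < L" unfolding L_def using B K K3 by auto
  have act_le: "norm (act g X) \<le> L * norm X" if "g \<in> G" for g X
  proof -
    have "norm (act g X) \<le> norm (transpose g ** X) * norm g * K" by (rule K)
    also have "\<dots> \<le> (norm (transpose g) * norm X * K) * norm g * K"
      by (intro mult_right_mono K) (use K in auto)
    also have "\<dots> \<le> ((norm g * K3) * norm X * K) * norm g * K"
      by (intro mult_right_mono K3) (use K in auto)
    also have "\<dots> \<le> ((B * K3) * norm X * K) * B * K"
      by (intro mult_right_mono mult_mono B that) (use K K3 B in auto)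
    finally show ?thesis unfolding L_def by (simp add: mult_ac)
  qed
  \<comment> \<open>The constant is written with \<open>+ 1\<close> so that it is positive; it comes from \<open>E_le\<close> below.\<close>
  define C where "C = {X. transpose X = X \<and> act E X = X \<and>
    (\<forall>g\<in>G. \<forall>x. (norm (E *v x))\<^sup>2 / (B * K2 + 1)\<^sup>2 \<le> (g *v x) \<bullet> (X *v (g *v x)))}"
  have E_le: "norm (E *v x) \<le> (B * K2 + 1) * norm (g *v x)" if "g \<in> G" for g x
  proof -
    obtain h where h: "h \<in> G" "h ** g = E" using inv[OF \<open>g \<in> G\<close>] by blast
    have "norm (E *v x) = norm (h *v (g *v x))" by (simp add: matrix_vector_mul_assoc h)
    also have "\<dots> \<le> norm h * norm (g *v x) * K2" by (rule K2)
    also have "\<dots> \<le> B * norm (g *v x) * K2" by (intro mult_right_mono B h) (use K2 in auto)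
    also have "\<dots> \<le> (B * K2 + 1) * norm (g *v x)" by (simp add: algebra_simps)
    finally show ?thesis .
  qed
  have Eg: "E ** g = g" if "g \<in> G" for g
    using inv[OF that] unit[OF that] by (metis matrix_mul_assoc)
  have BK: "0 < (B * K2 + 1)\<^sup>2" using B K2 by (intro zero_less_power add_pos_pos) auto
  have "act E (mat 1) \<in> C"
    unfolding C_def
  proof (intro CollectI conjI ballI allI)
    show "transpose (act E (mat 1)) = act E (mat 1)" by (simp add: matrix_transpose_mul)
    show "act E (act E (mat 1)) = act E (mat 1)" by (simp only: act_act unit[OF E])
    fix g x assume g: "g \<in> G"
    have "(norm (E *v x))\<^sup>2 \<le> (B * K2 + 1)\<^sup>2 * (norm (g *v x))\<^sup>2"
      using power_mono[OF E_le[OF g, of x], of 2] by (simp add: power_mult_distrib)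
    then have "(norm (E *v x))\<^sup>2 / (B * K2 + 1)\<^sup>2 \<le> (norm (g *v x))\<^sup>2"
      using BK by (simp add: divide_le_eq mult.commute)
    also have "\<dots> = (E *v (g *v x)) \<bullet> (mat 1 *v (E *v (g *v x)))"
      by (simp add: matrix_vector_mul_assoc Eg[OF g] power2_norm_eq_inner)
    also have "\<dots> = (g *v x) \<bullet> (act E (mat 1) *v (g *v x))" by (rule inner_act[symmetric])
    finally show "(norm (E *v x))\<^sup>2 / (B * K2 + 1)\<^sup>2 \<le> (g *v x) \<bullet> (act E (mat 1) *v (g *v x))" .
  qed
  have closed: "closed C"
  proof -
    have "C = {X. transpose X = X} \<inter> {X. act E X = X} \<inter>
        (\<Inter>g\<in>G. \<Inter>x. {X. (norm (E *v x))\<^sup>2 / (B * K2 + 1)\<^sup>2 \<le> (g *v x) \<bullet> (X *v (g *v x))})"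
      unfolding C_def by blast
    moreover have "closed {X. transpose X = (X::real^'d^'d)}"
      by (rule closed_Collect_eq[OF continuous_on_transpose[OF continuous_on_id] continuous_on_id])
    moreover have "closed {X. act E X = X}"
      by (rule closed_Collect_eq[OF bounded_linear.continuous_on[OF bounded_linear_act continuous_on_id] continuous_on_id])
    moreover have "closed {X::real^'d^'d. r \<le> y \<bullet> (X *v y)}" for r y
      by (rule closed_Collect_le[OF continuous_on_const
            continuous_on_inner[OF continuous_on_const
              continuous_on_matrix_vector_mult[OF continuous_on_id continuous_on_const]]])
    ultimately show ?thesis by (auto intro!: closed_Int closed_INT)
  qed
  have conv: "(1 / 2) *\<^sub>R (X + Y) \<in> C" if X: "X \<in> C" and Y: "Y \<in> C" for X Y
    unfolding C_def
  proof (intro CollectI conjI ballI allI)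
    show "transpose ((1 / 2) *\<^sub>R (X + Y)) = (1 / 2) *\<^sub>R (X + Y)"
      using X Y unfolding C_def linear_scale[OF bounded_linear.linear[OF bounded_linear_transpose]]
        linear_add[OF bounded_linear.linear[OF bounded_linear_transpose]] by simp
    show "act E ((1 / 2) *\<^sub>R (X + Y)) = (1 / 2) *\<^sub>R (X + Y)"
      using X Y unfolding C_def linear_scale[OF bounded_linear.linear[OF bounded_linear_act]]
        linear_add[OF bounded_linear.linear[OF bounded_linear_act]] by simp
    fix g x assume g: "g \<in> G"
    have "(g *v x) \<bullet> ((1 / 2) *\<^sub>R (X + Y) *v (g *v x)) =
        ((g *v x) \<bullet> (X *v (g *v x)) + (g *v x) \<bullet> (Y *v (g *v x))) / 2"
      by (simp add: matrix_vector_scaleR_left matrix_vector_mult_add_rdistrib inner_add_right)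
    moreover have "(norm (E *v x))\<^sup>2 / (B * K2 + 1)\<^sup>2 \<le> (g *v x) \<bullet> (X *v (g *v x))"
      using X g unfolding C_def by blast
    moreover have "(norm (E *v x))\<^sup>2 / (B * K2 + 1)\<^sup>2 \<le> (g *v x) \<bullet> (Y *v (g *v x))"
      using Y g unfolding C_def by blast
    moreover have "r \<le> p \<Longrightarrow> r \<le> q \<Longrightarrow> r \<le> (p + q) / 2" for r p q :: real by simp
    ultimately show "(norm (E *v x))\<^sup>2 / (B * K2 + 1)\<^sup>2 \<le> (g *v x) \<bullet> ((1 / 2) *\<^sub>R (X + Y) *v (g *v x))"
      by metis
  qed
  have C_act: "act g X \<in> C" if X: "X \<in> C" and g: "g \<in> G" for g X
    unfolding C_def
  proof (intro CollectI conjI ballI allI)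
    have "transpose X = X" using X unfolding C_def by blast
    then show "transpose (act g X) = act g X"
      by (simp add: matrix_transpose_mul matrix_mul_assoc)
    show "act E (act g X) = act g X" by (simp only: act_act unit[OF g])
    fix h x assume h: "h \<in> G"
    have "(norm (E *v x))\<^sup>2 / (B * K2 + 1)\<^sup>2 \<le> ((g ** h) *v x) \<bullet> (X *v ((g ** h) *v x))"
      using X mult[OF g h] unfolding C_def by blast
    also have "\<dots> = (h *v x) \<bullet> (act g X *v (h *v x))"
      unfolding inner_act by (simp only: matrix_vector_mul_assoc[symmetric])
    finally show "(norm (E *v x))\<^sup>2 / (B * K2 + 1)\<^sup>2 \<le> (h *v x) \<bullet> (act g X *v (h *v x))" .
  qed
  define \<phi> where "\<phi> X = (SUP g\<in>G. norm (act g X))" for X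
  have Gne: "G \<noteq> {}" using E by blast
  have \<phi>_bdd: "bdd_above ((\<lambda>g. norm (act g X)) ` G)" for X
    using act_le by (auto intro!: bdd_aboveI2)
  have \<phi>_ge: "norm (act g X) \<le> \<phi> X" if "g \<in> G" for g X
    unfolding \<phi>_def by (intro cSUP_upper that \<phi>_bdd)
  have \<phi>_diff: "\<phi> X \<le> \<phi> Y + L * norm (X - Y)" for X Y
    unfolding \<phi>_def
  proof (rule cSUP_least[OF Gne])
    fix g assume g: "g \<in> G"
    have "act g X = act g Y + act g (X - Y)"
      by (simp add: matrix_diff_left matrix_diff_right)
    then have "norm (act g X) \<le> norm (act g Y) + norm (act g (X - Y))"
      by (metis norm_triangle_ineq)
    then show "norm (act g X) \<le> (SUP g\<in>G. norm (act g Y)) + L * norm (X - Y)"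
      using act_le[OF g, of "X - Y"] \<phi>_ge[OF g, of Y] unfolding \<phi>_def by linarith
  qed
  have \<phi>_cont: "continuous_on S \<phi>" for S
  proof -
    have "L-lipschitz_on S \<phi>"
    proof (rule lipschitz_onI)
      fix X Y
      show "dist (\<phi> X) (\<phi> Y) \<le> L * dist X Y"
        using \<phi>_diff[of X Y] \<phi>_diff[of Y X] by (simp add: dist_norm norm_minus_commute abs_le_iff)
    qed (use L in simp)
    then show ?thesis by (rule lipschitz_on_continuous_on)
  qed
  have \<phi>_act: "\<phi> (act g X) \<le> \<phi> X" if "g \<in> G" for g X
    unfolding \<phi>_def[of "act g X"]
    by (rule cSUP_least[OF Gne]) (simp add: act_act \<phi>_ge mult that del: matrix_transpose_mul)
  have norm_le_\<phi>: "norm X \<le> \<phi> X" if "X \<in> C" for X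
  proof -
    have "act E X = X" using \<open>X \<in> C\<close> unfolding C_def by blast
    then have "norm X = norm (act E X)" by (rule arg_cong[OF sym])
    then show ?thesis using \<phi>_ge[OF E, of X] by (rule ord_eq_le_trans)
  qed
  \<comment> \<open>A nonempty sublevel set of \<open>\<phi>\<close> in \<open>C\<close> is compact, since \<open>\<phi>\<close> dominates the norm there.\<close>
  define D where "D = C \<inter> {X. \<phi> X \<le> \<phi> (act E (mat 1))}"
  have "compact D"
  proof -
    have "closed {X. \<phi> X \<le> \<phi> (act E (mat 1))}"
      by (rule closed_Collect_le[OF \<phi>_cont continuous_on_const])
    then have "closed D" unfolding D_def by (rule closed_Int[OF closed])
    moreover have "norm X \<le> \<phi> (act E (mat 1))" if "X \<in> D" for X
    proof -
      have X: "X \<in> C" "\<phi> X \<le> \<phi> (act E (mat 1))"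
        using \<open>X \<in> D\<close> unfolding D_def by blast+
      show ?thesis by (rule order_trans[OF norm_le_\<phi>[OF X(1)] X(2)])
    qed
    then have "bounded D" by (rule boundedI)
    ultimately show ?thesis unfolding compact_eq_bounded_closed by blast
  qed
  moreover have "D \<noteq> {}" using \<open>act E (mat 1) \<in> C\<close> unfolding D_def by blast
  ultimately have "\<exists>H\<in>D. \<forall>Y\<in>D. \<phi> H \<le> \<phi> Y" by (rule continuous_attains_inf[OF _ _ \<phi>_cont])
  then obtain H where H: "H \<in> D" "\<And>Y. Y \<in> D \<Longrightarrow> \<phi> H \<le> \<phi> Y" by blast
  have HC: "H \<in> C" using H(1) by (simp add: D_def)
  have min: "\<phi> H \<le> \<phi> Y" if "Y \<in> C" for Y
  proof (cases "Y \<in> D")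
    case False
    then show ?thesis using that H(1) by (auto simp: D_def)
  qed (rule H)
  have act_ge: "norm X \<le> L * norm (act g X)" if X: "act E X = X" and g: "g \<in> G" for X g
  proof -
    obtain h where h: "h \<in> G" "g ** h = E" using inv[OF g] by blast
    have "X = act h (act g X)" by (simp only: act_act h X)
    then show ?thesis using act_le[OF h(1), of "act g X"] by simp
  qed
  have uniq: "X = H" if X: "X \<in> C" "\<phi> X \<le> \<phi> H" for X
  proof (rule ccontr)
    assume "X \<noteq> H"
    \<comment> \<open>By the parallelogram law the midpoint of two minimisers would lower \<open>\<phi>\<^sup>2\<close> by \<open>r\<close>.\<close>
    define r where "r = (norm (X - H) / L)\<^sup>2 / 4"
    have r: "0 < r" using \<open>X \<noteq> H\<close> L by (simp add: r_def)
    have \<phi>0: "0 \<le> \<phi> Y" for Y using \<phi>_ge[OF E, of Y] norm_ge_zero order_trans by blast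
    have "(norm (act g ((1 / 2) *\<^sub>R (X + H))))\<^sup>2 \<le> (\<phi> H)\<^sup>2 - r" if g: "g \<in> G" for g
    proof -
      have 1: "act g ((1 / 2) *\<^sub>R (X + H)) = (1 / 2) *\<^sub>R (act g X + act g H)"
        by (simp add: matrix_scaleR_left matrix_scaleR_right matrix_add_ldistrib
            bounded_bilinear.add_left[OF bounded_bilinear_matrix_mult])
      have 2: "act g (X - H) = act g X - act g H"
        by (simp add: matrix_diff_left matrix_diff_right)
      have 3: "(norm ((1 / 2) *\<^sub>R (a + b)))\<^sup>2 = (norm a)\<^sup>2 / 2 + (norm b)\<^sup>2 / 2 - (norm (a - b))\<^sup>2 / 4"
        for a b :: "real^'d^'d"
        by (simp add: power2_norm_eq_inner inner_add_left inner_add_right inner_diff_left inner_diff_right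
            inner_commute field_simps)
      have "norm (X - H) / L \<le> norm (act g X - act g H)"
        using act_ge[of "X - H" g] X HC g L unfolding 2[symmetric]
        by (simp add: divide_le_eq mult.commute C_def matrix_diff_left matrix_diff_right)
      then have "(norm (X - H) / L)\<^sup>2 \<le> (norm (act g X - act g H))\<^sup>2"
        using L by (intro power_mono) auto
      moreover have "(norm (act g X))\<^sup>2 \<le> (\<phi> H)\<^sup>2" "(norm (act g H))\<^sup>2 \<le> (\<phi> H)\<^sup>2"
        using \<phi>_ge[OF g, of X] \<phi>_ge[OF g, of H] X(2) by (auto intro!: power_mono)
      ultimately show ?thesis unfolding 1 3 r_def by linarith
    qed
    then have "norm (act g ((1 / 2) *\<^sub>R (X + H))) \<le> sqrt ((\<phi> H)\<^sup>2 - r)" if "g \<in> G" for g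
      using that by (intro real_le_rsqrt) blast
    then have "\<phi> ((1 / 2) *\<^sub>R (X + H)) \<le> sqrt ((\<phi> H)\<^sup>2 - r)"
      unfolding \<phi>_def[of "(1 / 2) *\<^sub>R (X + H)"] by (intro cSUP_least Gne) auto
    also have "\<dots> < sqrt ((\<phi> H)\<^sup>2)" using r by (intro real_sqrt_less_mono) simp
    also have "\<dots> = \<phi> H" using \<phi>0 by simp
    finally show False using min[OF conv[OF X(1) HC]] by simp
  qed
  show ?thesis
  proof (intro exI[of _ H] exI[of _ "1 / (B * K2 + 1)\<^sup>2"] conjI ballI allI)
    show "transpose H = H" using HC by (simp add: C_def)
    show "act g H = H" if "g \<in> G" for g
      using C_act[OF HC that] \<phi>_act[OF that, of H] by (rule uniq)
    show "0 < 1 / (B * K2 + 1)\<^sup>2" using BK by simp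
    fix x
    have "act E H = H" using HC by (simp add: C_def)
    then have "x \<bullet> (H *v x) = (E *v x) \<bullet> (H *v (E *v x))" by (metis inner_act)
    then show "1 / (B * K2 + 1)\<^sup>2 * (norm (E *v x))\<^sup>2 \<le> x \<bullet> (H *v x)"
      using HC E by (auto simp: C_def)
  qed
qed

section \<open>Idempotents of minimal rank in a compact semigroup of matrices\<close>

abbreviation rng :: "real^'d^'d \<Rightarrow> (real^'d) set" where
  "rng M \<equiv> range ((*v) M)"

lemma subspace_rng: "subspace (rng M)"
  by (intro linear_subspace_image matrix_vector_mul_linear subspace_UNIV)

lemma rng_mult_subset: "rng (M ** N) \<subseteq> rng M"
  by (auto simp: matrix_vector_mul_assoc[symmetric])

lemma mpow_in_semigroup:
  assumes "T \<in> K" "mat 1 \<in> K" "\<And>X Y. X \<in> K \<Longrightarrow> Y \<in> K \<Longrightarrow> X ** Y \<in> K"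
  shows "mpow T n \<in> K"
  by (induction n) (auto intro: assms)

lemma mpow_add: "mpow T (m + n) = mpow T m ** mpow T n"
  by (induction m) (simp_all add: matrix_mul_assoc)

text \<open>If two powers \<open>T ^ m\<close> and \<open>T ^ (m + q)\<close> are close together, then \<open>T ^ q\<close> almost fixes the
  range of \<open>T ^ m\<close>. In the limit along a convergent subsequence this gives a matrix \<open>E\<close> that fixes
  a subspace of dimension at least the minimal rank, hence the whole range of \<open>T\<close>.\<close>

lemma minimal_rank_idempotent:
  fixes K :: "(real^'d^'d) set"
  assumes K: "compact K" "mat 1 \<in> K" "\<And>X Y. X \<in> K \<Longrightarrow> Y \<in> K \<Longrightarrow> X ** Y \<in> K"
    and T: "T \<in> K" and min: "\<And>X. X \<in> K \<Longrightarrow> dim (rng T) \<le> dim (rng X)"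
  obtains E h where "E \<in> K" "h \<in> K" "E ** E = E" "T ** h = E" "h ** T = E" "rng E = rng T"
proof -
  have pow: "mpow T n \<in> K" for n by (rule mpow_in_semigroup[OF T K(2,3)])
  obtain L \<psi> where L: "L \<in> K" "strict_mono (\<psi> :: nat \<Rightarrow> nat)" "((\<lambda>n. mpow T n) \<circ> \<psi>) \<longlonglongrightarrow> L"
    using K(1) pow unfolding compact_def by metis
  \<comment> \<open>One power of \<open>T\<close> is split off from each gap so that the limit also provides the inverse \<open>h\<close>.\<close>
  define m where "m k = \<psi> (Suc k) - \<psi> k - 1" for k
  have gap: "\<psi> (Suc k) = Suc (m k) + \<psi> k" for k
    using strict_monoD[OF L(2), of k "Suc k"] unfolding m_def by auto
  obtain h \<kappa> where h: "h \<in> K" "strict_mono (\<kappa> :: nat \<Rightarrow> nat)" "((\<lambda>k. mpow T (m k)) \<circ> \<kappa>) \<longlonglongrightarrow> h"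
    using K(1) pow unfolding compact_def by metis
  have L1: "(\<lambda>j. mpow T (\<psi> (\<kappa> j))) \<longlonglongrightarrow> L"
    using LIMSEQ_subseq_LIMSEQ[OF L(3) h(2)] by (simp add: o_def)
  have L2: "(\<lambda>j. mpow T (\<psi> (Suc (\<kappa> j)))) \<longlonglongrightarrow> L"
  proof -
    have "strict_mono (\<lambda>j. Suc (\<kappa> j))" using h(2) by (simp add: strict_mono_def)
    from LIMSEQ_subseq_LIMSEQ[OF L(3) this] show ?thesis by (simp add: o_def)
  qed
  have hl: "(\<lambda>j. mpow T (m (\<kappa> j))) \<longlonglongrightarrow> h" using h(3) by (simp add: o_def)
  have hT: "h ** T = T ** h"
  proof (rule LIMSEQ_unique)
    show "(\<lambda>j. mpow T (m (\<kappa> j)) ** T) \<longlonglongrightarrow> h ** T"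
      by (rule tendsto_matrix_mult[OF hl tendsto_const])
    show "(\<lambda>j. mpow T (m (\<kappa> j)) ** T) \<longlonglongrightarrow> T ** h"
      unfolding mpow_commute[symmetric] by (rule tendsto_matrix_mult[OF tendsto_const hl])
  qed
  define E where "E = T ** h"
  have EL: "E ** L = L"
  proof (rule LIMSEQ_unique[OF _ L2])
    show "(\<lambda>j. mpow T (\<psi> (Suc (\<kappa> j)))) \<longlonglongrightarrow> E ** L"
      unfolding gap mpow_add mpow.simps(2) E_def
      by (rule tendsto_matrix_mult[OF tendsto_matrix_mult[OF tendsto_const hl] L1])
  qed
  have EK: "E \<in> K" unfolding E_def by (intro K T h)
  have rET: "rng E \<subseteq> rng T" unfolding E_def by (rule rng_mult_subset)
  have "rng L \<subseteq> rng E" using rng_mult_subset[of E L] EL by simp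
  then have rLE: "rng L = rng E"
    using min[OF L(1)] dim_subset[OF rET] by (intro subspace_dim_equal subspace_rng) auto
  have rE: "rng E = rng T"
    using min[OF EK] rET by (intro subspace_dim_equal subspace_rng)
  have "E *v (E *v x) = E *v x" for x
  proof -
    obtain y where "E *v x = L *v y" using rLE by blast
    then show ?thesis by (simp add: matrix_vector_mul_assoc EL)
  qed
  then have EE: "E ** E = E" by (simp add: matrix_eq matrix_vector_mul_assoc)
  show ?thesis
    by (rule that[OF EK h(1) EE E_def[symmetric] _ rE]) (simp only: hT E_def)
qed

text \<open>Each compression \<open>E ** U ** E\<close> again has minimal rank and hence the same range as \<open>E\<close>. The
  idempotent obtained from its powers fixes that range and has the kernel of \<open>E\<close>, so it is \<open>E\<close>
  itself.\<close>

lemma minimal_rank_group: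
  fixes K :: "(real^'d^'d) set"
  assumes K: "compact K" "mat 1 \<in> K" "\<And>X Y. X \<in> K \<Longrightarrow> Y \<in> K \<Longrightarrow> X ** Y \<in> K"
  obtains E where "E \<in> K" "E ** E = E"
    "\<And>U. U \<in> K \<Longrightarrow> \<exists>V\<in>K. (E ** U ** E) ** (E ** V ** E) = E \<and> (E ** V ** E) ** (E ** U ** E) = E"
proof -
  obtain T where T: "T \<in> K" "\<And>X. X \<in> K \<Longrightarrow> dim (rng T) \<le> dim (rng X)"
    using ex_has_least_nat[of "\<lambda>X. X \<in> K" "mat 1" "\<lambda>X. dim (rng X)"] K(2) by blast
  obtain E h where E: "E \<in> K" "E ** E = E" "rng E = rng T"
    using minimal_rank_idempotent[OF K T] by metis
  have "\<exists>V\<in>K. (E ** U ** E) ** (E ** V ** E) = E \<and> (E ** V ** E) ** (E ** U ** E) = E" if U: "U \<in> K" for U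
  proof -
    define g where "g = E ** U ** E"
    have gK: "g \<in> K" unfolding g_def by (intro K E U)
    have gE: "g ** E = g" "E ** g = g"
      unfolding g_def by (metis E(2) matrix_mul_assoc)+
    have rg: "rng g = rng E"
    proof (rule subspace_dim_equal[OF subspace_rng subspace_rng])
      show "rng g \<subseteq> rng E" using rng_mult_subset[of E g] gE by simp
      show "dim (rng E) \<le> dim (rng g)" using T(2)[OF gK] E(3) by simp
    qed
    have "dim (rng g) \<le> dim (rng X)" if "X \<in> K" for X
      using T(2)[OF that] rg E(3) by simp
    then obtain F k where F: "F \<in> K" "k \<in> K" "F ** F = F" "g ** k = F" "k ** g = F" "rng F = rng g"
      using minimal_rank_idempotent[OF K gK] by metis
    have "F = E"
    proof -
      have "F *v x = E *v x" for x
      proof -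
        obtain y where y: "E *v x = F *v y" using F(6) rg by blast
        have "F *v x = (F ** E) *v x" using F(5) gE by (metis matrix_mul_assoc)
        also have "\<dots> = F *v (F *v y)" by (simp add: y[symmetric] matrix_vector_mul_assoc)
        also have "\<dots> = E *v x" by (simp add: y matrix_vector_mul_assoc F(3))
        finally show ?thesis .
      qed
      then show ?thesis by (simp add: matrix_eq)
    qed
    then have "g ** (E ** k ** E) = E" "(E ** k ** E) ** g = E"
      using F(4,5) gE E(2) by (metis matrix_mul_assoc)+
    then show ?thesis using F(2) unfolding g_def by blast
  qed
  then show ?thesis using that E by blast
qed

section \<open>Bounded irreducible semigroups of norm one\<close>

inductive_set flow_semigroup :: "('n \<Rightarrow> real^'d^'d) \<Rightarrow> (real^'d^'d) set" for B where
  one: "mat 1 \<in> flow_semigroup B"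
| step: "U \<in> flow_semigroup B \<Longrightarrow> 0 \<le> t \<Longrightarrow> mexp (t *\<^sub>R B i) ** U \<in> flow_semigroup B"

inductive_set flow_group :: "('n \<Rightarrow> real^'d^'d) \<Rightarrow> (real^'d^'d) set" for B where
  one: "mat 1 \<in> flow_group B"
| step: "U \<in> flow_group B \<Longrightarrow> mexp (t *\<^sub>R B i) ** U \<in> flow_group B"

lemma flow_semigroup_mexp: "0 \<le> t \<Longrightarrow> mexp (t *\<^sub>R B i) \<in> flow_semigroup B"
  using flow_semigroup.step[OF flow_semigroup.one, of t B i] by simp

lemma flow_semigroup_mult:
  assumes "U \<in> flow_semigroup B" "V \<in> flow_semigroup B" shows "U ** V \<in> flow_semigroup B"
  using assms(1)
  by induction (auto simp: assms(2) matrix_mul_assoc[symmetric] intro: flow_semigroup.step)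

lemma flow_group_mexp: "mexp (t *\<^sub>R B i) \<in> flow_group B"
  using flow_group.step[OF flow_group.one, of t B i] by simp

lemma flow_group_mult:
  assumes "U \<in> flow_group B" "V \<in> flow_group B" shows "U ** V \<in> flow_group B"
  using assms(1)
  by induction (auto simp: assms(2) matrix_mul_assoc[symmetric] intro: flow_group.step)

lemma flow_group_inverse:
  assumes "U \<in> flow_group B" shows "\<exists>V\<in>flow_group B. U ** V = mat 1 \<and> V ** U = mat 1"
  using assms
proof induction
  case one
  show ?case by (intro bexI[of _ "mat 1"] flow_group.one) simp
next
  case (step U t i)
  then obtain V where V: "V \<in> flow_group B" "U ** V = mat 1" "V ** U = mat 1" by blast
  have "(mexp (t *\<^sub>R B i) ** U) ** (V ** mexp (- t *\<^sub>R B i)) = mat 1"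
    using V(2) mexp_mult_minus[of t "B i"] by (metis matrix_mul_assoc matrix_mul_rid)
  moreover have "(V ** mexp (- t *\<^sub>R B i)) ** (mexp (t *\<^sub>R B i) ** U) = mat 1"
    using V(3) mexp_minus_mult[of t "B i"] by (metis matrix_mul_assoc matrix_mul_rid)
  ultimately show ?case using V(1) by (blast intro: flow_group_mult flow_group_mexp)
qed

lemma generator_limit:
  fixes M :: "real^'d^'d"
  shows "((\<lambda>t. (1 / t) *\<^sub>R (mexp (t *\<^sub>R M) *v x - x)) \<longlongrightarrow> M *v x) (at_right 0)"
proof -
  let ?f = "\<lambda>t. mexp (t *\<^sub>R M) *v x"
  have "(?f has_vector_derivative (M ** mexp (0 *\<^sub>R M)) *v x) (at 0 within {0<..})"
    by (rule bounded_linear.has_vector_derivative[OF bounded_bilinear.bounded_linear_left[OF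
          bounded_bilinear_matrix_vector_mult] has_vector_derivative_mexp])
  then have "((\<lambda>t. (1 / norm (t - 0)) *\<^sub>R (?f t - (?f 0 + (t - 0) *\<^sub>R (M *v x)))) \<longlongrightarrow> 0) (at_right 0)"
    by (simp add: has_vector_derivative_def has_derivative_within mexp_0)
  moreover have "\<forall>\<^sub>F t in at_right 0. (1 / norm (t - 0)) *\<^sub>R (?f t - (?f 0 + (t - 0) *\<^sub>R (M *v x))) =
      (1 / t) *\<^sub>R (?f t - x) - M *v x"
    using eventually_at_right_less[of "0::real"]
    by eventually_elim (simp add: mexp_0 scaleR_diff_right scaleR_add_right)
  ultimately have "((\<lambda>t. (1 / t) *\<^sub>R (?f t - x) - M *v x) \<longlongrightarrow> 0) (at_right 0)"
    by (rule Lim_transform_eventually)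
  then show ?thesis by (rule LIM_zero_cancel)
qed

lemma invariant_subspace_trivial:
  fixes B :: "'n \<Rightarrow> real^'d^'d"
  assumes irr: "irreducible_family B" and S: "subspace S"
    and inv: "\<And>i t x. 0 \<le> t \<Longrightarrow> x \<in> S \<Longrightarrow> mexp (t *\<^sub>R B i) *v x \<in> S"
  shows "S = {0} \<or> S = UNIV"
proof -
  have "B i *v x \<in> S" if "x \<in> S" for i x
  proof (rule Lim_in_closed_set[OF closed_subspace[OF S] _ _ generator_limit])
    show "\<forall>\<^sub>F t in at_right 0. (1 / t) *\<^sub>R (mexp (t *\<^sub>R B i) *v x - x) \<in> S"
      using eventually_at_right_less[of "0::real"]
    proof eventually_elim
      case (elim t)
      then show ?case using inv[of t x i] that
        by (intro subspace_scale[OF S] subspace_diff[OF S]) auto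
    qed
  qed simp
  then show ?thesis using irr S unfolding irreducible_family_def by blast
qed

text \<open>The compact closure \<open>K\<close> of the semigroup contains an idempotent \<open>E\<close> of minimal rank, and the
  compressions \<open>E U E\<close> form a group with an invariant quadratic form \<open>H\<close>. Hence
  \<open>t \<mapsto> H(E V mexp (t B) W E x)\<close> is constant for \<open>t \<ge> 0\<close>; being entire it is constant on the whole
  line, and so \<open>H(E V W E x) = H(E x)\<close> extends from the semigroup to \<open>W\<close> in the group generated
  by the flows. Irreducibility, used for the vectors \<open>E x\<close> and for the observations \<open>E V\<close>, turns this
  into boundedness of the group.\<close>

lemma flow_group_bounded:
  fixes B :: "'n \<Rightarrow> real^'d^'d" and e :: "real^'d \<Rightarrow> real"
  assumes irr: "irreducible_family B" and e: "is_norm e"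
    and one: "\<And>U. U \<in> flow_semigroup B \<Longrightarrow> opnorm e U = 1"
  shows "bounded (flow_group B)"
proof -
  define K where "K = closure (flow_semigroup B)"
  have K_one: "opnorm e U = 1" if "U \<in> K" for U
  proof -
    have "closed {U. opnorm e U = 1}"
      by (rule closed_Collect_eq[OF continuous_on_opnorm[OF e] continuous_on_const])
    then have "K \<subseteq> {U. opnorm e U = 1}"
      unfolding K_def using one by (intro closure_minimal) auto
    then show ?thesis using that by blast
  qed
  obtain c0 where c0: "0 < c0" "\<And>U. c0 * norm U \<le> opnorm e U"
    using is_norm_ge_norm[OF is_norm_opnorm[OF e]] by blast
  have "norm U \<le> 1 / c0" if "U \<in> K" for U
    using c0(2)[of U] K_one[OF that] c0(1) by (simp add: le_divide_eq mult.commute)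
  then have bdK: "bounded K" by (rule boundedI)
  have cK: "compact K"
    using bdK unfolding compact_eq_bounded_closed K_def by simp
  have SK: "flow_semigroup B \<subseteq> K" unfolding K_def by (rule closure_subset)
  have K1: "mat 1 \<in> K" using SK flow_semigroup.one by blast
  have Kmult: "X ** Y \<in> K" if X: "X \<in> K" and Y: "Y \<in> K" for X Y
  proof -
    obtain f g where f: "\<And>n. f n \<in> flow_semigroup B" "f \<longlonglongrightarrow> X"
      and g: "\<And>n. g n \<in> flow_semigroup B" "g \<longlonglongrightarrow> Y"
      using X Y unfolding K_def closure_sequential by blast
    have "(\<lambda>n. f n ** g n) \<longlonglongrightarrow> X ** Y" by (rule tendsto_matrix_mult[OF f(2) g(2)])
    moreover have "f n ** g n \<in> flow_semigroup B" for n by (rule flow_semigroup_mult[OF f(1) g(1)])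
    ultimately show ?thesis
      unfolding K_def closure_sequential by (intro exI[of _ "\<lambda>n. f n ** g n"] conjI allI)
  qed
  obtain E where E: "E \<in> K" "E ** E = E" and
    grp: "\<And>U. U \<in> K \<Longrightarrow> \<exists>V\<in>K. (E ** U ** E) ** (E ** V ** E) = E \<and> (E ** V ** E) ** (E ** U ** E) = E"
    using minimal_rank_group[OF cK K1 Kmult] by metis
  define G where "G = (\<lambda>U. E ** U ** E) ` K"
  have GK: "G \<subseteq> K" unfolding G_def using Kmult E by blast
  have G1: "E \<in> G" unfolding G_def using K1 E by (auto intro!: image_eqI[of _ _ "mat 1"])
  have G2: "bounded G" using bdK GK by (rule bounded_subset)
  have G3: "g ** h \<in> G" if gh: "g \<in> G" "h \<in> G" for g h
  proof -
    obtain U V where UV: "U \<in> K" "V \<in> K" "g = E ** U ** E" "h = E ** V ** E"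
      using gh unfolding G_def by blast
    have "g ** h = E ** (U ** E ** V) ** E" unfolding UV by (metis E(2) matrix_mul_assoc)
    then show ?thesis unfolding G_def using Kmult UV E by blast
  qed
  have G4: "g ** E = g" if "g \<in> G" for g
    using that E(2) unfolding G_def by (auto simp: matrix_mul_assoc[symmetric])
  have G5: "\<exists>h\<in>G. g ** h = E \<and> h ** g = E" if "g \<in> G" for g
    using that grp unfolding G_def by fastforce
  obtain H :: "real^'d^'d" and c where H: "transpose H = H" "\<And>g. g \<in> G \<Longrightarrow> act g H = H" "0 < c"
    "\<And>x. c * (norm (E *v x))\<^sup>2 \<le> x \<bullet> (H *v x)"
    using bounded_group_invariant_form[OF G1 G2 G3 G4 G5] by blast
  define q where "q x = x \<bullet> (H *v x)" for x
  have q_inv: "q (E *v (V *v (W *v (E *v x)))) = q x" if "V \<in> K" "W \<in> K" for V W x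
  proof -
    have "E ** (V ** W) ** E \<in> G" unfolding G_def using Kmult that by blast
    from H(2)[OF this] have "q x = q ((E ** (V ** W) ** E) *v x)"
      unfolding q_def inner_act[symmetric] by (rule arg_cong[OF sym])
    then show ?thesis by (simp only: matrix_vector_mul_assoc[symmetric])
  qed
  have q_group: "\<forall>V\<in>K. \<forall>x. q (E *v (V *v (W *v (E *v x)))) = q x" if "W \<in> flow_group B" for W
    using that
  proof induction
    case one
    then show ?case using q_inv[OF _ K1] by simp
  next
    case (step W t i)
    show ?case
    proof (intro ballI allI)
      fix V x assume V: "V \<in> K"
      define y where "y = W *v (E *v x)"
      define f where "f s = q (E *v (V *v (mexp (s *\<^sub>R B i) *v y)))" for s
      have "f s = q x" if "0 \<le> s" for s
      proof -
        have "V ** mexp (s *\<^sub>R B i) \<in> K"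
          by (rule Kmult[OF V subsetD[OF SK flow_semigroup_mexp[OF \<open>0 \<le> s\<close>]]])
        then have "q (E *v ((V ** mexp (s *\<^sub>R B i)) *v (W *v (E *v x)))) = q x" using step.IH by blast
        then show ?thesis unfolding f_def y_def by (simp only: matrix_vector_mul_assoc[symmetric])
      qed
      moreover have "real_entire f"
      proof -
        define g where "g s = (E ** V) *v (mexp (s *\<^sub>R B i) *v y)" for s
        have ge: "real_entire (\<lambda>s. g s $ j)" for j
          unfolding g_def matrix_vector_mult_def vec_lambda_beta
          by (intro real_entire_sum real_entire_mult real_entire_const real_entire_mexp_entry)
        have "f s = (\<Sum>j\<in>UNIV. g s $ j * (\<Sum>k\<in>UNIV. H $ j $ k * g s $ k))" for s
        proof -
          have "f s = q (g s)" unfolding f_def g_def by (simp only: matrix_vector_mul_assoc[symmetric])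
          then show ?thesis by (simp add: q_def inner_vec_def) (simp add: matrix_vector_mult_def)
        qed
        then have "f = (\<lambda>s. \<Sum>j\<in>UNIV. g s $ j * (\<Sum>k\<in>UNIV. H $ j $ k * g s $ k))" by blast
        then show ?thesis
          by (simp only:) (intro real_entire_sum real_entire_mult real_entire_const ge)
      qed
      ultimately have "f t = q x" by (rule real_entire_constant[rotated])
      then show "q (E *v (V *v ((mexp (t *\<^sub>R B i) ** W) *v (E *v x)))) = q x"
        unfolding f_def y_def by (simp only: matrix_vector_mul_assoc[symmetric])
    qed
  qed
  \<comment> \<open>The observations \<open>E V\<close> together define a norm.\<close>
  define N where "N z = (SUP V\<in>K. norm (E *v (V *v z)))" for z
  obtain k2 where k2: "0 < k2" "\<And>(X :: real^'d^'d) y. norm (X *v y) \<le> norm X * norm y * k2"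
    using bounded_bilinear.pos_bounded[OF bounded_bilinear_matrix_vector_mult] by blast
  obtain b where b: "\<And>U. U \<in> K \<Longrightarrow> norm U \<le> b" using bdK unfolding bounded_iff by blast
  have Kne: "K \<noteq> {}" using K1 by blast
  have N_bdd: "bdd_above ((\<lambda>V. norm (E *v (V *v z))) ` K)" for z
  proof (rule bdd_aboveI2)
    fix V assume V: "V \<in> K"
    have "norm (E *v (V *v z)) = norm ((E ** V) *v z)" by (simp add: matrix_vector_mul_assoc)
    also have "\<dots> \<le> norm (E ** V) * norm z * k2" by (rule k2)
    also have "\<dots> \<le> b * norm z * k2"
      using b[OF Kmult[OF E(1) V]] k2 by (intro mult_right_mono) auto
    finally show "norm (E *v (V *v z)) \<le> b * norm z * k2" .
  qed
  have N_ge: "norm (E *v (V *v z)) \<le> N z" if "V \<in> K" for V z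
    unfolding N_def by (intro cSUP_upper that N_bdd)
  have N_le: "N z \<le> r" if "\<And>V. V \<in> K \<Longrightarrow> norm (E *v (V *v z)) \<le> r" for z r
    unfolding N_def by (intro cSUP_least Kne that)
  have N_norm: "is_norm N"
    unfolding is_norm_def
  proof (intro conjI allI)
    show N0: "0 \<le> N z" for z using N_ge[OF K1] norm_ge_zero order_trans by blast
    show "N (x + y) \<le> N x + N y" for x y
    proof (rule N_le)
      fix V assume V: "V \<in> K"
      have "norm (E *v (V *v (x + y))) \<le> norm (E *v (V *v x)) + norm (E *v (V *v y))"
        by (simp add: matrix_vector_right_distrib norm_triangle_ineq)
      then show "norm (E *v (V *v (x + y))) \<le> N x + N y"
        using N_ge[OF V, of x] N_ge[OF V, of y] by linarith
    qed
    have N_scale: "N (r *\<^sub>R x) \<le> \<bar>r\<bar> * N x" for r x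
      by (rule N_le) (simp add: matrix_vector_mult_scaleR mult_left_mono N_ge)
    show "N (r *\<^sub>R x) = \<bar>r\<bar> * N x" for r x
    proof (cases "r = 0")
      case True
      then show ?thesis using N_scale[of 0 x] N0[of 0] by simp
    next
      case False
      then show ?thesis using N_scale[of r x] N_scale[of "1 / r" "r *\<^sub>R x"] by (simp add: field_simps)
    qed
    define Z where "Z = {z. \<forall>V\<in>K. E *v (V *v z) = 0}"
    have "subspace Z"
      by (auto simp: subspace_def Z_def matrix_vector_right_distrib matrix_vector_mult_scaleR)
    moreover have "mexp (t *\<^sub>R B i) *v z \<in> Z" if "0 \<le> t" "z \<in> Z" for t i z
      unfolding Z_def
    proof (intro CollectI ballI)
      fix V assume V: "V \<in> K"
      have "V ** mexp (t *\<^sub>R B i) \<in> K"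
        by (rule Kmult[OF V subsetD[OF SK flow_semigroup_mexp[OF \<open>0 \<le> t\<close>]]])
      then have "E *v ((V ** mexp (t *\<^sub>R B i)) *v z) = 0" using \<open>z \<in> Z\<close> unfolding Z_def by blast
      then show "E *v (V *v (mexp (t *\<^sub>R B i) *v z)) = 0"
        by (simp only: matrix_vector_mul_assoc[symmetric])
    qed
    ultimately have "Z = {0} \<or> Z = UNIV" by (rule invariant_subspace_trivial[OF irr])
    moreover have "Z \<noteq> UNIV"
    proof
      assume "Z = UNIV"
      then have "E *v (mat 1 *v z) = 0" for z using K1 unfolding Z_def by blast
      then have "E = 0" by (simp add: matrix_eq)
      then show False using K_one[OF E(1)] is_norm_zero[OF is_norm_opnorm[OF e]] by simp
    qed
    ultimately have Z0: "Z = {0}" by blast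
    show "N z = 0 \<longleftrightarrow> z = 0" for z
    proof
      assume "N z = 0"
      then have "z \<in> Z" unfolding Z_def using N_ge[of _ z] by auto
      then show "z = 0" using Z0 by blast
    next
      assume "z = 0"
      then show "N z = 0" using N_scale[of 0 z] N0[of 0] by simp
    qed
  qed
  obtain c1 where c1: "0 < c1" "\<And>z. c1 * norm z \<le> N z" using is_norm_ge_norm[OF N_norm] by blast
  define Y where "Y = {y. \<exists>r. \<forall>W\<in>flow_group B. norm (W *v y) \<le> r}"
  have EY: "E *v x \<in> Y" for x
  proof -
    have "norm (W *v (E *v x)) \<le> sqrt (q x / c) / c1" if W: "W \<in> flow_group B" for W
    proof -
      have "N (W *v (E *v x)) \<le> sqrt (q x / c)"
      proof (rule N_le)
        fix V assume V: "V \<in> K"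
        let ?z = "E *v (V *v (W *v (E *v x)))"
        have "E *v (E *v u) = E *v u" for u by (simp add: matrix_vector_mul_assoc E(2))
        then have "E *v ?z = ?z" by (simp only:)
        then have "c * (norm ?z)\<^sup>2 \<le> q ?z" using H(4)[of ?z] by (simp add: q_def)
        also have "\<dots> = q x" using q_group[OF W] V by blast
        finally have "(norm ?z)\<^sup>2 \<le> q x / c" using H(3) by (simp add: le_divide_eq mult.commute)
        then show "norm ?z \<le> sqrt (q x / c)" by (rule real_le_rsqrt)
      qed
      then show ?thesis using c1(2)[of "W *v (E *v x)"] c1(1) by (simp add: le_divide_eq mult.commute)
    qed
    then show ?thesis unfolding Y_def by blast
  qed
  have "subspace Y"
  proof (unfold subspace_def, intro conjI ballI allI)
    show "0 \<in> Y" unfolding Y_def by (auto intro: exI[of _ 0])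
    fix x y r assume x: "x \<in> Y" and y: "y \<in> Y"
    obtain r1 r2 where r: "\<And>W. W \<in> flow_group B \<Longrightarrow> norm (W *v x) \<le> r1"
      "\<And>W. W \<in> flow_group B \<Longrightarrow> norm (W *v y) \<le> r2" using x y unfolding Y_def by blast
    have "norm (W *v (x + y)) \<le> r1 + r2" if "W \<in> flow_group B" for W
      using r[OF that] norm_triangle_ineq[of "W *v x" "W *v y"] by (simp add: matrix_vector_right_distrib)
    then show "x + y \<in> Y" unfolding Y_def by blast
  next
    fix r x assume x: "x \<in> Y"
    obtain r1 where r: "\<And>W. W \<in> flow_group B \<Longrightarrow> norm (W *v x) \<le> r1" using x unfolding Y_def by blast
    have "norm (W *v (r *\<^sub>R x)) \<le> \<bar>r\<bar> * r1" if "W \<in> flow_group B" for W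
      using r[OF that] by (simp add: matrix_vector_mult_scaleR mult_left_mono)
    then show "r *\<^sub>R x \<in> Y" unfolding Y_def by blast
  qed
  moreover have "mexp (t *\<^sub>R B i) *v y \<in> Y" if "0 \<le> t" "y \<in> Y" for t i y
  proof -
    obtain r where r: "\<And>W. W \<in> flow_group B \<Longrightarrow> norm (W *v y) \<le> r"
      using \<open>y \<in> Y\<close> unfolding Y_def by blast
    have "norm (W *v (mexp (t *\<^sub>R B i) *v y)) \<le> r" if "W \<in> flow_group B" for W
      using r[OF flow_group_mult[OF that flow_group_mexp]] by (simp add: matrix_vector_mul_assoc)
    then show ?thesis unfolding Y_def by blast
  qed
  ultimately have "Y = {0} \<or> Y = UNIV" by (rule invariant_subspace_trivial[OF irr])
  moreover have "Y \<noteq> {0}"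
  proof
    assume "Y = {0}"
    then have "E *v z = 0" for z using EY by blast
    then have "E = 0" by (simp add: matrix_eq)
    then show False using K_one[OF E(1)] is_norm_zero[OF is_norm_opnorm[OF e]] by simp
  qed
  ultimately have "Y = UNIV" by blast
  then have "\<exists>r. \<forall>W\<in>flow_group B. norm (W *v axis j 1) \<le> r" for j unfolding Y_def by blast
  then obtain r :: "'d \<Rightarrow> real" where r: "\<And>j W. W \<in> flow_group B \<Longrightarrow> norm (W *v axis j 1) \<le> r j" by metis
  have "norm W \<le> (\<Sum>i\<in>(UNIV :: 'd set). \<Sum>j\<in>UNIV. r j)" if W: "W \<in> flow_group B" for W
  proof -
    have "norm W \<le> (\<Sum>i\<in>UNIV. norm (W $ i))" by (simp add: norm_vec_def L2_set_le_sum)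
    also have "\<dots> \<le> (\<Sum>i\<in>(UNIV :: 'd set). \<Sum>j\<in>UNIV. r j)"
    proof (rule sum_mono)
      fix i
      have "norm (W $ i) \<le> (\<Sum>j\<in>UNIV. \<bar>W $ i $ j\<bar>)" using norm_le_l1_cart[of "W $ i"] by simp
      also have "\<dots> \<le> (\<Sum>j\<in>UNIV. r j)"
      proof (rule sum_mono)
        fix j
        have "W $ i $ j = (W *v axis j 1) $ i"
          by (simp add: matrix_vector_mult_basis column_def)
        then show "\<bar>W $ i $ j\<bar> \<le> r j"
          using component_le_norm_cart[of "W *v axis j 1" i] r[OF W, of j] by simp
      qed
      finally show "norm (W $ i) \<le> (\<Sum>j\<in>UNIV. r j)" .
    qed
    finally show ?thesis .
  qed
  then show ?thesis by (rule boundedI)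
qed

section \<open>From bounded flows to skew-symmetric generators\<close>

text \<open>The Gram--Schmidt process for the inner product with matrix \<open>H\<close>.\<close>

lemma pos_definite_orthonormal_sequence:
  fixes H :: "real^'d^'d"
  assumes sym: "transpose H = H" and c: "0 < c" "\<And>x. c * (norm x)\<^sup>2 \<le> x \<bullet> (H *v x)"
    and "n \<le> CARD('d)"
  shows "\<exists>f :: nat \<Rightarrow> real^'d. \<forall>i<n. \<forall>j<n. f i \<bullet> (H *v f j) = (if i = j then 1 else 0)"
  using assms(4)
proof (induction n)
  case (Suc n)
  then obtain f :: "nat \<Rightarrow> real^'d" where
    f: "\<And>i j. i < n \<Longrightarrow> j < n \<Longrightarrow> f i \<bullet> (H *v f j) = (if i = j then 1 else 0)"
    by auto
  have symH: "x \<bullet> (H *v y) = y \<bullet> (H *v x)" for x y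
    using dot_lmul_matrix[of x H y] sym transpose_matrix_vector[of H x] by (simp add: inner_commute)
  have "dim (span (f ` {..<n})) \<le> card (f ` {..<n})" unfolding dim_span by (rule dim_le_card') auto
  also have "\<dots> \<le> n" using card_image_le[of "{..<n}" f] by simp
  finally have "dim (span (f ` {..<n})) \<noteq> dim (UNIV :: (real^'d) set)"
    using Suc.prems by (simp add: dim_UNIV)
  then have "span (f ` {..<n}) \<noteq> UNIV" by metis
  then obtain z where z: "z \<notin> span (f ` {..<n})" by blast
  define w where "w = z - (\<Sum>i<n. (f i \<bullet> (H *v z)) *\<^sub>R f i)"
  have "(\<Sum>i<n. (f i \<bullet> (H *v z)) *\<^sub>R f i) \<in> span (f ` {..<n})"
    by (intro span_sum span_scale) (auto intro: span_base)
  then have "w \<noteq> 0" using z unfolding w_def by auto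
  then have "0 < c * (norm w)\<^sup>2" using c(1) by simp
  then have pos: "0 < w \<bullet> (H *v w)" using c(2)[of w] by linarith
  have orth: "f j \<bullet> (H *v w) = 0" if "j < n" for j
  proof -
    have "f j \<bullet> (H *v w) = f j \<bullet> (H *v z) - (\<Sum>i<n. (f i \<bullet> (H *v z)) * (f j \<bullet> (H *v f i)))"
      unfolding w_def
      by (simp add: matrix_vector_mult_diff_distrib inner_diff_right linear_sum[OF matrix_vector_mul_linear]
          inner_sum_right matrix_vector_mult_scaleR)
    also have "(\<Sum>i<n. (f i \<bullet> (H *v z)) * (f j \<bullet> (H *v f i))) = (\<Sum>i<n. if i = j then f i \<bullet> (H *v z) else 0)"
      using that by (intro sum.cong) (auto simp: f)
    also have "\<dots> = f j \<bullet> (H *v z)" using that by simp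
    finally show ?thesis by simp
  qed
  define u where "u = (1 / sqrt (w \<bullet> (H *v w))) *\<^sub>R w"
  have uu: "u \<bullet> (H *v u) = 1" using pos by (simp add: u_def matrix_vector_mult_scaleR)
  have fu: "f j \<bullet> (H *v u) = 0" if "j < n" for j
    using orth[OF that] by (simp add: u_def matrix_vector_mult_scaleR)
  have uf: "u \<bullet> (H *v f j) = 0" if "j < n" for j
    using fu[OF that] symH[of u "f j"] by simp
  have "(f(n := u)) i \<bullet> (H *v (f(n := u)) j) = (if i = j then 1 else 0)" if "i < Suc n" "j < Suc n" for i j
    using that uu fu[of i] uf[of j] f[of i j] by (cases "i = n"; cases "j = n") simp_all
  then show ?case by blast
qed simp

text \<open>The columns of \<open>R\<close> are an orthonormal basis for \<open>H\<close>, and \<open>Q\<close> is its inverse.\<close>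

lemma pos_definite_factorization:
  fixes H :: "real^'d^'d"
  assumes "transpose H = H" and "0 < c" "\<And>x. c * (norm x)\<^sup>2 \<le> x \<bullet> (H *v x)"
  obtains Q R :: "real^'d^'d" where "R ** Q = mat 1" "Q ** R = mat 1" "transpose Q ** Q = H"
proof -
  obtain f :: "nat \<Rightarrow> real^'d" where
    f: "\<And>i j. i < CARD('d) \<Longrightarrow> j < CARD('d) \<Longrightarrow> f i \<bullet> (H *v f j) = (if i = j then 1 else 0)"
    using pos_definite_orthonormal_sequence[OF assms, of "CARD('d)"] by auto
  obtain \<beta> :: "'d \<Rightarrow> nat" where \<beta>: "bij_betw \<beta> UNIV {0..<CARD('d)}"
    using ex_bij_betw_finite_nat[OF finite_class.finite_UNIV] by blast
  have \<beta>_less: "\<beta> j < CARD('d)" for j using \<beta> unfolding bij_betw_def by auto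
  have \<beta>_inj: "\<beta> i = \<beta> j \<longleftrightarrow> i = j" for i j using \<beta> unfolding bij_betw_def by (auto dest: injD)
  define R :: "real^'d^'d" where "R = (\<chi> k j. f (\<beta> j) $ k)"
  have R_axis: "R *v axis j 1 = f (\<beta> j)" for j
    by (simp add: R_def matrix_vector_mult_basis column_def vec_eq_iff)
  have "(transpose R ** H ** R) $ i $ j = mat 1 $ i $ j" for i j
  proof -
    have "(transpose R ** H ** R) $ i $ j = axis i 1 \<bullet> ((transpose R ** H ** R) *v axis j 1)"
      by (simp add: inner_axis' matrix_vector_mult_basis column_def)
    also have "\<dots> = f (\<beta> i) \<bullet> (H *v f (\<beta> j))"
      by (simp add: matrix_vector_mul_assoc[symmetric] R_axis)
         (metis R_axis dot_lmul_matrix inner_commute)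
    finally show ?thesis by (simp add: f \<beta>_less \<beta>_inj mat_def)
  qed
  then have 1: "transpose R ** H ** R = mat 1" by (simp add: vec_eq_iff)
  then have 2: "R ** (transpose R ** H) = mat 1"
    by (simp add: matrix_left_right_inverse)
  have "transpose (transpose R ** H) ** (transpose R ** H) = H"
    by (simp add: matrix_transpose_mul assms(1)) (metis 2 matrix_mul_assoc matrix_mul_rid)
  with 1 2 show ?thesis using that by blast
qed

lemma invariant_form_generator:
  fixes B :: "real^'d^'d"
  assumes "\<And>t. act (mexp (t *\<^sub>R B)) H = H"
  shows "transpose B ** H + H ** B = 0"
proof -
  let ?m = "\<lambda>t. mexp (t *\<^sub>R B)"
  have m: "(?m has_vector_derivative B) (at 0)"
    using has_vector_derivative_mexp[of B 0 UNIV] by (simp add: mexp_0)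
  have mT: "((\<lambda>t. transpose (?m t)) has_vector_derivative transpose B) (at 0)"
    by (rule bounded_linear.has_vector_derivative[OF bounded_linear_transpose m])
  have "((\<lambda>t. act (?m t) H) has_vector_derivative
      (transpose (?m 0) ** H) ** B + (transpose (?m 0) ** 0 + transpose B ** H) ** ?m 0) (at 0)"
    by (rule has_vector_derivative_matrix_mult[OF
          has_vector_derivative_matrix_mult[OF mT has_vector_derivative_const] m])
  then have "((\<lambda>t. H) has_vector_derivative H ** B + transpose B ** H) (at (0::real))"
    by (simp add: assms mexp_0)
  then show ?thesis
    using vector_derivative_unique_at[OF _ has_vector_derivative_const] by (metis add.commute)
qed

lemma matrix_inv_mult:
  fixes Q :: "real^'d^'d"
  assumes "invertible Q" shows "matrix_inv Q ** Q = mat 1"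
  using someI_ex[OF assms[unfolded invertible_def]] unfolding matrix_inv_def by (rule conjunct2)

lemma matrix_inv_eq:
  fixes Q R :: "real^'d^'d"
  assumes "R ** Q = mat 1" "Q ** R = mat 1"
  shows "invertible Q" "matrix_inv Q = R"
proof -
  show "invertible Q" unfolding invertible_def using assms by blast
  then have "matrix_inv Q ** Q = mat 1" by (rule matrix_inv_mult)
  then show "matrix_inv Q = R" using assms(2) by (metis matrix_mul_assoc matrix_mul_lid matrix_mul_rid)
qed

definition skew_in_common_basis :: "('n \<Rightarrow> real^'d^'d) \<Rightarrow> bool" where
  "skew_in_common_basis B \<longleftrightarrow> (\<exists>Q :: real^'d^'d. invertible Q \<and> (\<forall>i. skew_symmetric (Q ** B i ** matrix_inv Q)))"

text \<open>In the coordinates given by a factorization \<open>H = transpose Q ** Q\<close> of an invariant form, the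
  infinitesimal invariance of \<open>H\<close> is skew-symmetry.\<close>

lemma norm_one_imp_skew:
  fixes B :: "'n \<Rightarrow> real^'d^'d" and e :: "real^'d \<Rightarrow> real"
  assumes "irreducible_family B" "is_norm e" "\<And>U. U \<in> flow_semigroup B \<Longrightarrow> opnorm e U = 1"
  shows "skew_in_common_basis B"
proof -
  obtain H :: "real^'d^'d" and c where H: "transpose H = H" "\<And>g. g \<in> flow_group B \<Longrightarrow> act g H = H" "0 < c"
    "\<And>x. c * (norm (mat 1 *v x))\<^sup>2 \<le> x \<bullet> (H *v x)"
    using bounded_group_invariant_form[OF flow_group.one flow_group_bounded[OF assms] flow_group_mult
        matrix_mul_rid flow_group_inverse] by blast
  obtain Q R :: "real^'d^'d" where QR: "R ** Q = mat 1" "Q ** R = mat 1" "transpose Q ** Q = H"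
    using pos_definite_factorization[OF H(1,3)] H(4) by (metis matrix_vector_mul_lid)
  have TR: "transpose R ** transpose Q = mat 1" using QR(2) by (metis matrix_transpose_mul transpose_mat)
  have "skew_symmetric (Q ** B i ** matrix_inv Q)" for i
  proof -
    have 0: "transpose (B i) ** H + H ** B i = 0"
      by (rule invariant_form_generator) (intro H(2) flow_group_mexp)
    have HR: "H ** R = transpose Q" using QR by (metis matrix_mul_assoc matrix_mul_rid)
    have RH: "transpose R ** H = Q" using QR(3) TR by (metis matrix_mul_assoc matrix_mul_lid)
    have "transpose (Q ** B i ** R) + Q ** B i ** R = transpose R ** (transpose (B i) ** H + H ** B i) ** R"
    proof -
      have "transpose R ** (transpose (B i) ** H) ** R = transpose (Q ** B i ** R)"
        by (simp add: matrix_transpose_mul HR[symmetric] matrix_mul_assoc)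
      moreover have "transpose R ** (H ** B i) ** R = Q ** B i ** R"
        by (simp add: RH matrix_mul_assoc)
      ultimately show ?thesis
        by (simp add: matrix_add_ldistrib bounded_bilinear.add_left[OF bounded_bilinear_matrix_mult])
    qed
    also have "\<dots> = 0" unfolding 0
      by (simp add: bounded_bilinear.zero_left[OF bounded_bilinear_matrix_mult]
          bounded_bilinear.zero_right[OF bounded_bilinear_matrix_mult])
    finally show ?thesis
      unfolding skew_symmetric_def matrix_inv_eq(2)[OF QR(1,2)] by (simp add: add_eq_0_iff2)
  qed
  then show ?thesis unfolding skew_in_common_basis_def using matrix_inv_eq(1)[OF QR(1,2)] by blast
qed

section \<open>Spectral radii\<close>

text \<open>The derivative of \<open>t \<mapsto> (norm (Q *v (mexp (t *\<^sub>R B i) *v y)))\<^sup>2\<close> is the value of a skew-symmetric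
  form on the diagonal.\<close>

lemma skew_imp_isometry:
  fixes B :: "'n \<Rightarrow> real^'d^'d" and Q :: "real^'d^'d"
  assumes Q: "invertible Q" and skew: "\<And>i. skew_symmetric (Q ** B i ** matrix_inv Q)"
    and U: "U \<in> flow_semigroup B"
  shows "norm (Q *v (U *v x)) = norm (Q *v x)"
  using U
proof (induction arbitrary: x)
  case (step U t i)
  define R where "R = matrix_inv Q"
  have RQ: "R ** Q = mat 1" unfolding R_def using Q by (rule matrix_inv_mult)
  have iso: "norm (Q *v (mexp (t *\<^sub>R B i) *v y)) = norm (Q *v y)" for y
  proof -
    let ?p = "\<lambda>s. Q *v (mexp (s *\<^sub>R B i) *v y)"
    have d: "(?p has_vector_derivative Q *v ((B i ** mexp (s *\<^sub>R B i)) *v y)) (at s)" for s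
      by (intro bounded_linear.has_vector_derivative[OF matrix_vector_mul_bounded_linear]
          bounded_linear.has_vector_derivative[OF bounded_bilinear.bounded_linear_left[OF
            bounded_bilinear_matrix_vector_mult]] has_vector_derivative_mexp)
    have 0: "?p s \<bullet> (Q *v ((B i ** mexp (s *\<^sub>R B i)) *v y)) = 0" for s
    proof -
      let ?S = "Q ** B i ** R"
      have "Q *v ((B i ** mexp (s *\<^sub>R B i)) *v y) = ?S *v ?p s"
        using RQ by (metis matrix_vector_mul_assoc matrix_mul_assoc matrix_mul_rid)
      moreover have "z \<bullet> (?S *v z) = 0" for z
      proof -
        have "z \<bullet> (?S *v z) = (transpose ?S *v z) \<bullet> z"
          by (simp add: dot_lmul_matrix)
        also have "\<dots> = - (z \<bullet> (?S *v z))"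
          using skew[of i] unfolding skew_symmetric_def R_def[symmetric]
          by (simp only:) (simp add: inner_commute bounded_bilinear.minus_left[OF bounded_bilinear_matrix_vector_mult])
        finally show ?thesis by simp
      qed
      ultimately show ?thesis by simp
    qed
    have "((\<lambda>s. ?p s \<bullet> ?p s) has_real_derivative 0) (at s)" for s
      using bounded_bilinear.has_vector_derivative[OF bounded_bilinear_inner d d, of s] 0[of s]
      unfolding has_real_derivative_iff_has_vector_derivative by (simp add: inner_commute)
    then have "?p t \<bullet> ?p t = ?p 0 \<bullet> ?p 0" by (intro DERIV_isconst_all) blast
    then show ?thesis by (simp add: norm_eq_sqrt_inner mexp_0)
  qed
  have "norm (Q *v ((mexp (t *\<^sub>R B i) ** U) *v x)) = norm (Q *v (mexp (t *\<^sub>R B i) *v (U *v x)))"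
    by (simp add: matrix_vector_mul_assoc)
  then show ?case using iso step.IH by simp
qed simp

lemma eigenvalue_real_parts:
  assumes "complex_matrix M *v x = z *s x"
  shows "M *v (\<chi> j. Re (w * x $ j)) = (\<chi> j. Re (w * z * x $ j))"
proof -
  have "(complex_matrix M *v (w *s x)) = (w * z) *s x"
    using assms by (simp add: vec.scale)
  then show ?thesis
    using complex_matrix_component(1)[of M "w *s x"] by (simp add: vec_eq_iff)
qed

text \<open>\<open>U\<close> acts on the real and imaginary parts of an eigenvector as multiplication by the eigenvalue
  \<open>z\<close>, so it multiplies the sum of the squared norms of their images under \<open>Q\<close> by \<open>(cmod z)\<^sup>2\<close>.\<close>

lemma isometry_spectral_radius:
  fixes Q U :: "real^'d^'d"
  assumes Q: "invertible Q" and iso: "\<And>x. norm (Q *v (U *v x)) = norm (Q *v x)"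
  shows "spectral_radius U = 1"
proof -
  have "cmod z = 1" if "z \<in> eigenvalues U" for z
  proof -
    have "\<exists>x. x \<noteq> 0 \<and> complex_matrix U *v x = z *s x"
      using that unfolding eigenvalues_def mem_Collect_eq .
    then obtain x where x: "x \<noteq> 0" "complex_matrix U *v x = z *s x" by (elim exE conjE)
    define a b where "a = Q *v (\<chi> j. Re (x $ j))" and "b = Q *v (\<chi> j. Im (x $ j))"
    have Ua: "U *v (\<chi> j. Re (x $ j)) = Re z *\<^sub>R (\<chi> j. Re (x $ j)) - Im z *\<^sub>R (\<chi> j. Im (x $ j))"
      using complex_matrix_component(1)[of U x] x(2) by (simp add: vec_eq_iff)
    have Ub: "U *v (\<chi> j. Im (x $ j)) = Im z *\<^sub>R (\<chi> j. Re (x $ j)) + Re z *\<^sub>R (\<chi> j. Im (x $ j))"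
      using complex_matrix_component(2)[of U x] x(2) by (simp add: vec_eq_iff add.commute)
    have "(norm (Re z *\<^sub>R a - Im z *\<^sub>R b))\<^sup>2 + (norm (Im z *\<^sub>R a + Re z *\<^sub>R b))\<^sup>2 = (norm a)\<^sup>2 + (norm b)\<^sup>2"
      using iso[of "\<chi> j. Re (x $ j)"] iso[of "\<chi> j. Im (x $ j)"] unfolding Ua Ub a_def b_def
      by (simp add: matrix_vector_mult_diff_distrib matrix_vector_right_distrib matrix_vector_mult_scaleR)
    moreover have "(norm (Re z *\<^sub>R a - Im z *\<^sub>R b))\<^sup>2 + (norm (Im z *\<^sub>R a + Re z *\<^sub>R b))\<^sup>2 =
        (cmod z)\<^sup>2 * ((norm a)\<^sup>2 + (norm b)\<^sup>2)"
      unfolding cmod_power2 power2_norm_eq_inner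
      by (simp add: inner_diff_left inner_diff_right inner_add_left inner_add_right inner_commute
          power2_eq_square algebra_simps)
    moreover have "(norm a)\<^sup>2 + (norm b)\<^sup>2 \<noteq> 0"
    proof
      assume "(norm a)\<^sup>2 + (norm b)\<^sup>2 = 0"
      then have "a = 0" "b = 0" by (simp_all add: sum_power2_eq_zero_iff)
      then have "(\<chi> j. Re (x $ j)) = 0" "(\<chi> j. Im (x $ j)) = 0"
        using Q unfolding a_def b_def invertible_left_inverse matrix_left_invertible_ker by blast+
      then have "x = 0" by (simp add: vec_eq_iff complex_eq_iff)
      then show False using x(1) by simp
    qed
    ultimately have "(cmod z)\<^sup>2 = 1" by (metis mult_cancel_right1)
    then show ?thesis by (simp add: power2_eq_1_iff) (use norm_ge_zero[of z] in linarith)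
  qed
  then have "cmod ` eigenvalues U = {1}" using eigenvalues_finite_nonempty(2)[of U] by auto
  then show ?thesis by (simp add: spectral_radius_def)
qed

text \<open>An eigenvector for an eigenvalue of modulus one would be contracted to zero by the powers of
  a matrix of norm below one.\<close>

lemma spectral_radius_one_imp_opnorm_ge:
  fixes e :: "real^'d \<Rightarrow> real"
  assumes e: "is_norm e" and U: "spectral_radius U = 1"
  shows "1 \<le> opnorm e U"
proof (rule ccontr)
  assume "\<not> 1 \<le> opnorm e U"
  then have lt: "opnorm e U < 1" by simp
  have "Max (cmod ` eigenvalues U) \<in> cmod ` eigenvalues U"
    using eigenvalues_finite_nonempty[of U] by (intro Max_in) auto
  then obtain z where z: "z \<in> eigenvalues U" "cmod z = 1"
    using U unfolding spectral_radius_def by auto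
  have "\<exists>x. x \<noteq> 0 \<and> complex_matrix U *v x = z *s x"
    using z(1) unfolding eigenvalues_def mem_Collect_eq .
  then obtain x where x: "x \<noteq> 0" "complex_matrix U *v x = z *s x" by (elim exE conjE)
  obtain c where c: "0 < c" "\<And>y. c * norm y \<le> e y" using is_norm_ge_norm[OF e] by blast
  have decay: "e (\<chi> j. Re (w * z ^ n * x $ j)) \<le> opnorm e U ^ n * e (\<chi> j. Re (w * x $ j))" for w n
  proof (induction n)
    case (Suc n)
    have "e (\<chi> j. Re (w * z ^ Suc n * x $ j)) = e (U *v (\<chi> j. Re (w * z ^ n * x $ j)))"
      using eigenvalue_real_parts[OF x(2), of "w * z ^ n"] by (simp add: mult_ac)
    also have "\<dots> \<le> opnorm e U * e (\<chi> j. Re (w * z ^ n * x $ j))" by (rule opnorm_bound[OF e])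
    also have "\<dots> \<le> opnorm e U * (opnorm e U ^ n * e (\<chi> j. Re (w * x $ j)))"
      by (intro mult_left_mono Suc opnorm_nonneg e)
    finally show ?case by simp
  qed simp
  have "x $ j = 0" for j
  proof -
    have comp: "\<bar>Re (w * z ^ n * x $ j)\<bar> \<le> opnorm e U ^ n * e (\<chi> j. Re (w * x $ j)) / c" for w n
    proof -
      have "\<bar>Re (w * z ^ n * x $ j)\<bar> \<le> norm (\<chi> j. Re (w * z ^ n * x $ j))"
        using component_le_norm_cart[of "\<chi> j. Re (w * z ^ n * x $ j)" j] by simp
      also have "\<dots> \<le> e (\<chi> j. Re (w * z ^ n * x $ j)) / c"
        using c(2)[of "\<chi> j. Re (w * z ^ n * x $ j)"] c(1) by (simp add: le_divide_eq mult.commute)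
      also have "\<dots> \<le> opnorm e U ^ n * e (\<chi> j. Re (w * x $ j)) / c"
        using decay c(1) by (intro divide_right_mono) auto
      finally show ?thesis .
    qed
    have "cmod (x $ j) \<le> opnorm e U ^ n * (e (\<chi> j. Re (1 * x $ j)) / c + e (\<chi> j. Re (- \<i> * x $ j)) / c)" for n
    proof -
      have "cmod (x $ j) = cmod (z ^ n * x $ j)" by (simp add: norm_mult norm_power z(2))
      also have "\<dots> \<le> \<bar>Re (z ^ n * x $ j)\<bar> + \<bar>Im (z ^ n * x $ j)\<bar>" by (rule cmod_le)
      also have "Im (z ^ n * x $ j) = Re (- \<i> * z ^ n * x $ j)" by (simp add: mult.assoc)
      finally show ?thesis using comp[of 1 n] comp[of "- \<i>" n] by (simp add: algebra_simps)
    qed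
    moreover have "(\<lambda>n. opnorm e U ^ n * (e (\<chi> j. Re (1 * x $ j)) / c + e (\<chi> j. Re (- \<i> * x $ j)) / c)) \<longlonglongrightarrow> 0"
      using lt opnorm_nonneg[OF e, of U] by (intro tendsto_mult_left_zero LIMSEQ_power_zero) auto
    ultimately have "cmod (x $ j) \<le> 0" by (intro LIMSEQ_le_const) auto
    then show ?thesis by simp
  qed
  then show False using x(1) by (simp add: vec_eq_iff)
qed

lemma spectral_radius_scaleR:
  fixes M :: "real^'d^'d"
  assumes r: "0 < r" shows "spectral_radius (r *\<^sub>R M) = r * spectral_radius M"
proof -
  have sub: "(\<lambda>z. of_real r * z) ` eigenvalues M \<subseteq> eigenvalues (r *\<^sub>R M)" for r :: real and M :: "real^'d^'d"
  proof -
    have "complex_matrix (r *\<^sub>R M) *v x = of_real r *s (complex_matrix M *v x)" for x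
      by (simp add: vec_eq_iff matrix_vector_mult_def sum_distrib_left mult.assoc)
    then show ?thesis unfolding eigenvalues_def by (auto simp: vector_smult_assoc)
  qed
  have "eigenvalues (r *\<^sub>R M) = (\<lambda>z. of_real r * z) ` eigenvalues M"
  proof
    show "eigenvalues (r *\<^sub>R M) \<subseteq> (\<lambda>z. of_real r * z) ` eigenvalues M"
    proof
      fix z assume "z \<in> eigenvalues (r *\<^sub>R M)"
      then have "of_real (1 / r) * z \<in> eigenvalues M" using sub[of "1 / r" "r *\<^sub>R M"] r by auto
      then show "z \<in> (\<lambda>z. of_real r * z) ` eigenvalues M"
        by (intro image_eqI[of _ _ "of_real (1 / r) * z"]) (use r in auto)
    qed
  qed (rule sub)
  then have "cmod ` eigenvalues (r *\<^sub>R M) = (\<lambda>t. r * t) ` cmod ` eigenvalues M"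
    using r by (auto simp: image_image norm_mult)
  then show ?thesis
    using mono_Max_commute[of "\<lambda>t. r * t" "cmod ` eigenvalues M"] eigenvalues_finite_nonempty[of M] r
    by (simp add: spectral_radius_def mono_def)
qed

section \<open>Products of exponentials and flows of switching signals\<close>

primrec wprod :: "('n \<Rightarrow> real^'d^'d) \<Rightarrow> (nat \<Rightarrow> 'n) \<Rightarrow> (nat \<Rightarrow> real) \<Rightarrow> nat \<Rightarrow> real^'d^'d" where
  "wprod A z r 0 = mat 1"
| "wprod A z r (Suc n) = mexp (r n *\<^sub>R A (z n)) ** wprod A z r n"

lemma switched_prod_wprod: "switched_prod A i t k = wprod A (\<lambda>k. i (Suc k)) (\<lambda>k. t (Suc k)) k"
  by (induction k) simp_all

lemma wprod_cong:
  assumes "\<And>k. k < n \<Longrightarrow> z k = z' k" "\<And>k. k < n \<Longrightarrow> r k = r' k"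
  shows "wprod A z r n = wprod A z' r' n"
  using assms by (induction n) auto

lemma wprod_in_semigroup: "(\<And>k. k < n \<Longrightarrow> 0 \<le> r k) \<Longrightarrow> wprod B z r n \<in> flow_semigroup B"
  by (induction n) (auto intro: flow_semigroup.intros)

lemma semigroup_is_wprod:
  assumes "U \<in> flow_semigroup B"
  shows "\<exists>z r n. (\<forall>k. 0 \<le> r k) \<and> 1 \<le> n \<and> U = wprod B z r n"
  using assms
proof induction
  case one
  show ?case by (intro exI[of _ undefined] exI[of _ "\<lambda>_. 0"] exI[of _ 1]) (simp add: mexp_0)
next
  case (step U t i)
  then obtain z r n where zrn: "\<forall>k. 0 \<le> r k" "1 \<le> n" "U = wprod B z r n" by blast
  have "wprod B z r n = wprod B (z(n := i)) (r(n := t)) n" by (rule wprod_cong) auto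
  then have eq: "mexp (t *\<^sub>R B i) ** U = wprod B (z(n := i)) (r(n := t)) (Suc n)"
    by (simp only: zrn(3) wprod.simps fun_upd_same)
  have nonneg: "\<forall>k. 0 \<le> (r(n := t)) k" using zrn(1) step(2) by simp
  have "1 \<le> Suc n" by simp
  with nonneg eq show ?case by blast
qed

lemma wprod_shift:
  assumes "\<And>k. k < n \<Longrightarrow> 0 \<le> r k"
  shows "wprod A z r n = exp (l * (\<Sum>k<n. r k)) *\<^sub>R wprod (\<lambda>i. A i - l *\<^sub>R mat 1) z r n"
  using assms
proof (induction n)
  case (Suc n)
  have "mexp (r n *\<^sub>R A (z n)) = exp (l * r n) *\<^sub>R mexp (r n *\<^sub>R (A (z n) - l *\<^sub>R mat 1))"
    by (rule mexp_shift) (simp add: Suc.prems)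
  moreover have "wprod A z r n = exp (l * (\<Sum>k<n. r k)) *\<^sub>R wprod (\<lambda>i. A i - l *\<^sub>R mat 1) z r n"
    using Suc by simp
  ultimately show ?case
    by (simp add: matrix_scaleR_left matrix_scaleR_right distrib_left exp_add mult.commute)
qed simp

lemma wprod_add:
  "wprod B z r (a + b) = wprod B (\<lambda>k. z (a + k)) (\<lambda>k. r (a + k)) b ** wprod B z r a"
  by (induction b) (simp_all add: matrix_mul_assoc)

lemma tendsto_mexp:
  "((f :: _ \<Rightarrow> real) \<longlongrightarrow> t) F \<Longrightarrow> ((\<lambda>x. mexp (f x *\<^sub>R M)) \<longlongrightarrow> mexp (t *\<^sub>R M)) F"
  by (rule continuous_on_tendsto_compose[OF continuous_on_mexp[of UNIV]]) auto

lemma tendsto_wprod: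
  assumes "\<And>k. k < n \<Longrightarrow> ((\<lambda>x. r x k) \<longlongrightarrow> s k) F"
  shows "((\<lambda>x. wprod B z (r x) n) \<longlongrightarrow> wprod B z s n) F"
  using assms by (induction n) (auto intro!: tendsto_matrix_mult tendsto_mexp)

text \<open>The time spent before \<open>t\<close> in the \<open>k\<close>-th mode when the holding times are \<open>\<tau>\<close>. It vanishes
  for the modes that are entered after time \<open>t\<close>, so the flow at time \<open>t\<close> is one and the same product
  for every sufficiently large number of factors; for a random signal this avoids a case distinction
  on the number of jumps.\<close>

definition elapsed :: "(nat \<Rightarrow> real) \<Rightarrow> real \<Rightarrow> nat \<Rightarrow> real" where
  "elapsed \<tau> t k = max 0 (min (t - (\<Sum>j<k. \<tau> j)) (\<tau> k))"

lemma elapsed_nonneg: "0 \<le> elapsed \<tau> t k"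
  by (simp add: elapsed_def)

lemma sum_elapsed:
  assumes "\<And>k. 0 \<le> \<tau> k" "0 \<le> t"
  shows "(\<Sum>k<n. elapsed \<tau> t k) = min t (\<Sum>k<n. \<tau> k)"
proof (induction n)
  case (Suc n)
  then show ?case using assms(1)[of n] assms(2) by (auto simp: elapsed_def min_def max_def)
qed (use assms in simp)

lemma partial_sum_mono:
  fixes \<tau> :: "nat \<Rightarrow> real"
  assumes "\<And>k. 0 < \<tau> k" "m \<le> n" shows "(\<Sum>k<m. \<tau> k) \<le> (\<Sum>k<n. \<tau> k)"
  using assms by (intro sum_mono2) (auto intro: less_imp_le)

lemma elapsed_eq:
  assumes "\<And>k. 0 < \<tau> k" "(\<Sum>j<Suc k. \<tau> j) \<le> t" shows "elapsed \<tau> t k = \<tau> k"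
  using assms(2) less_imp_le[OF assms(1)[of k]] by (simp add: elapsed_def)

lemma wprod_elapsed_complete:
  assumes "\<And>k. 0 < \<tau> k" "(\<Sum>j<n. \<tau> j) \<le> t"
  shows "wprod A z (elapsed \<tau> t) n = wprod A z \<tau> n"
proof (rule wprod_cong)
  fix k assume "k < n"
  then have "(\<Sum>j<Suc k. \<tau> j) \<le> (\<Sum>j<n. \<tau> j)" by (intro partial_sum_mono assms) auto
  then show "elapsed \<tau> t k = \<tau> k" by (intro elapsed_eq assms) (use assms(2) in linarith)
qed simp

lemma wprod_elapsed_stable:
  assumes "\<And>k. 0 < \<tau> k" "t \<le> (\<Sum>j<n. \<tau> j)" "n \<le> m"
  shows "wprod A z (elapsed \<tau> t) m = wprod A z (elapsed \<tau> t) n"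
  using assms(3)
proof (induction m rule: dec_induct)
  case (step m)
  have "(\<Sum>j<n. \<tau> j) \<le> (\<Sum>j<m. \<tau> j)" by (intro partial_sum_mono assms(1) step)
  then have "elapsed \<tau> t m = 0" using assms(2) by (simp add: elapsed_def)
  then show ?case using step by (simp add: mexp_0)
qed simp

lemma wprod_elapsed_interval:
  assumes "\<And>k. 0 < \<tau> k" "(\<Sum>j<n. \<tau> j) \<le> t" "t \<le> (\<Sum>j<Suc n. \<tau> j)"
  shows "wprod A z (elapsed \<tau> t) (Suc n) = mexp ((t - (\<Sum>j<n. \<tau> j)) *\<^sub>R A (z n)) ** wprod A z \<tau> n"
  using assms by (simp add: wprod_elapsed_complete) (simp add: elapsed_def)

lemma interval_exists:
  fixes \<tau> :: "nat \<Rightarrow> real"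
  assumes "filterlim (\<lambda>n. \<Sum>k<n. \<tau> k) at_top sequentially" "0 \<le> t"
  obtains n where "(\<Sum>k<n. \<tau> k) \<le> t" "t < (\<Sum>k<Suc n. \<tau> k)"
proof -
  have "\<exists>n. t < (\<Sum>k<n. \<tau> k)"
    using assms(1) by (auto simp: filterlim_at_top_dense eventually_sequentially)
  then have 1: "t < (\<Sum>k<(LEAST n. t < (\<Sum>k<n. \<tau> k)). \<tau> k)" by (rule LeastI_ex)
  obtain n where n: "(LEAST n. t < (\<Sum>k<n. \<tau> k)) = Suc n"
    using 1 assms(2) by (cases "LEAST n. t < (\<Sum>k<n. \<tau> k)") auto
  have "\<not> t < (\<Sum>k<n. \<tau> k)" by (rule not_less_Least) (simp add: n)
  then show ?thesis using that[of n] 1 n by (simp add: not_less)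
qed

text \<open>On the interval spent in the \<open>n\<close>-th mode the flow is determined by the differential equation
  with constant coefficient. For existence, a point that is not a jump time may still be one of the
  instants \<open>\<Sum>k<n. \<tau> k\<close>, when two consecutive modes agree; there the exponentials on both sides
  combine into one.\<close>

lemma flow_is_wprod:
  fixes A :: "'n \<Rightarrow> real^'d^'d"
  assumes pos: "\<And>k. 0 < \<tau> k" and lim: "filterlim (\<lambda>n. \<Sum>k<n. \<tau> k) at_top sequentially"
    and sig: "\<And>n t. (\<Sum>k<n. \<tau> k) \<le> t \<Longrightarrow> t < (\<Sum>k<Suc n. \<tau> k) \<Longrightarrow> \<sigma> t = z n"
    and t: "0 \<le> t" "t \<le> (\<Sum>k<n. \<tau> k)"
  shows "flow A \<sigma> t = wprod A z (elapsed \<tau> t) n"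
proof -
  define S where "S n = (\<Sum>k<n. \<tau> k)" for n
  have S0: "S 0 = 0" and SS: "S (Suc n) = S n + \<tau> n" for n by (simp_all add: S_def)
  have Sge: "0 \<le> S n" for n unfolding S_def by (intro sum_nonneg less_imp_le pos)
  have sig': "\<sigma> t = z n" if "S n \<le> t" "t < S (Suc n)" for n t using sig that unfolding S_def .
  define \<Psi> where "\<Psi> t = wprod A z (elapsed \<tau> t) (LEAST n. t \<le> S n)" for t
  have \<Psi>: "\<Psi> t = wprod A z (elapsed \<tau> t) n" if "t \<le> S n" for t n
    unfolding \<Psi>_def
    by (rule wprod_elapsed_stable[OF pos, symmetric])
       (use that in \<open>auto simp: S_def[symmetric] intro: LeastI Least_le\<close>)
  have large: "\<exists>n. t < S n" for t
    using lim unfolding S_def[symmetric] by (auto simp: filterlim_at_top_dense eventually_sequentially)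
  have \<Psi>_int: "\<Psi> s = mexp ((s - S n) *\<^sub>R A (z n)) ** wprod A z \<tau> n" if "S n \<le> s" "s \<le> S (Suc n)" for s n
    using \<Psi>[OF that(2)] wprod_elapsed_interval[where \<tau> = \<tau> and n = n and t = s and A = A and z = z, OF pos] that unfolding S_def by simp
  have flow: "is_flow A \<sigma> \<Psi>"
    unfolding is_flow_def
  proof (intro conjI allI impI)
    show "\<Psi> 0 = mat 1" using \<Psi>[of 0 0] by (simp add: S0)
    have "isCont \<Psi> t" for t
    proof -
      obtain n where n: "t < S n" using large by blast
      have "((\<lambda>s. wprod A z (elapsed \<tau> s) n) \<longlongrightarrow> wprod A z (elapsed \<tau> t) n) (at t)"
        unfolding elapsed_def by (intro tendsto_wprod tendsto_intros)
      moreover have "\<forall>\<^sub>F s in at t. wprod A z (elapsed \<tau> s) n = \<Psi> s"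
      proof (rule eventually_mono)
        show "\<forall>\<^sub>F s in at t. s \<in> {..<S n}" using n by (intro eventually_at_in_open') auto
        show "wprod A z (elapsed \<tau> s) n = \<Psi> s" if "s \<in> {..<S n}" for s
          using \<Psi>[of s n] that by simp
      qed
      ultimately have "(\<Psi> \<longlongrightarrow> wprod A z (elapsed \<tau> t) n) (at t)" by (rule Lim_transform_eventually)
      then show ?thesis using \<Psi>[of t n] n by (simp add: isCont_def)
    qed
    then show "continuous_on {0..} \<Psi>" by (simp add: continuous_at_imp_continuous_on)
    fix t :: real assume t: "0 < t" "t \<notin> jump_times \<sigma>"
    then have ev: "\<forall>\<^sub>F s in at t. \<sigma> s = \<sigma> t" unfolding jump_times_def by blast
    obtain n where n: "S n \<le> t" "t < S (Suc n)"
      using interval_exists[OF lim less_imp_le[OF t(1)]] unfolding S_def by blast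
    have "\<exists>a b c C. a < t \<and> t < b \<and> (\<forall>s. a < s \<longrightarrow> s < b \<longrightarrow> \<Psi> s = mexp ((s - c) *\<^sub>R A (\<sigma> t)) ** C)"
    proof (cases "S n < t")
      case True
      then show ?thesis using n \<Psi>_int[of n] sig'[OF n]
        by (intro exI[of _ "S n"] exI[of _ "S (Suc n)"] exI[of _ "wprod A z \<tau> n"]) auto
    next
      case False
      then have tS: "t = S n" using n by simp
      then obtain m where m: "n = Suc m" using t(1) S0 by (cases n) auto
      have "\<forall>\<^sub>F s in at_left t. \<sigma> s = \<sigma> t" using ev by (simp add: eventually_at_split)
      moreover have "\<forall>\<^sub>F s in at_left t. S m < s \<and> s < t"
        using eventually_at_left_real[of "S m" t] tS m pos[of m] by (simp add: SS)
      ultimately have "\<forall>\<^sub>F s in at_left t. \<sigma> t = z m"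
        by eventually_elim (use sig'[of m] tS m in force)
      then have zm: "\<sigma> t = z m" by simp
      have "\<Psi> s = mexp ((s - S m) *\<^sub>R A (\<sigma> t)) ** wprod A z \<tau> m" if "S m < s" "s < S (Suc n)" for s
      proof (cases "s \<le> S n")
        case True
        then show ?thesis using \<Psi>_int[of m s] that m zm by simp
      next
        case False
        then have "\<Psi> s = mexp ((s - S n) *\<^sub>R A (\<sigma> t)) ** (mexp (\<tau> m *\<^sub>R A (\<sigma> t)) ** wprod A z \<tau> m)"
          using \<Psi>_int[of n s] that sig'[OF n] zm m by simp
        also have "\<dots> = mexp ((s - S n + \<tau> m) *\<^sub>R A (\<sigma> t)) ** wprod A z \<tau> m"
          using False by (simp add: mexp_add matrix_mul_assoc)
        finally show ?thesis by (simp add: m SS)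
      qed
      then show ?thesis using tS m n pos[of m]
        by (intro exI[of _ "S m"] exI[of _ "S (Suc n)"] exI[of _ "S m"] exI[of _ "wprod A z \<tau> m"]) (auto simp: SS)
    qed
    then obtain a b c C where ab: "a < t" "t < b"
      and eq: "\<And>s. a < s \<Longrightarrow> s < b \<Longrightarrow> \<Psi> s = mexp ((s - c) *\<^sub>R A (\<sigma> t)) ** C" by blast
    have "((\<lambda>s. s - c) has_vector_derivative 1) (at t)" by (auto intro!: derivative_eq_intros)
    from vector_diff_chain_at[OF this has_vector_derivative_mexp[of "A (\<sigma> t)"]]
    have "((\<lambda>s. mexp ((s - c) *\<^sub>R A (\<sigma> t))) has_vector_derivative A (\<sigma> t) ** mexp ((t - c) *\<^sub>R A (\<sigma> t))) (at t)"
      by (simp add: o_def)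
    from has_vector_derivative_matrix_mult[OF this has_vector_derivative_const[of C]]
    have "((\<lambda>s. mexp ((s - c) *\<^sub>R A (\<sigma> t)) ** C) has_vector_derivative A (\<sigma> t) ** \<Psi> t) (at t)"
      using eq[OF ab]
      by (simp add: matrix_mul_assoc bounded_bilinear.zero_right[OF bounded_bilinear_matrix_mult])
    then show "(\<Psi> has_vector_derivative A (\<sigma> t) ** \<Psi> t) (at t)"
      by (rule has_vector_derivative_transform_within_open[of _ _ _ "{a<..<b}"]) (use ab eq in auto)
  qed
  then have isf: "is_flow A \<sigma> (flow A \<sigma>)" unfolding flow_def by (rule someI[of "is_flow A \<sigma>"])
  have seg: "flow A \<sigma> t = mexp ((t - S n) *\<^sub>R A (z n)) ** flow A \<sigma> (S n)" if "S n \<le> t" "t \<le> S (Suc n)" for n t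
  proof (rule linear_ode_unique[OF that(1)])
    show "continuous_on {S n..t} (flow A \<sigma>)"
      using isf Sge[of n] unfolding is_flow_def by (auto elim: continuous_on_subset)
    fix s assume s: "S n < s" "s < t"
    then have "s \<in> {S n<..<S (Suc n)}" using that by auto
    then have "\<forall>\<^sub>F u in at s. u \<in> {S n<..<S (Suc n)}" by (intro eventually_at_in_open') auto
    then have "\<forall>\<^sub>F u in at s. \<sigma> u = \<sigma> s"
      by eventually_elim (use sig'[of n] s that in auto)
    then have "s \<notin> jump_times \<sigma>" unfolding jump_times_def by blast
    moreover have "0 < s" using s(1) Sge[of n] by simp
    ultimately have "(flow A \<sigma> has_vector_derivative A (\<sigma> s) ** flow A \<sigma> s) (at s)"
      using isf unfolding is_flow_def by blast
    moreover have "\<sigma> s = z n" using sig'[of n s] s that by simp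
    ultimately show "(flow A \<sigma> has_vector_derivative A (z n) ** flow A \<sigma> s) (at s)" by simp
  qed
  have nodes: "flow A \<sigma> (S n) = wprod A z \<tau> n" for n
  proof (induction n)
    case 0
    show ?case using isf by (simp add: is_flow_def S0)
  next
    case (Suc n)
    then show ?case using seg[of n "S (Suc n)"] pos[of n] by (simp add: SS)
  qed
  obtain k where k: "S k \<le> t" "t < S (Suc k)"
    using interval_exists[OF lim t(1)] unfolding S_def by blast
  have "flow A \<sigma> t = \<Psi> t"
    using seg[of k t] \<Psi>_int[of k t] k by (simp add: nodes)
  then show ?thesis using \<Psi>[of t n] t(2) by (simp add: S_def)
qed

lemma flow_constant_signal:
  fixes A :: "'n \<Rightarrow> real^'d^'d"
  assumes "0 \<le> t" shows "flow A (\<lambda>_. i) t = mexp (t *\<^sub>R A i)"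
proof -
  have "flow A (\<lambda>_. i) t = wprod A (\<lambda>_. i) (elapsed (\<lambda>_. t + 1) t) 1"
  proof (rule flow_is_wprod)
    show "filterlim (\<lambda>n. \<Sum>k<n. t + 1) at_top sequentially"
      using assms
      by (simp, intro filterlim_at_top_mult_tendsto_pos[OF tendsto_const] filterlim_real_sequentially) auto
  qed (use assms in auto)
  then show ?thesis using assms by (simp add: elapsed_def)
qed

lemma constant_switching_signal: "(\<lambda>_. i) \<in> switching_signals"
  by (simp add: switching_signals_def jump_times_def)

section \<open>Patterns in the random switching signal\<close>

text \<open>The embedded chain \<open>Z\<close> and the holding times \<open>\<tau>\<close> that realise a Markov process, as a fixed
  context for the estimates.\<close>

locale jump_chain = prob_space M for M :: "'a measure" +
  fixes Z :: "nat \<Rightarrow> 'a \<Rightarrow> 'n::finite" and \<tau> :: "nat \<Rightarrow> 'a \<Rightarrow> real"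
    and P :: "real^'n^'n" and \<nu> :: "real^'n" and \<mu> :: real
  assumes Z_meas: "\<And>n. Z n \<in> M \<rightarrow>\<^sub>M count_space UNIV"
    and Z_law: "\<And>n z. measure M {\<omega>\<in>space M. \<forall>k\<le>n. Z k \<omega> = z k} =
           \<nu> $ z 0 * (\<Prod>k<n. P $ z k $ z (Suc k))"
    and tau_law: "\<And>n. distributed M lborel (\<tau> n) (exponential_density \<mu>)"
    and tau_indep: "indep_vars (\<lambda>_. borel) \<tau> UNIV"
    and Z_tau_indep: "indep_set
          (sets (vimage_algebra (space M) (\<lambda>\<omega> n. Z n \<omega>) (PiM UNIV (\<lambda>_. count_space UNIV))))
          (sets (vimage_algebra (space M) (\<lambda>\<omega> n. \<tau> n \<omega>) (PiM UNIV (\<lambda>_. borel))))"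
    and tau_pos: "\<And>\<omega> n. \<omega> \<in> space M \<Longrightarrow> 0 < \<tau> n \<omega>"
    and tau_lim: "\<And>\<omega>. \<omega> \<in> space M \<Longrightarrow> filterlim (\<lambda>n. \<Sum>k<n. \<tau> k \<omega>) at_top sequentially"
    and mu_pos: "0 < \<mu>"
begin

lemma tau_meas [measurable]: "\<tau> n \<in> borel_measurable M"
  using distributed_measurable[OF tau_law[of n]] by simp

lemma Z_event [measurable]: "{\<omega>\<in>space M. Z n \<omega> = i} \<in> sets M"
  using measurable_sets[OF Z_meas[of n], of "{i}"] by (simp add: vimage_def Int_def conj_commute)

lemma Z_path_event: "{\<omega>\<in>space M. \<forall>j\<le>l. Z (a + j) \<omega> = y j} \<in> sets M"
proof -
  have "{\<omega>\<in>space M. \<forall>j\<in>{..l}. Z (a + j) \<omega> = y j} \<in> sets M"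
    by (intro sets.sets_Collect_finite_All Z_event) auto
  then show ?thesis by (simp add: Ball_def)
qed

lemma tau_box_event: "{\<omega>\<in>space M. \<forall>j\<le>l. s j < \<tau> (a + j) \<omega> \<and> \<tau> (a + j) \<omega> \<le> s j + \<eta>} \<in> sets M"
proof -
  have "{\<omega>\<in>space M. \<forall>j\<in>{..l}. s j < \<tau> (a + j) \<omega> \<and> \<tau> (a + j) \<omega> \<le> s j + \<eta>} \<in> sets M"
    by (intro sets.sets_Collect_finite_All) auto
  then show ?thesis by (simp add: Ball_def)
qed

text \<open>The Markov property at a deterministic index, obtained by summing the law of the chain over
  all histories.\<close>

lemma prob_Z_path:
  "prob {\<omega>\<in>space M. \<forall>j\<le>l. Z (a + j) \<omega> = y j} =
    prob {\<omega>\<in>space M. Z a \<omega> = y 0} * (\<Prod>j<l. P $ y j $ y (Suc j))"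
proof -
  define H where "H = PiE {..<a} (\<lambda>_. UNIV :: 'n set)"
  define g where "g h k = (if k < a then h k else y (k - a))" for h :: "nat \<Rightarrow> 'n" and k
  have fin: "finite H" unfolding H_def by (intro finite_PiE) auto
  define D where "D l h = {\<omega>\<in>space M. \<forall>k\<le>a + l. Z k \<omega> = g h k}" for l h
  have prod: "(\<Prod>k<a + l. P $ g h k $ g h (Suc k)) =
      (\<Prod>k<a. P $ g h k $ g h (Suc k)) * (\<Prod>j<l. P $ y j $ y (Suc j))" for h l
    by (induction l) (simp_all add: g_def)
  have main: "prob {\<omega>\<in>space M. \<forall>j\<le>l. Z (a + j) \<omega> = y j} =
      (\<Sum>h\<in>H. \<nu> $ g h 0 * (\<Prod>k<a. P $ g h k $ g h (Suc k))) * (\<Prod>j<l. P $ y j $ y (Suc j))" for l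
  proof -
    have "{\<omega>\<in>space M. \<forall>j\<le>l. Z (a + j) \<omega> = y j} = (\<Union>h\<in>H. D l h)"
    proof
      show "{\<omega>\<in>space M. \<forall>j\<le>l. Z (a + j) \<omega> = y j} \<subseteq> (\<Union>h\<in>H. D l h)"
      proof
        fix \<omega> assume \<omega>: "\<omega> \<in> {\<omega>\<in>space M. \<forall>j\<le>l. Z (a + j) \<omega> = y j}"
        define h where "h = restrict (\<lambda>k. Z k \<omega>) {..<a}"
        have "Z k \<omega> = g h k" if k: "k \<le> a + l" for k
        proof (cases "k < a")
          case False
          then have "Z (a + (k - a)) \<omega> = y (k - a)" using \<omega> k by (intro \<omega>[simplified, THEN conjunct2, rule_format]) auto
          then show ?thesis using False by (simp add: g_def)
        qed (simp add: g_def h_def)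
        moreover have "h \<in> H" by (simp add: h_def H_def)
        ultimately show "\<omega> \<in> (\<Union>h\<in>H. D l h)" using \<omega> unfolding D_def by blast
      qed
      show "(\<Union>h\<in>H. D l h) \<subseteq> {\<omega>\<in>space M. \<forall>j\<le>l. Z (a + j) \<omega> = y j}"
        by (auto simp: D_def g_def)
    qed
    moreover have "prob (\<Union>h\<in>H. D l h) = (\<Sum>h\<in>H. prob (D l h))"
    proof (rule finite_measure_finite_Union[OF fin])
      show "D l ` H \<subseteq> events" using Z_path_event[of "a + l" 0] by (auto simp: D_def)
      have "h = h'" if "h \<in> H" "h' \<in> H" "\<omega> \<in> D l h" "\<omega> \<in> D l h'" for h h' \<omega>
        using that(1,2) unfolding H_def
      proof (rule PiE_ext)
        fix k assume "k \<in> {..<a}"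
        then have "Z k \<omega> = g h k" "Z k \<omega> = g h' k" using that(3,4) unfolding D_def by auto
        then show "h k = h' k" using \<open>k \<in> {..<a}\<close> by (simp add: g_def)
      qed
      then show "disjoint_family_on (D l) H" unfolding disjoint_family_on_def by blast
    qed
    moreover have "prob (D l h) = \<nu> $ g h 0 * (\<Prod>k<a + l. P $ g h k $ g h (Suc k))" for h
      unfolding D_def by (rule Z_law)
    ultimately show ?thesis by (simp add: prod sum_distrib_right mult.assoc)
  qed
  show ?thesis using main[of l] main[of 0] by simp
qed

lemma sum_prob_Z: "(\<Sum>i\<in>UNIV. prob {\<omega>\<in>space M. Z a \<omega> = i}) = 1"
proof -
  have "prob (\<Union>i\<in>UNIV. {\<omega>\<in>space M. Z a \<omega> = i}) = (\<Sum>i\<in>UNIV. prob {\<omega>\<in>space M. Z a \<omega> = i})"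
    by (rule finite_measure_finite_Union) (auto simp: disjoint_family_on_def)
  moreover have "(\<Union>i\<in>UNIV. {\<omega>\<in>space M. Z a \<omega> = i}) = space M" by auto
  ultimately show ?thesis by (simp add: prob_space)
qed

lemma prob_tau_interval:
  assumes "0 \<le> s" "0 \<le> \<eta>"
  shows "prob {\<omega>\<in>space M. s < \<tau> n \<omega> \<and> \<tau> n \<omega> \<le> s + \<eta>} = exp (- s * \<mu>) - exp (- (s + \<eta>) * \<mu>)"
proof -
  have "{\<omega>\<in>space M. s < \<tau> n \<omega> \<and> \<tau> n \<omega> \<le> s + \<eta>} =
      {\<omega>\<in>space M. \<tau> n \<omega> \<le> s + \<eta>} - {\<omega>\<in>space M. \<tau> n \<omega> \<le> s}" by auto
  moreover have "prob \<dots> = prob {\<omega>\<in>space M. \<tau> n \<omega> \<le> s + \<eta>} - prob {\<omega>\<in>space M. \<tau> n \<omega> \<le> s}"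
    by (rule finite_measure_Diff) (use assms in auto)
  ultimately show ?thesis
    using exponential_distributedD_le[OF tau_law _ mu_pos, of s n] assms
      exponential_distributedD_le[OF tau_law _ mu_pos, of "s + \<eta>" n] by simp
qed

lemma prob_tau_box:
  assumes "\<And>j. j \<le> l \<Longrightarrow> 0 \<le> s j" "0 \<le> \<eta>"
  shows "prob {\<omega>\<in>space M. \<forall>j\<le>l. s j < \<tau> (a + j) \<omega> \<and> \<tau> (a + j) \<omega> \<le> s j + \<eta>} =
    (\<Prod>j\<le>l. exp (- s j * \<mu>) - exp (- (s j + \<eta>) * \<mu>))"
proof -
  let ?I = "(\<lambda>j. a + j) ` {..l}"
  let ?A = "\<lambda>k. {s (k - a) <.. s (k - a) + \<eta>}"
  have "prob (\<Inter>k\<in>?I. \<tau> k -` ?A k \<inter> space M) = (\<Prod>k\<in>?I. prob (\<tau> k -` ?A k \<inter> space M))"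
    by (rule indep_varsD[OF tau_indep]) auto
  moreover have "(\<Inter>k\<in>?I. \<tau> k -` ?A k \<inter> space M) =
      {\<omega>\<in>space M. \<forall>j\<le>l. s j < \<tau> (a + j) \<omega> \<and> \<tau> (a + j) \<omega> \<le> s j + \<eta>}"
    by auto
  moreover have "(\<Prod>k\<in>?I. prob (\<tau> k -` ?A k \<inter> space M)) =
      (\<Prod>j\<le>l. prob (\<tau> (a + j) -` ?A (a + j) \<inter> space M))"
    by (subst prod.reindex) (auto simp: inj_on_def)
  moreover have "prob (\<tau> (a + j) -` ?A (a + j) \<inter> space M) = exp (- s j * \<mu>) - exp (- (s j + \<eta>) * \<mu>)"
    if "j \<le> l" for j
  proof -
    have "\<tau> (a + j) -` ?A (a + j) \<inter> space M = {\<omega>\<in>space M. s j < \<tau> (a + j) \<omega> \<and> \<tau> (a + j) \<omega> \<le> s j + \<eta>}"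
      by auto
    then show ?thesis using prob_tau_interval[of "s j" \<eta> "a + j"] assms(1)[OF that] assms(2) by simp
  qed
  ultimately show ?thesis by simp
qed

lemma prob_Z_path_tau_box:
  assumes "\<And>j. j \<le> l \<Longrightarrow> 0 \<le> s j" "0 \<le> \<eta>"
  shows "prob {\<omega>\<in>space M. \<forall>j\<le>l. Z (a + j) \<omega> = y j \<and> s j < \<tau> (a + j) \<omega> \<and> \<tau> (a + j) \<omega> \<le> s j + \<eta>} =
    prob {\<omega>\<in>space M. Z a \<omega> = y 0} * (\<Prod>j<l. P $ y j $ y (Suc j)) *
    (\<Prod>j\<le>l. exp (- s j * \<mu>) - exp (- (s j + \<eta>) * \<mu>))"
proof -
  let ?AZ = "{\<omega>\<in>space M. \<forall>j\<le>l. Z (a + j) \<omega> = y j}"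
  let ?AT = "{\<omega>\<in>space M. \<forall>j\<le>l. s j < \<tau> (a + j) \<omega> \<and> \<tau> (a + j) \<omega> \<le> s j + \<eta>}"
  let ?NZ = "PiM UNIV (\<lambda>_. count_space UNIV) :: (nat \<Rightarrow> 'n) measure"
  let ?NT = "PiM UNIV (\<lambda>_. borel) :: (nat \<Rightarrow> real) measure"
  have "{z\<in>space ?NZ. z (a + j) = y j} \<in> sets ?NZ" for j
    using measurable_sets[OF measurable_component_singleton[of "a + j" UNIV "\<lambda>_. count_space UNIV"], of "{y j}"]
    by (simp add: vimage_def Int_def conj_commute)
  then have "{z\<in>space ?NZ. \<forall>j\<in>{..l}. z (a + j) = y j} \<in> sets ?NZ"
    by (intro sets.sets_Collect_finite_All) auto
  from in_vimage_algebra[OF this, of "\<lambda>\<omega> n. Z n \<omega>" "space M"]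
  have "(\<lambda>\<omega> n. Z n \<omega>) -` {z\<in>space ?NZ. \<forall>j\<in>{..l}. z (a + j) = y j} \<inter> space M
      \<in> sets (vimage_algebra (space M) (\<lambda>\<omega> n. Z n \<omega>) ?NZ)" .
  moreover have "space ?NZ = UNIV" by (simp add: space_PiM)
  then have "(\<lambda>\<omega> n. Z n \<omega>) -` {z\<in>space ?NZ. \<forall>j\<in>{..l}. z (a + j) = y j} \<inter> space M = ?AZ"
    by auto
  ultimately have 1: "?AZ \<in> sets (vimage_algebra (space M) (\<lambda>\<omega> n. Z n \<omega>) ?NZ)" by (simp only:)
  have "{z\<in>space ?NT. s j < z (a + j) \<and> z (a + j) \<le> s j + \<eta>} \<in> sets ?NT" for j
    using measurable_sets[OF measurable_component_singleton[of "a + j" UNIV "\<lambda>_. borel :: real measure"],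
        of "{s j <.. s j + \<eta>}"]
    by (simp add: vimage_def Int_def conj_commute)
  then have "{z\<in>space ?NT. \<forall>j\<in>{..l}. s j < z (a + j) \<and> z (a + j) \<le> s j + \<eta>} \<in> sets ?NT"
    by (intro sets.sets_Collect_finite_All) auto
  from in_vimage_algebra[OF this, of "\<lambda>\<omega> n. \<tau> n \<omega>" "space M"]
  have "(\<lambda>\<omega> n. \<tau> n \<omega>) -` {z\<in>space ?NT. \<forall>j\<in>{..l}. s j < z (a + j) \<and> z (a + j) \<le> s j + \<eta>} \<inter> space M
      \<in> sets (vimage_algebra (space M) (\<lambda>\<omega> n. \<tau> n \<omega>) ?NT)" .
  moreover have "space ?NT = UNIV" by (simp add: space_PiM)
  then have "(\<lambda>\<omega> n. \<tau> n \<omega>) -` {z\<in>space ?NT. \<forall>j\<in>{..l}. s j < z (a + j) \<and> z (a + j) \<le> s j + \<eta>} \<inter> space M = ?AT"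
    by auto
  ultimately have 2: "?AT \<in> sets (vimage_algebra (space M) (\<lambda>\<omega> n. \<tau> n \<omega>) ?NT)" by (simp only:)
  have "prob (?AZ \<inter> ?AT) = prob ?AZ * prob ?AT" by (rule indep_setD[OF Z_tau_indep 1 2])
  moreover have "?AZ \<inter> ?AT = {\<omega>\<in>space M. \<forall>j\<le>l. Z (a + j) \<omega> = y j \<and> s j < \<tau> (a + j) \<omega> \<and> \<tau> (a + j) \<omega> \<le> s j + \<eta>}"
    by auto
  ultimately show ?thesis by (simp add: prob_Z_path prob_tau_box[OF assms])
qed

lemma tau_integrable: "integrable M (\<tau> n)" and tau_expectation: "expectation (\<tau> n) = 1 / \<mu>"
proof -
  show e: "expectation (\<tau> n) = 1 / \<mu>" by (rule exponential_distributed_expectation[OF mu_pos tau_law])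
  then show "integrable M (\<tau> n)" using mu_pos not_integrable_integral_eq by fastforce
qed

lemma prob_jump_time_gt:
  assumes "0 < t" shows "prob {\<omega>\<in>space M. t < (\<Sum>k<n. \<tau> k \<omega>)} \<le> real n / (\<mu> * t)"
proof -
  have "prob {\<omega>\<in>space M. t < (\<Sum>k<n. \<tau> k \<omega>)} \<le> prob {\<omega>\<in>space M. (\<Sum>k<n. \<tau> k \<omega>) \<ge> t}"
    by (intro finite_measure_mono) auto
  also have "\<dots> \<le> expectation (\<lambda>\<omega>. \<Sum>k<n. \<tau> k \<omega>) / t"
    by (rule integral_Markov_inequality_measure[where A = "{}"])
       (auto intro!: Bochner_Integration.integrable_sum tau_integrable AE_I2 sum_nonneg less_imp_le[OF tau_pos] assms)
  also have "\<dots> = real n / (\<mu> * t)"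
    by (subst Bochner_Integration.integral_sum) (auto simp: tau_integrable tau_expectation)
  finally show ?thesis .
qed

text \<open>A pattern prescribes, for each starting state, finitely many transitions of positive
  probability and approximate holding times. Uniformly in the index \<open>a\<close> it occurs from there on with
  probability bounded below, whatever the distribution of the state at that index.\<close>

definition pattern_event ::
    "('n \<Rightarrow> nat \<Rightarrow> 'n) \<Rightarrow> ('n \<Rightarrow> nat \<Rightarrow> real) \<Rightarrow> ('n \<Rightarrow> nat) \<Rightarrow> real \<Rightarrow> nat \<Rightarrow> 'a set" where
  "pattern_event y s l \<eta> a = (\<Union>i. {\<omega>\<in>space M.
     \<forall>j\<le>l i. Z (a + j) \<omega> = y i j \<and> s i j < \<tau> (a + j) \<omega> \<and> \<tau> (a + j) \<omega> \<le> s i j + \<eta>})"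

lemma pattern_event_sets: "pattern_event y s l \<eta> a \<in> sets M"
proof -
  have "{\<omega>\<in>space M. \<forall>j\<le>l i. Z (a + j) \<omega> = y i j} \<inter>
      {\<omega>\<in>space M. \<forall>j\<le>l i. s i j < \<tau> (a + j) \<omega> \<and> \<tau> (a + j) \<omega> \<le> s i j + \<eta>} \<in> sets M" for i
    by (intro sets.Int Z_path_event tau_box_event)
  moreover have "pattern_event y s l \<eta> a = (\<Union>i. {\<omega>\<in>space M. \<forall>j\<le>l i. Z (a + j) \<omega> = y i j} \<inter>
      {\<omega>\<in>space M. \<forall>j\<le>l i. s i j < \<tau> (a + j) \<omega> \<and> \<tau> (a + j) \<omega> \<le> s i j + \<eta>})"
    unfolding pattern_event_def by auto
  ultimately show ?thesis by auto
qed

lemma prob_pattern_event: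
  assumes y0: "\<And>i. y i 0 = i" and yP: "\<And>i j. j < l i \<Longrightarrow> 0 < P $ y i j $ y i (Suc j)"
    and s: "\<And>i j. j \<le> l i \<Longrightarrow> 0 \<le> s i j" and \<eta>: "0 < \<eta>"
  obtains p where "0 < p" "\<And>a. p \<le> prob (pattern_event y s l \<eta> a)"
proof -
  define w where "w i = (\<Prod>j<l i. P $ y i j $ y i (Suc j)) *
      (\<Prod>j\<le>l i. exp (- s i j * \<mu>) - exp (- (s i j + \<eta>) * \<mu>))" for i
  have w_pos: "0 < w i" for i
    unfolding w_def
  proof (intro mult_pos_pos prod_pos)
    fix j
    have "0 < \<eta> * \<mu>" using \<eta> mu_pos by simp
    then show "0 < exp (- s i j * \<mu>) - exp (- (s i j + \<eta>) * \<mu>)" by (simp add: algebra_simps)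
  qed (use yP in auto)
  define p where "p = Min (range w)"
  have "p \<in> range w" unfolding p_def by (intro Min_in) auto
  then have p_pos: "0 < p" using w_pos by auto
  have p_le: "p \<le> w i" for i unfolding p_def by (intro Min_le) auto
  have "p \<le> prob (pattern_event y s l \<eta> a)" for a
  proof -
    let ?D = "\<lambda>i. {\<omega>\<in>space M. \<forall>j\<le>l i. Z (a + j) \<omega> = y i j \<and> s i j < \<tau> (a + j) \<omega> \<and> \<tau> (a + j) \<omega> \<le> s i j + \<eta>}"
    have D_sets: "?D i \<in> sets M" for i
    proof -
      have "?D i = {\<omega>\<in>space M. \<forall>j\<le>l i. Z (a + j) \<omega> = y i j} \<inter>
        {\<omega>\<in>space M. \<forall>j\<le>l i. s i j < \<tau> (a + j) \<omega> \<and> \<tau> (a + j) \<omega> \<le> s i j + \<eta>}" by auto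
      then show ?thesis by (simp only: sets.Int[OF Z_path_event tau_box_event])
    qed
    have Z0: "Z a \<omega> = i" if "\<omega> \<in> ?D i" for \<omega> i
    proof -
      have "Z (a + 0) \<omega> = y i 0" using that by blast
      then show ?thesis using y0 by simp
    qed
    have "p = (\<Sum>i\<in>UNIV. prob {\<omega>\<in>space M. Z a \<omega> = i} * p)"
      by (simp add: sum_distrib_right[symmetric] sum_prob_Z)
    also have "\<dots> \<le> (\<Sum>i\<in>UNIV. prob {\<omega>\<in>space M. Z a \<omega> = i} * w i)"
      by (intro sum_mono mult_left_mono p_le) auto
    also have "\<dots> = (\<Sum>i\<in>UNIV. prob (?D i))"
    proof (rule sum.cong[OF refl])
      fix i
      have "prob (?D i) = prob {\<omega>\<in>space M. Z a \<omega> = y i 0} * (\<Prod>j<l i. P $ y i j $ y i (Suc j)) *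
          (\<Prod>j\<le>l i. exp (- s i j * \<mu>) - exp (- (s i j + \<eta>) * \<mu>))"
        by (rule prob_Z_path_tau_box) (use s \<eta> in auto)
      then show "prob {\<omega>\<in>space M. Z a \<omega> = i} * w i = prob (?D i)"
        by (simp only: w_def y0 mult.assoc)
    qed
    also have "\<dots> = prob (pattern_event y s l \<eta> a)"
      unfolding pattern_event_def
    proof (rule finite_measure_finite_Union[symmetric])
      show "range ?D \<subseteq> events" using D_sets by blast
      have "?D i \<inter> ?D i' = {}" if "i \<noteq> i'" for i i'
      proof (rule equals0I)
        fix \<omega> assume "\<omega> \<in> ?D i \<inter> ?D i'"
        then show False using Z0[of \<omega> i] Z0[of \<omega> i'] that by blast
      qed
      then show "disjoint_family_on ?D UNIV" unfolding disjoint_family_on_def by blast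
    qed simp
    finally show ?thesis .
  qed
  then show ?thesis using that p_pos by blast
qed

end

section \<open>Bounds and contraction for products of exponentials\<close>

text \<open>Applied to the induced matrix norms, this allows the exponent of the random flow to be computed
  with the extremal norm in place of the reference norm.\<close>

lemma log_norms_comparable:
  fixes v e :: "'v::euclidean_space \<Rightarrow> real"
  assumes v: "is_norm v" and e: "is_norm e"
  obtains K where "0 \<le> K" "\<And>x. x \<noteq> 0 \<Longrightarrow> \<bar>ln (v x) - ln (e x)\<bar> \<le> K"
proof -
  obtain C1 where C1: "0 < C1" "\<And>x. v x \<le> C1 * norm x" using is_norm_le_norm[OF v] by blast
  obtain c1 where c1: "0 < c1" "\<And>x. c1 * norm x \<le> v x" using is_norm_ge_norm[OF v] by blast
  obtain C2 where C2: "0 < C2" "\<And>x. e x \<le> C2 * norm x" using is_norm_le_norm[OF e] by blast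
  obtain c2 where c2: "0 < c2" "\<And>x. c2 * norm x \<le> e x" using is_norm_ge_norm[OF e] by blast
  have ln_le: "ln (w x) \<le> ln C + ln (norm x)"
    if "0 < C" "w x \<le> C * norm x" "0 < w x" "x \<noteq> 0" for w C and x :: 'v
  proof -
    have "ln (w x) \<le> ln (C * norm x)" using that by (intro ln_mono) auto
    then show ?thesis using that by (simp add: ln_mult)
  qed
  have ln_ge: "ln c + ln (norm x) \<le> ln (w x)"
    if "0 < c" "c * norm x \<le> w x" "x \<noteq> 0" for w c and x :: 'v
  proof -
    have "ln (c * norm x) \<le> ln (w x)" using that by (intro ln_mono) auto
    then show ?thesis using that by (simp add: ln_mult)
  qed
  show ?thesis
  proof (rule that[of "\<bar>ln C1 - ln c2\<bar> + \<bar>ln C2 - ln c1\<bar>"])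
    fix x :: 'v assume x: "x \<noteq> 0"
    show "\<bar>ln (v x) - ln (e x)\<bar> \<le> \<bar>ln C1 - ln c2\<bar> + \<bar>ln C2 - ln c1\<bar>"
      using ln_le[of C1 v x, OF C1(1) C1(2) is_norm_pos[OF v x] x]
        ln_le[of C2 e x, OF C2(1) C2(2) is_norm_pos[OF e x] x]
        ln_ge[of c1 x v, OF c1(1) c1(2) x] ln_ge[of c2 x e, OF c2(1) c2(2) x] by linarith
  qed simp
qed

text \<open>Each factor can be undone at the cost of a factor \<open>exp (C r)\<close>. This keeps the logarithm of the
  norm of the random flow bounded below, and hence integrable.\<close>

lemma wprod_opnorm_ge:
  fixes e :: "real^'d \<Rightarrow> real"
  assumes e: "is_norm e" and C: "\<And>i. opnorm e (B i) \<le> C" and r: "\<And>k. k < n \<Longrightarrow> 0 \<le> r k"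
  shows "exp (- C * (\<Sum>k<n. r k)) \<le> opnorm e (wprod B z r n)"
  using r
proof (induction n)
  case 0
  show ?case by (simp add: opnorm_mat_1 e)
next
  case (Suc n)
  let ?M = "B (z n)"
  have "wprod B z r n = mexp (- r n *\<^sub>R ?M) ** wprod B z r (Suc n)"
    by (simp add: matrix_mul_assoc mexp_minus_mult[simplified])
  then have "opnorm e (wprod B z r n) \<le> opnorm e (mexp (- r n *\<^sub>R ?M)) * opnorm e (wprod B z r (Suc n))"
    using opnorm_matrix_mult[OF e] by metis
  also have "\<dots> \<le> exp (C * r n) * opnorm e (wprod B z r (Suc n))"
  proof (intro mult_right_mono opnorm_nonneg e)
    have "opnorm e (mexp (- r n *\<^sub>R ?M)) \<le> exp (opnorm e (- r n *\<^sub>R ?M))"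
      by (rule opnorm_mexp[OF e])
    also have "opnorm e (- r n *\<^sub>R ?M) = r n * opnorm e ?M"
      using Suc.prems[of n] by (simp only: opnorm_scaleR[OF e]) simp
    also have "exp (r n * opnorm e ?M) \<le> exp (C * r n)"
      using mult_left_mono[OF C[of "z n"], of "r n"] Suc.prems[of n] by (simp add: mult.commute)
    finally show "opnorm e (mexp (- r n *\<^sub>R ?M)) \<le> exp (C * r n)" by simp
  qed
  finally have "exp (- C * (\<Sum>k<n. r k)) \<le> exp (C * r n) * opnorm e (wprod B z r (Suc n))"
    using Suc by (meson less_SucI order_trans)
  then have "exp (- C * (\<Sum>k<n. r k)) * exp (- C * r n) \<le> opnorm e (wprod B z r (Suc n))"
    by (simp add: exp_minus field_simps)
  then show ?case by (simp add: distrib_left exp_add[symmetric])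
qed

text \<open>Prescribed holding times are met exactly only with probability zero, so a contraction is needed
  that survives small perturbations. One-sided perturbations suffice and keep the times positive.\<close>

lemma contraction_neighbourhood:
  fixes e :: "real^'d \<Rightarrow> real"
  assumes e: "is_norm e" and lt: "opnorm e (wprod B y s n) < q"
  obtains \<eta> where "0 < \<eta>"
    "\<And>s'. (\<And>k. k < n \<Longrightarrow> s k < s' k \<and> s' k \<le> s k + \<eta>) \<Longrightarrow> opnorm e (wprod B y s' n) \<le> q"
proof -
  have "\<exists>\<eta>>0. \<forall>s'. (\<forall>k<n. s k < s' k \<and> s' k \<le> s k + \<eta>) \<longrightarrow> opnorm e (wprod B y s' n) \<le> q"
  proof (rule ccontr)
    assume neg: "\<not> ?thesis"
    have "\<exists>s'. (\<forall>k<n. s k < s' k \<and> s' k \<le> s k + inverse (real (Suc m))) \<and> q \<le> opnorm e (wprod B y s' n)" for m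
    proof -
      have "0 < inverse (real (Suc m))" by simp
      then show ?thesis using neg by (meson linear)
    qed
    then obtain f where f: "\<And>m k. k < n \<Longrightarrow> s k < f m k \<and> f m k \<le> s k + inverse (real (Suc m))"
      "\<And>m. q \<le> opnorm e (wprod B y (f m) n)" by metis
    have "(\<lambda>m. f m k) \<longlonglongrightarrow> s k" if "k < n" for k
    proof (rule tendsto_sandwich[OF _ _ tendsto_const])
      show "(\<lambda>m. s k + inverse (real (Suc m))) \<longlonglongrightarrow> s k"
        using tendsto_add[OF tendsto_const LIMSEQ_inverse_real_of_nat, of "s k"] by simp
      show "\<forall>\<^sub>F m in sequentially. s k \<le> f m k" "\<forall>\<^sub>F m in sequentially. f m k \<le> s k + inverse (real (Suc m))"
        using f(1)[OF that] by (auto intro!: always_eventually less_imp_le)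
    qed
    then have "(\<lambda>m. opnorm e (wprod B y (f m) n)) \<longlonglongrightarrow> opnorm e (wprod B y s n)"
      by (intro tendsto_opnorm[OF e] tendsto_wprod)
    then have "q \<le> opnorm e (wprod B y s n)" using f(2) by (intro LIMSEQ_le_const) auto
    then show False using lt by simp
  qed
  then show ?thesis using that by blast
qed

text \<open>Every element of the semigroup is realised along an admissible path of the chain from any
  starting state: connecting states are visited for time zero.\<close>

definition admissible ::
    "('n \<Rightarrow> real^'d^'d) \<Rightarrow> real^'n^'n \<Rightarrow> 'n \<Rightarrow> 'n \<Rightarrow> real^'d^'d \<Rightarrow> bool" where
  "admissible B P i j U \<longleftrightarrow> (\<exists>y s l. y 0 = i \<and> y l = j \<and> (\<forall>k<l. 0 < P $ y k $ y (Suc k)) \<and>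
     (\<forall>k\<le>l. 0 \<le> s k) \<and> U = wprod B y s (Suc l))"

lemma admissible_refl: "admissible B P i i (mat 1)"
  unfolding admissible_def
  by (intro exI[of _ "\<lambda>_. i"] exI[of _ "\<lambda>_. 0"] exI[of _ 0]) (simp add: mexp_0)

lemma admissible_stay:
  assumes "admissible B P i j U" "0 \<le> t" shows "admissible B P i j (mexp (t *\<^sub>R B j) ** U)"
proof -
  obtain y s l where 1: "y 0 = i" "y l = j" "\<forall>k<l. 0 < P $ y k $ y (Suc k)" "\<forall>k\<le>l. 0 \<le> s k"
    "U = wprod B y s (Suc l)" using assms(1) unfolding admissible_def by blast
  define s' where "s' = s(l := t + s l)"
  have "wprod B y s' l = wprod B y s l" by (rule wprod_cong) (auto simp: s'_def)
  then have "mexp (t *\<^sub>R B j) ** U = wprod B y s' (Suc l)"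
    using assms(2) by (simp add: s'_def 1(2,5) mexp_add matrix_mul_assoc)
  moreover have "\<forall>k\<le>l. 0 \<le> s' k" using 1(4) assms(2) by (simp add: s'_def)
  ultimately show ?thesis unfolding admissible_def using 1 by blast
qed

lemma admissible_jump:
  assumes "admissible B P i j U" "0 < P $ j $ j'" shows "admissible B P i j' U"
proof -
  obtain y s l where 1: "y 0 = i" "y l = j" "\<forall>k<l. 0 < P $ y k $ y (Suc k)" "\<forall>k\<le>l. 0 \<le> s k"
    "U = wprod B y s (Suc l)" using assms(1) unfolding admissible_def by blast
  define y' s' where "y' = y(Suc l := j')" and "s' = s(Suc l := 0)"
  have "wprod B y' s' (Suc l) = wprod B y s (Suc l)" by (rule wprod_cong) (auto simp: s'_def y'_def)
  then have "U = wprod B y' s' (Suc (Suc l))"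
    using 1(5) by (simp add: s'_def[THEN fun_cong] mexp_0)
  moreover have "y' 0 = i" "y' (Suc l) = j'" using 1 by (simp_all add: y'_def)
  moreover have "\<forall>k<Suc l. 0 < P $ y' k $ y' (Suc k)"
    using 1 assms(2) by (auto simp: y'_def less_Suc_eq)
  moreover have "\<forall>k\<le>Suc l. 0 \<le> s' k" using 1 by (simp add: s'_def le_Suc_eq)
  ultimately show ?thesis unfolding admissible_def by blast
qed

lemma admissible_reach:
  assumes "(j, j') \<in> {(k, l). 0 < P $ k $ l}\<^sup>*" "admissible B P i j U" shows "admissible B P i j' U"
  using assms by induction (auto intro: admissible_jump)

lemma semigroup_admissible:
  assumes "strongly_connected_matrix P" "U \<in> flow_semigroup B"
  shows "\<exists>j. admissible B P i j U"
  using assms(2)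
proof induction
  case one
  show ?case using admissible_refl by blast
next
  case (step U t i')
  then obtain j where "admissible B P i j U" by blast
  then have "admissible B P i i' U"
    using assms(1) admissible_reach unfolding strongly_connected_matrix_def by blast
  then show ?case using admissible_stay[OF _ step(2)] by blast
qed

section \<open>Growth of the random flow\<close>

context jump_chain
begin

abbreviation elapsed_time :: "real \<Rightarrow> 'a \<Rightarrow> nat \<Rightarrow> real" where
  "elapsed_time t \<omega> \<equiv> elapsed (\<lambda>k. \<tau> k \<omega>) t"

abbreviation random_prod :: "('n \<Rightarrow> real^'d^'d) \<Rightarrow> real \<Rightarrow> nat \<Rightarrow> 'a \<Rightarrow> real^'d^'d" where
  "random_prod B t n \<omega> \<equiv> wprod B (\<lambda>k. Z k \<omega>) (elapsed_time t \<omega>) n"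

lemma random_prod_measurable: "random_prod B t n \<in> borel_measurable M"
proof (induction n)
  case (Suc n)
  have "(\<lambda>\<omega>. elapsed_time t \<omega> n) \<in> borel_measurable M"
    unfolding elapsed_def by measurable
  then have "(\<lambda>\<omega>. mexp (elapsed_time t \<omega> n *\<^sub>R B i)) \<in> borel_measurable M" for i
    by (rule measurable_compose) (rule borel_measurable_continuous_onI[OF continuous_on_mexp])
  then have "(\<lambda>\<omega>. mexp (elapsed_time t \<omega> n *\<^sub>R B (Z n \<omega>))) \<in> borel_measurable M"
    by (rule measurable_compose_countable[OF _ Z_meas])
  then have "(\<lambda>\<omega>. mexp (elapsed_time t \<omega> n *\<^sub>R B (Z n \<omega>)) ** random_prod B t n \<omega>) \<in> borel_measurable M"
    by (rule borel_measurable_continuous_Pair[OF _ Suc])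
       (intro continuous_on_matrix_mult continuous_on_fst continuous_on_snd continuous_on_id)
  then show ?case by simp
qed simp

lemma jump_time_exceeds:
  assumes "\<omega> \<in> space M" obtains n where "N \<le> n" "t \<le> (\<Sum>k<n. \<tau> k \<omega>)"
proof -
  have "\<forall>\<^sub>F n in sequentially. t \<le> (\<Sum>k<n. \<tau> k \<omega>)"
    using tau_lim[OF assms] by (simp add: filterlim_at_top)
  then obtain n0 where n0: "\<And>n. n0 \<le> n \<Longrightarrow> t \<le> (\<Sum>k<n. \<tau> k \<omega>)" unfolding eventually_sequentially by blast
  show ?thesis by (rule that[of "max N n0"]) (auto intro: n0)
qed

lemma random_prod_step_le:
  fixes e :: "real^'d \<Rightarrow> real"
  assumes e: "is_norm e" and le1: "\<And>U. U \<in> flow_semigroup B \<Longrightarrow> opnorm e U \<le> 1" and "n \<le> m"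
  shows "opnorm e (random_prod B t m \<omega>) \<le> opnorm e (random_prod B t n \<omega>)"
proof -
  obtain b where m: "m = n + b" using assms(3) le_Suc_ex by blast
  have "opnorm e (random_prod B t m \<omega>) \<le>
      opnorm e (wprod B (\<lambda>k. Z (n + k) \<omega>) (\<lambda>k. elapsed_time t \<omega> (n + k)) b) * opnorm e (random_prod B t n \<omega>)"
    unfolding m wprod_add by (rule opnorm_matrix_mult[OF e])
  also have "\<dots> \<le> 1 * opnorm e (random_prod B t n \<omega>)"
    by (intro mult_right_mono le1 wprod_in_semigroup elapsed_nonneg opnorm_nonneg e)
  finally show ?thesis by simp
qed

lemma random_prod_pos:
  fixes e :: "real^'d \<Rightarrow> real"
  assumes e: "is_norm e" shows "0 < opnorm e (random_prod B t n \<omega>)"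
proof -
  define C where "C = Max (range (\<lambda>i. opnorm e (B i)))"
  have "opnorm e (B i) \<le> C" for i unfolding C_def by (intro Max_ge) auto
  then show ?thesis
    by (rule less_le_trans[OF exp_gt_zero wprod_opnorm_ge[OF e]]) (rule elapsed_nonneg)
qed

text \<open>Every block of \<open>m\<close> steps that follows the pattern and is completed before time \<open>t\<close>
  contributes a factor \<open>q\<close>; all other factors have norm at most one.\<close>

lemma random_prod_blocks:
  fixes e :: "real^'d \<Rightarrow> real"
  assumes e: "is_norm e" and le1: "\<And>U. U \<in> flow_semigroup B \<Longrightarrow> opnorm e U \<le> 1"
    and q: "0 < q"
    and contr: "\<And>i s'. (\<And>k. k < Suc (l i) \<Longrightarrow> s i k < s' k \<and> s' k \<le> s i k + \<eta>) \<Longrightarrow>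
      opnorm e (wprod B (y i) s' (Suc (l i))) \<le> q"
    and m: "\<And>i. Suc (l i) \<le> m" and \<omega>: "\<omega> \<in> space M"
  shows "ln (opnorm e (random_prod B t (n * m) \<omega>)) \<le> ln q * (\<Sum>k<n.
    indicator (pattern_event y s l \<eta> (k * m) \<inter> {\<omega>\<in>space M. (\<Sum>j<(k + 1) * m. \<tau> j \<omega>) \<le> t}) \<omega>)"
proof (induction n)
  case 0
  show ?case by (simp add: opnorm_mat_1 e)
next
  case (Suc n)
  let ?E = "pattern_event y s l \<eta> (n * m) \<inter> {\<omega>\<in>space M. (\<Sum>j<(n + 1) * m. \<tau> j \<omega>) \<le> t}"
  let ?b = "n * m"
  have "ln (opnorm e (random_prod B t (Suc n * m) \<omega>)) \<le>
      ln q * indicator ?E \<omega> + ln (opnorm e (random_prod B t ?b \<omega>))"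
  proof (cases "\<omega> \<in> ?E")
    case False
    have "ln (opnorm e (random_prod B t (Suc n * m) \<omega>)) \<le> ln (opnorm e (random_prod B t ?b \<omega>))"
      by (intro ln_mono random_prod_step_le e le1 random_prod_pos) auto
    then show ?thesis using False by simp
  next
    case True
    then obtain i where i: "\<And>j. j \<le> l i \<Longrightarrow> Z (?b + j) \<omega> = y i j"
      "\<And>j. j \<le> l i \<Longrightarrow> s i j < \<tau> (?b + j) \<omega> \<and> \<tau> (?b + j) \<omega> \<le> s i j + \<eta>"
      unfolding pattern_event_def by blast
    have el: "elapsed_time t \<omega> (?b + j) = \<tau> (?b + j) \<omega>" if "j \<le> l i" for j
    proof (rule elapsed_eq)
      have "Suc (?b + j) \<le> (n + 1) * m" using that m[of i] by simp
      then have "(\<Sum>k<Suc (?b + j). \<tau> k \<omega>) \<le> (\<Sum>k<(n + 1) * m. \<tau> k \<omega>)"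
        by (intro partial_sum_mono tau_pos \<omega>)
      then show "(\<Sum>k<Suc (?b + j). \<tau> k \<omega>) \<le> t" using True by simp
    qed (rule tau_pos[OF \<omega>])
    let ?w = "wprod B (\<lambda>k. Z (?b + k) \<omega>) (\<lambda>k. elapsed_time t \<omega> (?b + k)) (Suc (l i))"
    have "?w = wprod B (y i) (\<lambda>k. \<tau> (?b + k) \<omega>) (Suc (l i))"
      by (rule wprod_cong) (simp_all add: i el)
    then have w: "opnorm e ?w \<le> q" using contr[of i "\<lambda>k. \<tau> (?b + k) \<omega>"] i(2) by simp
    have "opnorm e (random_prod B t (Suc n * m) \<omega>) \<le> opnorm e (random_prod B t (?b + Suc (l i)) \<omega>)"
      by (intro random_prod_step_le e le1) (use m[of i] in auto)
    also have "\<dots> \<le> opnorm e ?w * opnorm e (random_prod B t ?b \<omega>)"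
      unfolding wprod_add by (rule opnorm_matrix_mult[OF e])
    also have "\<dots> \<le> q * opnorm e (random_prod B t ?b \<omega>)"
      by (intro mult_right_mono w opnorm_nonneg e)
    finally have "ln (opnorm e (random_prod B t (Suc n * m) \<omega>)) \<le> ln (q * opnorm e (random_prod B t ?b \<omega>))"
      by (intro ln_mono random_prod_pos e) auto
    also have "\<dots> = ln q + ln (opnorm e (random_prod B t ?b \<omega>))"
      by (intro ln_mult_pos q random_prod_pos e)
    finally show ?thesis using True by simp
  qed
  then show ?case using Suc by (simp add: distrib_left)
qed

end

context jump_chain
begin

context
  fixes \<sigma> :: "'a \<Rightarrow> real \<Rightarrow> 'n" and A :: "'n \<Rightarrow> real^'d^'d" and e :: "real^'d \<Rightarrow> real" and \<Lambda> :: real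
  assumes signal: "\<And>\<omega> n t. \<omega> \<in> space M \<Longrightarrow> (\<Sum>k<n. \<tau> k \<omega>) \<le> t \<Longrightarrow> t < (\<Sum>k<Suc n. \<tau> k \<omega>) \<Longrightarrow>
      \<sigma> \<omega> t = Z n \<omega>"
    and e: "is_norm e"
    and le1: "\<And>U. U \<in> flow_semigroup (\<lambda>i. A i - \<Lambda> *\<^sub>R mat 1) \<Longrightarrow> opnorm e U \<le> 1"
begin

abbreviation B where "B \<equiv> \<lambda>i. A i - \<Lambda> *\<^sub>R mat 1"

lemma random_flow_normalized:
  assumes "\<omega> \<in> space M" "0 \<le> t" "t \<le> (\<Sum>k<n. \<tau> k \<omega>)"
  shows "flow A (\<sigma> \<omega>) t = exp (\<Lambda> * t) *\<^sub>R random_prod B t n \<omega>"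
proof -
  have "flow A (\<sigma> \<omega>) t = random_prod A t n \<omega>"
    by (rule flow_is_wprod) (use assms signal tau_pos tau_lim in auto)
  also have "\<dots> = exp (\<Lambda> * (\<Sum>k<n. elapsed_time t \<omega> k)) *\<^sub>R random_prod B t n \<omega>"
    by (rule wprod_shift) (rule elapsed_nonneg)
  also have "(\<Sum>k<n. elapsed_time t \<omega> k) = t"
    using sum_elapsed[of "\<lambda>k. \<tau> k \<omega>" t n] assms less_imp_le[OF tau_pos[OF assms(1)]] by simp
  finally show ?thesis .
qed

lemma log_opnorm_random_flow:
  assumes "\<omega> \<in> space M" "0 \<le> t" "t \<le> (\<Sum>k<n. \<tau> k \<omega>)"
  shows "ln (opnorm e (flow A (\<sigma> \<omega>) t)) = \<Lambda> * t + ln (opnorm e (random_prod B t n \<omega>))"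
proof -
  have "opnorm e (flow A (\<sigma> \<omega>) t) = exp (\<Lambda> * t) * opnorm e (random_prod B t n \<omega>)"
    by (simp add: random_flow_normalized[OF assms] opnorm_scaleR[OF e])
  then show ?thesis by (simp add: ln_mult_pos random_prod_pos[OF e])
qed

text \<open>The number of factors that represents the flow at time \<open>t\<close> depends on the outcome; as a limit
  over that number the norm is still measurable.\<close>

lemma random_flow_opnorm_measurable:
  fixes v :: "real^'d \<Rightarrow> real"
  assumes v: "is_norm v" and t: "0 \<le> t"
  shows "(\<lambda>\<omega>. opnorm v (flow A (\<sigma> \<omega>) t)) \<in> borel_measurable M"
proof (rule borel_measurable_LIMSEQ_real)
  let ?u = "\<lambda>n \<omega>. opnorm v (exp (\<Lambda> * t) *\<^sub>R random_prod B t n \<omega>)"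
  show "?u n \<in> borel_measurable M" for n
    using random_prod_measurable[of B t n]
    by (intro measurable_compose[OF _ borel_measurable_continuous_onI[OF continuous_on_opnorm[OF v, of UNIV]]]
        borel_measurable_scaleR measurable_const) auto
  fix \<omega> assume \<omega>: "\<omega> \<in> space M"
  have "\<forall>\<^sub>F n in sequentially. t \<le> (\<Sum>k<n. \<tau> k \<omega>)"
    using tau_lim[OF \<omega>] by (simp add: filterlim_at_top)
  then have "\<forall>\<^sub>F n in sequentially. ?u n \<omega> = opnorm v (flow A (\<sigma> \<omega>) t)"
    by eventually_elim (simp add: random_flow_normalized[OF \<omega> t])
  then show "(\<lambda>n. ?u n \<omega>) \<longlonglongrightarrow> opnorm v (flow A (\<sigma> \<omega>) t)" by (rule tendsto_eventually)
qed

lemma log_opnorm_random_flow_bounds: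
  obtains C where "\<And>\<omega> t. \<omega> \<in> space M \<Longrightarrow> 0 \<le> t \<Longrightarrow>
    \<Lambda> * t - C * t \<le> ln (opnorm e (flow A (\<sigma> \<omega>) t)) \<and> ln (opnorm e (flow A (\<sigma> \<omega>) t)) \<le> \<Lambda> * t"
proof -
  define C where "C = Max (range (\<lambda>i. opnorm e (B i)))"
  have C: "opnorm e (B i) \<le> C" for i unfolding C_def by (intro Max_ge) auto
  have "\<Lambda> * t - C * t \<le> ln (opnorm e (flow A (\<sigma> \<omega>) t)) \<and> ln (opnorm e (flow A (\<sigma> \<omega>) t)) \<le> \<Lambda> * t"
    if \<omega>: "\<omega> \<in> space M" and t: "0 \<le> t" for \<omega> t
  proof -
    obtain n where n: "t \<le> (\<Sum>k<n. \<tau> k \<omega>)" using jump_time_exceeds[OF \<omega>] by blast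
    have "exp (- C * (\<Sum>k<n. elapsed_time t \<omega> k)) \<le> opnorm e (random_prod B t n \<omega>)"
      by (rule wprod_opnorm_ge[OF e C]) (rule elapsed_nonneg)
    moreover have "(\<Sum>k<n. elapsed_time t \<omega> k) = t"
      using sum_elapsed[of "\<lambda>k. \<tau> k \<omega>" t n] t n less_imp_le[OF tau_pos[OF \<omega>]] by simp
    ultimately have "ln (exp (- C * t)) \<le> ln (opnorm e (random_prod B t n \<omega>))"
      by (intro ln_mono) auto
    moreover have "ln (opnorm e (random_prod B t n \<omega>)) \<le> ln 1"
      by (intro ln_mono random_prod_pos e le1 wprod_in_semigroup elapsed_nonneg)
    ultimately show ?thesis by (simp add: log_opnorm_random_flow[OF \<omega> t n])
  qed
  then show ?thesis using that by blast
qed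

lemma flow_nonzero:
  assumes "\<omega> \<in> space M" "0 \<le> t" shows "flow A (\<sigma> \<omega>) t \<noteq> 0"
proof -
  obtain n where n: "t \<le> (\<Sum>k<n. \<tau> k \<omega>)" using jump_time_exceeds[OF assms(1)] by blast
  have "random_prod B t n \<omega> \<noteq> 0"
    using random_prod_pos[OF e, of B \<omega> t n] is_norm_zero[OF is_norm_opnorm[OF e]] by auto
  then show ?thesis by (simp add: random_flow_normalized[OF assms n])
qed

lemma log_opnorm_integrable:
  fixes v :: "real^'d \<Rightarrow> real"
  assumes v: "is_norm v" and t: "0 \<le> t"
  shows "integrable M (\<lambda>\<omega>. ln (opnorm v (flow A (\<sigma> \<omega>) t)))"
proof -
  obtain C where C: "\<And>\<omega> t. \<omega> \<in> space M \<Longrightarrow> 0 \<le> t \<Longrightarrow>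
    \<Lambda> * t - C * t \<le> ln (opnorm e (flow A (\<sigma> \<omega>) t)) \<and> ln (opnorm e (flow A (\<sigma> \<omega>) t)) \<le> \<Lambda> * t"
    using log_opnorm_random_flow_bounds by blast
  obtain K where K: "\<And>X. X \<noteq> 0 \<Longrightarrow> \<bar>ln (opnorm v X) - ln (opnorm e X)\<bar> \<le> K"
    using log_norms_comparable[OF is_norm_opnorm[OF v] is_norm_opnorm[OF e]] by blast
  have "AE \<omega> in M. norm (ln (opnorm v (flow A (\<sigma> \<omega>) t))) \<le> K + \<bar>\<Lambda> * t\<bar> + \<bar>C * t\<bar>"
  proof (rule AE_I2)
    fix \<omega> assume \<omega>: "\<omega> \<in> space M"
    show "norm (ln (opnorm v (flow A (\<sigma> \<omega>) t))) \<le> K + \<bar>\<Lambda> * t\<bar> + \<bar>C * t\<bar>"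
      using C[OF \<omega> t] K[OF flow_nonzero[OF \<omega> t]] unfolding real_norm_def by linarith
  qed
  then show ?thesis
    by (rule integrable_const_bound) (intro borel_measurable_ln random_flow_opnorm_measurable v t)
qed

lemma expected_log_comparison:
  fixes v :: "real^'d \<Rightarrow> real"
  assumes v: "is_norm v"
  shows "\<exists>K. \<forall>t\<ge>0.
    \<bar>expectation (\<lambda>\<omega>. ln (opnorm v (flow A (\<sigma> \<omega>) t))) - expectation (\<lambda>\<omega>. ln (opnorm e (flow A (\<sigma> \<omega>) t)))\<bar> \<le> K"
proof -
  obtain K where K: "\<And>X. X \<noteq> 0 \<Longrightarrow> \<bar>ln (opnorm v X) - ln (opnorm e X)\<bar> \<le> K"
    using log_norms_comparable[OF is_norm_opnorm[OF v] is_norm_opnorm[OF e]] by blast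
  have "\<bar>expectation (\<lambda>\<omega>. ln (opnorm v (flow A (\<sigma> \<omega>) t))) - expectation (\<lambda>\<omega>. ln (opnorm e (flow A (\<sigma> \<omega>) t)))\<bar> \<le> K"
    if t: "0 \<le> t" for t
  proof -
    note int = log_opnorm_integrable[OF v t] log_opnorm_integrable[OF e t]
    have 1: "expectation (\<lambda>\<omega>. ln (opnorm v (flow A (\<sigma> \<omega>) t)) - ln (opnorm e (flow A (\<sigma> \<omega>) t))) \<le> K"
    proof (rule integral_le_const[OF Bochner_Integration.integrable_diff[OF int]], rule AE_I2)
      fix \<omega> assume \<omega>: "\<omega> \<in> space M"
      show "ln (opnorm v (flow A (\<sigma> \<omega>) t)) - ln (opnorm e (flow A (\<sigma> \<omega>) t)) \<le> K"
        using K[OF flow_nonzero[OF \<omega> t]] by linarith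
    qed
    have 2: "- K \<le> expectation (\<lambda>\<omega>. ln (opnorm v (flow A (\<sigma> \<omega>) t)) - ln (opnorm e (flow A (\<sigma> \<omega>) t)))"
    proof (rule integral_ge_const[OF Bochner_Integration.integrable_diff[OF int]], rule AE_I2)
      fix \<omega> assume \<omega>: "\<omega> \<in> space M"
      show "- K \<le> ln (opnorm v (flow A (\<sigma> \<omega>) t)) - ln (opnorm e (flow A (\<sigma> \<omega>) t))"
        using K[OF flow_nonzero[OF \<omega> t]] by linarith
    qed
    show ?thesis using 1 2 by (simp add: Bochner_Integration.integral_diff[OF int] abs_le_iff)
  qed
  then show ?thesis by blast
qed

lemma expected_log_bounds: "\<exists>C. \<forall>t\<ge>0. \<Lambda> * t - C * t \<le> expectation (\<lambda>\<omega>. ln (opnorm e (flow A (\<sigma> \<omega>) t)))"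
proof -
  obtain C where C: "\<And>\<omega> t. \<omega> \<in> space M \<Longrightarrow> 0 \<le> t \<Longrightarrow>
    \<Lambda> * t - C * t \<le> ln (opnorm e (flow A (\<sigma> \<omega>) t)) \<and> ln (opnorm e (flow A (\<sigma> \<omega>) t)) \<le> \<Lambda> * t"
    using log_opnorm_random_flow_bounds by blast
  have "\<Lambda> * t - C * t \<le> expectation (\<lambda>\<omega>. ln (opnorm e (flow A (\<sigma> \<omega>) t)))" if t: "0 \<le> t" for t
    using C t by (intro integral_ge_const[OF log_opnorm_integrable[OF e t]] AE_I2) blast
  then show ?thesis by blast
qed

lemma expected_log_of_norm_one:
  assumes one: "\<And>U. U \<in> flow_semigroup B \<Longrightarrow> opnorm e U = 1" and t: "0 \<le> t"
  shows "expectation (\<lambda>\<omega>. ln (opnorm e (flow A (\<sigma> \<omega>) t))) = \<Lambda> * t"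
proof -
  have "ln (opnorm e (flow A (\<sigma> \<omega>) t)) = \<Lambda> * t" if \<omega>: "\<omega> \<in> space M" for \<omega>
  proof -
    obtain n where n: "t \<le> (\<Sum>k<n. \<tau> k \<omega>)" using jump_time_exceeds[OF \<omega>] by blast
    have "opnorm e (random_prod B t n \<omega>) = 1" by (intro one wprod_in_semigroup elapsed_nonneg)
    then show ?thesis by (simp add: log_opnorm_random_flow[OF \<omega> t n])
  qed
  then have "expectation (\<lambda>\<omega>. ln (opnorm e (flow A (\<sigma> \<omega>) t))) = expectation (\<lambda>_. \<Lambda> * t)"
    by (intro Bochner_Integration.integral_cong) auto
  then show ?thesis by (simp add: prob_space)
qed

text \<open>If a single product of exponentials contracts, each of the first \<open>k\<close> blocks of \<open>m\<close> steps is a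
  contracting pattern with probability at least \<open>p\<close>. By Markov's inequality these blocks are
  completed before time \<open>t\<close> with probability at least \<open>1 - p / 2\<close> as long as
  \<open>k m \<le> p \<mu> t / 2\<close>, so that a number of blocks proportional to \<open>t\<close> contributes.\<close>

lemma expected_log_of_contraction:
  assumes conn: "strongly_connected_matrix P"
    and U: "U \<in> flow_semigroup B" "opnorm e U < 1"
  shows "\<exists>\<delta> T. 0 < \<delta> \<and>
    (\<forall>t\<ge>T. expectation (\<lambda>\<omega>. ln (opnorm e (flow A (\<sigma> \<omega>) t))) \<le> \<Lambda> * t - \<delta> * t)"
proof -
  \<comment> \<open>A contraction factor strictly between the norm of \<open>U\<close> and one leaves room for the perturbation
    of the holding times, and it is positive.\<close>
  define q where "q = (1 + opnorm e U) / 2"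
  have q: "0 < q" "q < 1" "opnorm e U < q"
    using U(2) opnorm_nonneg[OF e, of U] by (auto simp: q_def)
  have "\<forall>i. \<exists>y s l. y 0 = i \<and> (\<forall>k<l. 0 < P $ y k $ y (Suc k)) \<and> (\<forall>k\<le>l. 0 \<le> s k) \<and> U = wprod B y s (Suc l)"
    using semigroup_admissible[OF conn U(1)] unfolding admissible_def by blast
  then obtain y s l where y0: "\<And>i. y i 0 = i" and yP: "\<And>i k. k < l i \<Longrightarrow> 0 < P $ y i k $ y i (Suc k)"
    and s: "\<And>i k. k \<le> l i \<Longrightarrow> 0 \<le> s i k" and yU: "\<And>i. U = wprod B (y i) (s i) (Suc (l i))"
    by metis
  have "\<forall>i. \<exists>\<eta>>0. \<forall>s'. (\<forall>k<Suc (l i). s i k < s' k \<and> s' k \<le> s i k + \<eta>) \<longrightarrow>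
      opnorm e (wprod B (y i) s' (Suc (l i))) \<le> q"
  proof
    fix i
    have "opnorm e (wprod B (y i) (s i) (Suc (l i))) < q" using q(3) yU[of i] by metis
    then obtain \<eta> where "0 < \<eta>"
      "\<And>s'. (\<And>k. k < Suc (l i) \<Longrightarrow> s i k < s' k \<and> s' k \<le> s i k + \<eta>) \<Longrightarrow>
        opnorm e (wprod B (y i) s' (Suc (l i))) \<le> q"
      using contraction_neighbourhood[OF e] by metis
    then show "\<exists>\<eta>>0. \<forall>s'. (\<forall>k<Suc (l i). s i k < s' k \<and> s' k \<le> s i k + \<eta>) \<longrightarrow>
      opnorm e (wprod B (y i) s' (Suc (l i))) \<le> q" by blast
  qed
  then obtain h where h: "\<And>i. 0 < h i" "\<And>i s'. (\<And>k. k < Suc (l i) \<Longrightarrow> s i k < s' k \<and> s' k \<le> s i k + h i) \<Longrightarrow>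
      opnorm e (wprod B (y i) s' (Suc (l i))) \<le> q"
    by metis
  define \<eta> where "\<eta> = Min (range h)"
  have "\<eta> \<in> range h" unfolding \<eta>_def by (intro Min_in) auto
  then have \<eta>: "0 < \<eta>" using h(1) by auto
  have \<eta>_le: "\<eta> \<le> h i" for i unfolding \<eta>_def by (intro Min_le) auto
  have contr: "opnorm e (wprod B (y i) s' (Suc (l i))) \<le> q"
    if "\<And>k. k < Suc (l i) \<Longrightarrow> s i k < s' k \<and> s' k \<le> s i k + \<eta>" for i s'
    by (rule h(2)) (use that \<eta>_le[of i] in force)
  obtain p where p: "0 < p" "\<And>a. p \<le> prob (pattern_event y s l \<eta> a)"
    using prob_pattern_event[of y l s \<eta>] y0 yP s \<eta> by blast
  define m where "m = Suc (Max (range l))"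
  have m: "Suc (l i) \<le> m" for i unfolding m_def by simp
  have m_pos: "0 < real m" by (simp add: m_def)
  have block_bound: "expectation (\<lambda>\<omega>. ln (opnorm e (flow A (\<sigma> \<omega>) t))) \<le> \<Lambda> * t + ln q * (real k * (p / 2))"
    if t: "0 < t" and k: "real k * real m \<le> p * \<mu> * t / 2" for k t
  proof -
    have t0: "0 \<le> t" using t by simp
    define E where "E n = pattern_event y s l \<eta> (n * m) \<inter> {\<omega>\<in>space M. (\<Sum>j<(n + 1) * m. \<tau> j \<omega>) \<le> t}" for n
    have E_sets: "E n \<in> sets M" for n unfolding E_def by (intro sets.Int pattern_event_sets) measurable
    have "p / 2 \<le> prob (E n)" if n: "n < k" for n
    proof -
      let ?late = "{\<omega>\<in>space M. t < (\<Sum>j<(n + 1) * m. \<tau> j \<omega>)}"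
      have "p \<le> prob (pattern_event y s l \<eta> (n * m))" by (rule p)
      also have "\<dots> \<le> prob (E n \<union> ?late)"
        using sets.sets_into_space[OF pattern_event_sets[of y s l \<eta> "n * m"]]
        by (intro finite_measure_mono sets.Un E_sets) (auto simp: E_def)
      also have "\<dots> \<le> prob (E n) + prob ?late"
        by (intro measure_Un_le E_sets) measurable
      also have "prob ?late \<le> real ((n + 1) * m) / (\<mu> * t)" by (rule prob_jump_time_gt[OF t])
      also have "real ((n + 1) * m) / (\<mu> * t) \<le> (real k * real m) / (\<mu> * t)"
      proof (rule divide_right_mono)
        have "(n + 1) * m \<le> k * m" using n by (intro mult_right_mono) auto
        then show "real ((n + 1) * m) \<le> real k * real m" by (simp only: of_nat_mult[symmetric] of_nat_le_iff)
      qed (use mu_pos t in simp)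
      also have "\<dots> \<le> (p * \<mu> * t / 2) / (\<mu> * t)" using k mu_pos t by (intro divide_right_mono) auto
      also have "\<dots> = p / 2" using mu_pos t by simp
      finally show ?thesis by simp
    qed
    then have "(\<Sum>n<k. p / 2) \<le> (\<Sum>n<k. prob (E n))" by (intro sum_mono) auto
    then have sumE: "real k * (p / 2) \<le> (\<Sum>n<k. prob (E n))" by simp
    have "expectation (\<lambda>\<omega>. ln (opnorm e (flow A (\<sigma> \<omega>) t))) \<le> expectation (\<lambda>\<omega>. \<Lambda> * t + ln q * (\<Sum>n<k. indicator (E n) \<omega>))"
    proof (rule integral_mono[OF log_opnorm_integrable[OF e t0]])
      show "integrable M (\<lambda>\<omega>. \<Lambda> * t + ln q * (\<Sum>n<k. indicator (E n) \<omega>))"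
        using E_sets by (intro Bochner_Integration.integrable_add integrable_mult_right
            Bochner_Integration.integrable_sum integrable_real_indicator) (auto simp: emeasure_eq_measure)
      fix \<omega> assume \<omega>: "\<omega> \<in> space M"
      obtain n where n: "k * m \<le> n" "t \<le> (\<Sum>k<n. \<tau> k \<omega>)" using jump_time_exceeds[OF \<omega>] by blast
      have "ln (opnorm e (random_prod B t n \<omega>)) \<le> ln (opnorm e (random_prod B t (k * m) \<omega>))"
        by (intro ln_mono random_prod_pos random_prod_step_le e le1 n)
      also have "\<dots> \<le> ln q * (\<Sum>n<k. indicator (E n) \<omega>)"
        unfolding E_def by (rule random_prod_blocks[OF e le1 q(1) contr m \<omega>])
      finally show "ln (opnorm e (flow A (\<sigma> \<omega>) t)) \<le> \<Lambda> * t + ln q * (\<Sum>n<k. indicator (E n) \<omega>)"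
        by (simp add: log_opnorm_random_flow[OF \<omega> t0 n(2)])
    qed
    also have "\<dots> = \<Lambda> * t + ln q * (\<Sum>n<k. prob (E n))"
      using E_sets by (simp add: emeasure_eq_measure prob_space)
    also have "\<dots> \<le> \<Lambda> * t + ln q * (real k * (p / 2))"
      using sumE q by (intro add_left_mono mult_left_mono_neg) auto
    finally show ?thesis .
  qed
  \<comment> \<open>With \<open>c\<close> blocks per unit of time the expected duration of the blocks is at most \<open>p t / 2\<close>.
    Rounding down costs at most half of the blocks once \<open>c t \<ge> 2\<close>.\<close>
  define c where "c = p * \<mu> / (2 * real m)"
  have c: "0 < c" using p mu_pos m_pos by (simp add: c_def)
  define \<delta> where "\<delta> = - ln q * (c / 2) * (p / 2)"
  show ?thesis
  proof (rule exI[of _ \<delta>], rule exI[of _ "2 / c"], intro conjI allI impI)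
    show "0 < \<delta>" unfolding \<delta>_def using q c p by (intro mult_pos_pos) auto
    fix t assume t: "2 / c \<le> t"
    have t_pos: "0 < t" using t c by (meson divide_pos_pos less_le_trans zero_less_numeral)
    have ct: "2 \<le> c * t" using t c by (simp add: divide_le_eq mult.commute)
    define k where "k = nat \<lfloor>c * t\<rfloor>"
    have k: "real k \<le> c * t" "c * t / 2 \<le> real k" using ct unfolding k_def by linarith+
    have "real k * real m \<le> c * t * real m" using k(1) by (intro mult_right_mono) auto
    also have "\<dots> = p * \<mu> * t / 2" using m_pos by (simp add: c_def)
    finally have "expectation (\<lambda>\<omega>. ln (opnorm e (flow A (\<sigma> \<omega>) t))) \<le> \<Lambda> * t + ln q * (real k * (p / 2))"
      by (rule block_bound[OF t_pos])
    also have "\<dots> \<le> \<Lambda> * t + ln q * (c * t / 2 * (p / 2))"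
      using k(2) q p by (intro add_left_mono mult_left_mono_neg mult_right_mono) auto
    also have "\<dots> = \<Lambda> * t - \<delta> * t" by (simp add: \<delta>_def)
    finally show "expectation (\<lambda>\<omega>. ln (opnorm e (flow A (\<sigma> \<omega>) t))) \<le> \<Lambda> * t - \<delta> * t" .
  qed
qed

end

end

section \<open>The equivalence\<close>

lemma Limsup_rate_eq:
  fixes g :: "real \<Rightarrow> real"
  assumes "\<And>t. 0 \<le> t \<Longrightarrow> \<bar>g t - l * t\<bar> \<le> K"
  shows "real_of_ereal (Limsup at_top (\<lambda>t. ereal (1 / t * g t))) = l"
proof -
  have "((\<lambda>t. 1 / t * g t - l) \<longlongrightarrow> 0) at_top"
  proof (rule Lim_null_comparison)
    show "\<forall>\<^sub>F t in at_top. norm (1 / t * g t - l) \<le> K / t"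
      using eventually_gt_at_top[of 0]
    proof eventually_elim
      case (elim t)
      have "1 / t * g t - l = (g t - l * t) / t" using elim by (simp add: field_simps)
      then show ?case using assms[of t] elim by (simp add: divide_right_mono)
    qed
    show "((\<lambda>t. K / t) \<longlongrightarrow> 0) at_top" by (rule tendsto_divide_0[OF tendsto_const filterlim_at_top_imp_at_infinity[OF filterlim_ident]])
  qed
  then have "((\<lambda>t. ereal (1 / t * g t)) \<longlongrightarrow> ereal l) at_top"
    by (intro tendsto_ereal) (rule LIM_zero_cancel)
  from lim_imp_Limsup[OF _ this] show ?thesis by simp
qed

text \<open>The lower bound on \<open>g\<close> makes the upper limit finite: \<open>real_of_ereal\<close> maps \<open>-\<infinity>\<close> to zero, which
  need not be below \<open>l\<close>.\<close>

lemma Limsup_rate_less: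
  fixes g :: "real \<Rightarrow> real"
  assumes up: "\<And>t. T \<le> t \<Longrightarrow> g t \<le> l * t - \<delta> * t + K" and \<delta>: "0 < \<delta>"
    and low: "\<And>t. 0 \<le> t \<Longrightarrow> l * t - C * t - K \<le> g t"
  shows "real_of_ereal (Limsup at_top (\<lambda>t. ereal (1 / t * g t))) < l"
proof -
  let ?L = "Limsup at_top (\<lambda>t. ereal (1 / t * g t))"
  have "?L \<le> ereal (l - \<delta> / 2)"
  proof (rule Limsup_bounded)
    show "\<forall>\<^sub>F t in at_top. ereal (1 / t * g t) \<le> ereal (l - \<delta> / 2)"
      using eventually_ge_at_top[of T] eventually_gt_at_top[of 0] eventually_ge_at_top[of "2 * K / \<delta>"]
    proof eventually_elim
      case (elim t)
      have "K \<le> \<delta> / 2 * t" using elim(3) \<delta> by (simp add: divide_le_eq mult.commute)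
      then have "g t \<le> (l - \<delta> / 2) * t" using up[OF elim(1)] by (simp add: algebra_simps)
      then show ?case using elim(2) by (simp add: divide_le_eq)
    qed
  qed
  moreover have "ereal (l - C - \<bar>K\<bar>) \<le> ?L"
  proof (rule le_Limsup)
    show "\<forall>\<^sub>F t in at_top. ereal (l - C - \<bar>K\<bar>) \<le> ereal (1 / t * g t)"
      using eventually_ge_at_top[of 1]
    proof eventually_elim
      case (elim t)
      have "K \<le> \<bar>K\<bar> * t" using elim mult_left_mono[of 1 t "\<bar>K\<bar>"] by simp
      then have "(l - C - \<bar>K\<bar>) * t \<le> g t" using low[of t] elim by (simp add: algebra_simps)
      then show ?case using elim by (simp add: le_divide_eq)
    qed
  qed simp
  ultimately show ?thesis using \<delta> by (cases ?L) auto
qed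


text \<open>Used with the extremal norm and with the spectral radius in the role of \<open>\<phi>\<close>: both are positively
  homogeneous, so the shift of the generators absorbs the exponential.\<close>

lemma switched_prod_characterization:
  fixes A :: "'n \<Rightarrow> real^'d^'d"
  assumes hom: "\<And>c U. 0 < c \<Longrightarrow> \<phi> (c *\<^sub>R U) = c * \<phi> U"
  shows "(\<forall>k\<ge>1. \<forall>(i :: nat \<Rightarrow> 'n) t. (\<forall>j\<in>{1..k}. 0 \<le> t j) \<longrightarrow>
      \<phi> (switched_prod A i t k) = exp (l * (\<Sum>j=1..k. t j))) \<longleftrightarrow>
    (\<forall>U\<in>flow_semigroup (\<lambda>i. A i - l *\<^sub>R mat 1). \<phi> U = 1)"
    (is "?L \<longleftrightarrow> ?R")
proof -
  let ?B = "\<lambda>i. A i - l *\<^sub>R mat 1"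
  have sw: "\<phi> (switched_prod A i t k) =
      exp (l * (\<Sum>j=1..k. t j)) * \<phi> (wprod ?B (\<lambda>k. i (Suc k)) (\<lambda>k. t (Suc k)) k)"
    if "\<And>j. j \<in> {1..k} \<Longrightarrow> 0 \<le> t j" for i :: "nat \<Rightarrow> 'n" and t k
  proof -
    have "switched_prod A i t k =
        exp (l * (\<Sum>j<k. t (Suc j))) *\<^sub>R wprod ?B (\<lambda>k. i (Suc k)) (\<lambda>k. t (Suc k)) k"
      unfolding switched_prod_wprod by (rule wprod_shift) (simp add: that)
    then show ?thesis by (simp add: hom sum.atLeast1_atMost_eq)
  qed
  show ?thesis
  proof
    assume L: ?L
    show ?R
    proof
      fix U assume "U \<in> flow_semigroup ?B"
      then obtain z r n where zrn: "\<forall>k. 0 \<le> r k" "1 \<le> n" "U = wprod ?B z r n"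
        using semigroup_is_wprod by blast
      have "\<phi> (switched_prod A (\<lambda>k. z (k - 1)) (\<lambda>k. r (k - 1)) n) = exp (l * (\<Sum>j=1..n. r (j - 1)))"
        by (rule L[rule_format]) (use zrn in auto)
      moreover have "\<phi> (switched_prod A (\<lambda>k. z (k - 1)) (\<lambda>k. r (k - 1)) n) =
          exp (l * (\<Sum>j=1..n. r (j - 1))) * \<phi> U"
        using sw[of n "\<lambda>k. r (k - 1)" "\<lambda>k. z (k - 1)"] zrn by simp
      ultimately show "\<phi> U = 1" by simp
    qed
  next
    assume R: ?R
    show ?L
    proof (intro allI impI)
      fix k and i :: "nat \<Rightarrow> 'n" and t :: "nat \<Rightarrow> real"
      assume t: "\<forall>j\<in>{1..k}. 0 \<le> t j"
      have "\<phi> (wprod ?B (\<lambda>k. i (Suc k)) (\<lambda>k. t (Suc k)) k) = 1"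
        using R t by (intro R[rule_format] wprod_in_semigroup) auto
      then show "\<phi> (switched_prod A i t k) = exp (l * (\<Sum>j=1..k. t j))"
        using sw[of k t i] t by simp
    qed
  qed
qed

lemma irreducible_family_shift:
  assumes "irreducible_family A" shows "irreducible_family (\<lambda>i. A i - l *\<^sub>R mat 1)"
  unfolding irreducible_family_def
proof (intro allI impI)
  fix S assume S: "subspace S \<and> (\<forall>i. \<forall>x\<in>S. (A i - l *\<^sub>R mat 1) *v x \<in> S)"
  have "A i *v x \<in> S" if "x \<in> S" for i x
  proof -
    have "A i *v x = (A i - l *\<^sub>R mat 1) *v x + l *\<^sub>R x"
      by (simp add: matrix_vector_mult_diff_rdistrib matrix_vector_scaleR_left)
    then show ?thesis using S that by (metis subspace_add subspace_scale)
  qed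
  then show "S = {0} \<or> S = UNIV" using assms S unfolding irreducible_family_def by blast
qed

lemma extremal_norm_opnorm_le_one:
  assumes "extremal_norm v A e" and U: "U \<in> flow_semigroup (\<lambda>i. A i - lambda_d v A *\<^sub>R mat 1)"
  shows "opnorm e U \<le> 1"
  using U
proof induction
  case one
  show ?case using assms(1) by (simp add: extremal_norm_def opnorm_mat_1)
next
  case (step U t i)
  have e: "is_norm e" using assms(1) by (simp add: extremal_norm_def)
  let ?X = "mexp (t *\<^sub>R (A i - lambda_d v A *\<^sub>R mat 1))"
  have "\<forall>\<sigma>\<in>switching_signals. \<forall>t\<ge>0. opnorm e (flow A \<sigma> t) \<le> exp (lambda_d v A * t)"
    using assms(1) unfolding extremal_norm_def by (rule conjunct2)
  from this[rule_format, OF constant_switching_signal step(2)]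
  have "opnorm e (flow A (\<lambda>_. i) t) \<le> exp (lambda_d v A * t)" .
  then have "exp (lambda_d v A * t) * opnorm e ?X \<le> exp (lambda_d v A * t) * 1"
    by (simp add: flow_constant_signal step(2) mexp_shift[OF step(2), of "A i" "lambda_d v A"] opnorm_scaleR[OF e])
  then have X: "opnorm e ?X \<le> 1" by (simp only: mult_le_cancel_left_pos[OF exp_gt_zero])
  have "opnorm e (?X ** U) \<le> opnorm e ?X * opnorm e U" by (rule opnorm_matrix_mult[OF e])
  also have "\<dots> \<le> 1 * 1" by (intro mult_mono X step.IH opnorm_nonneg e) auto
  finally show ?case by simp
qed

lemma markov_process_jump_chain:
  assumes "markov_process M \<nu> \<mu> P \<sigma>" "0 < \<mu>"
  obtains Z \<tau> where "jump_chain M Z \<tau> P \<nu> \<mu>"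
    "\<And>\<omega> n t. \<omega> \<in> space M \<Longrightarrow> (\<Sum>k<n. \<tau> k \<omega>) \<le> t \<Longrightarrow> t < (\<Sum>k<Suc n. \<tau> k \<omega>) \<Longrightarrow> \<sigma> \<omega> t = Z n \<omega>"
  using assms
  unfolding markov_process_def jump_chain_def jump_chain_axioms_def by blast

lemma probabilistic_exponent_eq_iff:
  fixes A :: "'n::finite \<Rightarrow> real^'d^'d"
  assumes mp: "markov_process M \<nu> \<mu> P \<sigma>" "0 < \<mu>" and conn: "strongly_connected_matrix P"
    and v: "is_norm v" and ext: "extremal_norm v A e"
  shows "lambda_d v A = lambda_p v M \<sigma> A \<longleftrightarrow>
    (\<forall>U\<in>flow_semigroup (\<lambda>i. A i - lambda_d v A *\<^sub>R mat 1). opnorm e U = 1)"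
proof -
  have e: "is_norm e" using ext by (simp add: extremal_norm_def)
  obtain Z \<tau> where "jump_chain M Z \<tau> P \<nu> \<mu>" and
    sig: "\<And>\<omega> n t. \<omega> \<in> space M \<Longrightarrow> (\<Sum>k<n. \<tau> k \<omega>) \<le> t \<Longrightarrow> t < (\<Sum>k<Suc n. \<tau> k \<omega>) \<Longrightarrow> \<sigma> \<omega> t = Z n \<omega>"
    using markov_process_jump_chain[OF mp] by metis
  then interpret jump_chain M Z \<tau> P \<nu> \<mu> by simp
  note le1 = extremal_norm_opnorm_le_one[OF ext]
  define l where "l = lambda_d v A"
  define ge gv where "ge t = expectation (\<lambda>\<omega>. ln (opnorm e (flow A (\<sigma> \<omega>) t)))"
    and "gv t = expectation (\<lambda>\<omega>. ln (opnorm v (flow A (\<sigma> \<omega>) t)))" for t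
  have lp: "lambda_p v M \<sigma> A = real_of_ereal (Limsup at_top (\<lambda>t. ereal (1 / t * gv t)))"
    unfolding lambda_p_def gv_def ..
  have "\<exists>K. \<forall>t\<ge>0. \<bar>gv t - ge t\<bar> \<le> K"
    unfolding ge_def gv_def by (rule expected_log_comparison[OF sig e le1 v])
  then obtain K where K: "\<And>t. 0 \<le> t \<Longrightarrow> \<bar>gv t - ge t\<bar> \<le> K" by blast
  have "\<exists>C. \<forall>t\<ge>0. l * t - C * t \<le> ge t"
    unfolding ge_def l_def by (rule expected_log_bounds[OF sig e le1])
  then obtain C where C: "\<And>t. 0 \<le> t \<Longrightarrow> l * t - C * t \<le> ge t" by blast
  show ?thesis
  proof
    assume eq: "\<forall>U\<in>flow_semigroup (\<lambda>i. A i - lambda_d v A *\<^sub>R mat 1). opnorm e U = 1"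
    have "ge t = l * t" if "0 \<le> t" for t
      unfolding ge_def l_def by (rule expected_log_of_norm_one[OF sig e le1 _ that]) (use eq in blast)+
    then have "lambda_p v M \<sigma> A = l"
      unfolding lp using K by (intro Limsup_rate_eq[of gv l K]) force
    then show "lambda_d v A = lambda_p v M \<sigma> A" by (simp add: l_def)
  next
    assume eq: "lambda_d v A = lambda_p v M \<sigma> A"
    show "\<forall>U\<in>flow_semigroup (\<lambda>i. A i - lambda_d v A *\<^sub>R mat 1). opnorm e U = 1"
    proof (rule ccontr)
      assume "\<not> ?thesis"
      then obtain U where U: "U \<in> flow_semigroup (\<lambda>i. A i - lambda_d v A *\<^sub>R mat 1)" "opnorm e U < 1"
        using le1 by (metis order_le_less)
      have "\<exists>\<delta> T. 0 < \<delta> \<and> (\<forall>t\<ge>T. ge t \<le> l * t - \<delta> * t)"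
        unfolding ge_def l_def by (rule expected_log_of_contraction[OF sig e le1 conn U])
      then obtain \<delta> T where \<delta>: "0 < \<delta>" "\<And>t. T \<le> t \<Longrightarrow> ge t \<le> l * t - \<delta> * t" by blast
      have "lambda_p v M \<sigma> A < l"
        unfolding lp
      proof (rule Limsup_rate_less[of "max T 0" gv l \<delta> K C])
        show "gv t \<le> l * t - \<delta> * t + K" if "max T 0 \<le> t" for t
          using K[of t] \<delta>(2)[of t] that by linarith
        show "l * t - C * t - K \<le> gv t" if "0 \<le> t" for t
          using K[OF that] C[OF that] by linarith
      qed (rule \<delta>)
      then show False using eq by (simp add: l_def)
    qed
  qed
qed

theorem proposition4p1:
  fixes A :: "'n::finite \<Rightarrow> real^'d^'d"
    and P :: "real^'n^'n"
    and \<nu> :: "real^'n"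
    and \<mu> :: real
    and v e :: "real^'d \<Rightarrow> real"
    and M :: "'a measure"
    and \<sigma> :: "'a \<Rightarrow> real \<Rightarrow> 'n"
  assumes "stochastic_matrix P"
    and "strongly_connected_matrix P"
    and "probability_vector \<nu>"
    and "0 < \<mu>"
    and "is_norm v"
    and "irreducible_family A"
    and "extremal_norm v A e"
    and "markov_process M \<nu> \<mu> P \<sigma>"
  defines "a \<equiv> lambda_d v A = lambda_p v M \<sigma> A"
    and "b \<equiv> \<forall>k\<ge>1. \<forall>(i :: nat \<Rightarrow> 'n) (t :: nat \<Rightarrow> real). (\<forall>j\<in>{1..k}. 0 \<le> t j) \<longrightarrow>
                opnorm e (switched_prod A i t k) = exp (lambda_d v A * (\<Sum>j=1..k. t j))"
    and "c \<equiv> \<forall>k\<ge>1. \<forall>(i :: nat \<Rightarrow> 'n) (t :: nat \<Rightarrow> real). (\<forall>j\<in>{1..k}. 0 \<le> t j) \<longrightarrow>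
                spectral_radius (switched_prod A i t k) = exp (lambda_d v A * (\<Sum>j=1..k. t j))"
    and "d \<equiv> \<exists>Q :: real^'d^'d. invertible Q \<and>
                (\<forall>i. skew_symmetric (Q ** (A i - lambda_d v A *\<^sub>R mat 1) ** matrix_inv Q))"
  shows "(a \<longleftrightarrow> b) \<and> (b \<longleftrightarrow> c) \<and> (c \<longleftrightarrow> d)"
proof -
  define B where "B = (\<lambda>i. A i - lambda_d v A *\<^sub>R mat 1)"
  have e: "is_norm e" using assms(7) by (simp add: extremal_norm_def)
  have irr: "irreducible_family B" unfolding B_def by (rule irreducible_family_shift[OF assms(6)])
  have le1: "opnorm e U \<le> 1" if "U \<in> flow_semigroup B" for U
    using extremal_norm_opnorm_le_one[OF assms(7)] that unfolding B_def by blast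
  have a: "a \<longleftrightarrow> (\<forall>U\<in>flow_semigroup B. opnorm e U = 1)"
    unfolding a_def B_def
    by (rule probabilistic_exponent_eq_iff[OF assms(8) assms(4) assms(2) assms(5) assms(7)])
  have b: "b \<longleftrightarrow> (\<forall>U\<in>flow_semigroup B. opnorm e U = 1)"
    unfolding b_def B_def by (rule switched_prod_characterization) (simp add: opnorm_scaleR[OF e])
  have c: "c \<longleftrightarrow> (\<forall>U\<in>flow_semigroup B. spectral_radius U = 1)"
    unfolding c_def B_def by (rule switched_prod_characterization) (rule spectral_radius_scaleR)
  have d: "d \<longleftrightarrow> skew_in_common_basis B"
    unfolding d_def B_def skew_in_common_basis_def ..
  have bd: "b \<Longrightarrow> d"
    unfolding b d by (rule norm_one_imp_skew[OF irr e]) blast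
  have dc: "d \<Longrightarrow> c"
    unfolding c d skew_in_common_basis_def using isometry_spectral_radius skew_imp_isometry by metis
  have cb: "c \<Longrightarrow> b"
    unfolding b c using spectral_radius_one_imp_opnorm_ge[OF e] le1 by (metis antisym)
  show ?thesis using a b bd dc cb by blast
qed

end
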